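(* Let $\mathcal F=(P,F_p,\mu_{p,q})$ be a proper Ore diagram, that is, $P$ is an Ore monoid and $\mathcal F$ is a $P$-shaped diagram of rings with local units and proper smooth bimodules. Then the family $(\tilde\kappa_p)_{p\in P}$ of canonical maps $\tilde\kappa_p\colon F_p\to\mathcal O_{\mathcal F}$ is the universal covariant representation of $\mathcal F$, so that the $G$-graded ring $$\mathcal O_{\mathcal F}=\bigoplus_{g\in G}\ \varinjlim_{(p_1,p_2)\in R_g}\mathrm{Hom}_{-,F_1}(F_{p_2},F_{p_1})F_1$$ is a covariance ring of $\mathcal F$. That is, for any ring $D$ with local units, the map $f\mapsto(f\circ\tilde\kappa_p)_{p\in P}$ is a bijection from the set of nondegenerate ring homomorphisms $\mathcal O_{\mathcal F}\to D$ onto the set of covariant representations of $\mathcal F$ in $D$.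
   Context: **Rings.** Rings are associative, not necessarily unital. A ring $R$ has local units if for every finite subset $F\subseteq R$ there is an idempotent $e\in R$ with $er=r=re$ for all $r\in F$. Modules over such rings are smooth if the multiplication map $R\otimes_RM\to M$ (resp. $M\otimes_RR\to M$) is an isomorphism. A smooth $R,S$-bimodule $M$ is proper if for every idempotent $e\in R$ the right $S$-module $eM$ is finitely generated and projective. A ring homomorphism $f\colon A\to B$ is nondegenerate if $f(A)B=B$. **Diagram.** It consists of a ring $F_1$ with local units, smooth proper $F_1,F_1$-bimodules $F_p$ for $p\in P$ (with $F_1$ itself for $p=1$), and bimodule isomorphisms $\mu_{p,q}\colon F_p\otimes_{F_1}F_q\to F_{pq}$, with $\mu_{1,q},\mu_{q,1}$ the canonical maps and $\mu_{pq,t}(\mu_{p,q}\otimes\mathrm{id})=\mu_{p,qt}(\mathrm{id}\otimes\mu_{q,t})$. **Covariant representation** of $\mathcal F$ in a ring $D$ with local units: additive maps $\tilde\nu_p\colon F_p\to D$, $p\in P$, with $\tilde\nu_p(x)\tilde\nu_q(y)=\tilde\nu_{pq}(\mu_{p,q}(x\otimes y))$ such that all maps $F_p\otimes_{F_1}D\to D$, $x\otimes d\mapsto\tilde\nu_p(x)d$, are isomorphisms. A covariance ring is a ring with local units representing the functor $D\mapsto\{\text{covariant representations in }D\}$ on the category of rings with local units and nondegenerate homomorphisms. **Ore monoid.** A monoid $P$ such that (O1) for all $x_1,x_2\in P$ there are $y_1,y_2\in P$ with $x_1y_1=x_2y_2$; (O2) if $xy_1=xy_2$, there is $z\in P$ with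 $y_1z=y_2z$. Its group completion $G$ is $P\times P$ modulo $(p_1,p_2)\sim(q_1,q_2)$ iff there are $t_1,t_2\in P$ with $p_1t_1=q_1t_2$, $p_2t_1=q_2t_2$; the class of $(p_1,p_2)$ is written $p_1p_2^{-1}$, and $p_1p_2^{-1}\cdot q_1q_2^{-1}=(p_1t_1)(q_2t_2)^{-1}$ if $p_2t_1=q_1t_2$. For $g\in G$, $R_g=\{(p_1,p_2)\in P^2 : p_1p_2^{-1}=g\}$; it is the object set of a filtered category with arrows $(p_1,p_2,q)\colon(p_1,p_2)\to(p_1q,p_2q)$, $q\in P$. **The ring $\mathcal O_{\mathcal F}$.** $\mathrm{Hom}_{-,F_1}(F_{p_2},F_{p_1})$ is the space of right $F_1$-module maps, an $F_1$-bimodule by $(a\cdot f\cdot b)(x)=a f(bx)$; $\mathrm{Hom}_{-,F_1}(F_{p_2},F_{p_1})F_1$ is its subbimodule on which the right $F_1$-action is nondegenerate. For $q\in P$ let $\varphi_{p_1,p_2,q}(T)=\mu_{p_1,q}\circ(T\otimes_{F_1}\mathrm{id}_{F_q})\circ\mu_{p_2,q}^{-1}\in\mathrm{Hom}_{-,F_1}(F_{p_2q},F_{p_1q})F_1$. These maps form a filtered diagram over $R_g$; its inductive limit is $\mathcal O_g$, with elements $[x,(p_1,p_2)]$. The multiplication $\mathcal O_g\times\mathcal O_h\to\mathcal O_{gh}$ is $[x,(p_1,p_2)]\cdot[y,(q_1,q_2)]=[\varphi_{p_1,p_2,t_1}(x)\circ\varphi_{q_1,q_2,t_2}(y),(p_1t_1,q_2t_2)]$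 for any $t_1,t_2\in P$ with $p_2t_1=q_1t_2$; it is well defined and makes $\mathcal O_{\mathcal F}=\bigoplus_{g\in G}\mathcal O_g$ a ring with local units. The map $\tilde\kappa_p\colon F_p\cong\mathrm{Hom}_{-,F_1}(F_1,F_p)F_1\to\mathcal O_{p1^{-1}}\subseteq\mathcal O_{\mathcal F}$ sends $x\in F_p$ to the class of the map $F_1\to F_p$, $z\mapsto x\cdot z$, at $(p,1)\in R_{p1^{-1}}$. *)

theory Defs
  imports "HOL-Algebra.Free_Abelian_Groups" "HOL-Algebra.Module" "HOL-Algebra.AbelCoset"
begin

section \<open>Rings with local units and their modules\<close>

text \<open>
  Rings are not necessarily unital.  They are represented by the ring records of the library,
  whose component \<^const>\<open>one\<close> carries no meaning here.
\<close>

locale nonunital_ring = abelian_group R for R (structure) +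
  assumes m_closed: "\<lbrakk>x \<in> carrier R; y \<in> carrier R\<rbrakk> \<Longrightarrow> x \<otimes> y \<in> carrier R"
    and m_assoc: "\<lbrakk>x \<in> carrier R; y \<in> carrier R; z \<in> carrier R\<rbrakk>
      \<Longrightarrow> (x \<otimes> y) \<otimes> z = x \<otimes> (y \<otimes> z)"
    and l_distr: "\<lbrakk>x \<in> carrier R; y \<in> carrier R; z \<in> carrier R\<rbrakk>
      \<Longrightarrow> (x \<oplus> y) \<otimes> z = x \<otimes> z \<oplus> y \<otimes> z"
    and r_distr: "\<lbrakk>x \<in> carrier R; y \<in> carrier R; z \<in> carrier R\<rbrakk>
      \<Longrightarrow> z \<otimes> (x \<oplus> y) = z \<otimes> x \<oplus> z \<otimes> y"

definition idempotents :: "('a, 'm) ring_scheme \<Rightarrow> 'a set" where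
  "idempotents R = {e \<in> carrier R. e \<otimes>\<^bsub>R\<^esub> e = e}"

locale ring_with_local_units = nonunital_ring +
  assumes local_units: "\<lbrakk>finite X; X \<subseteq> carrier R\<rbrakk>
    \<Longrightarrow> \<exists>e\<in>idempotents R. \<forall>x\<in>X. e \<otimes> x = x \<and> x \<otimes> e = x"

text \<open>
  Additive groups with a left action \<^const>\<open>smult\<close> of a ring and a right action \<open>ract\<close> of
  another.  One-sided modules are given by the same records, with the other action ignored.
\<close>

record ('l, 'a, 'r) bimodule = "('l, 'a) module" +
  ract :: "'a \<Rightarrow> 'r \<Rightarrow> 'a"  (infixl \<open>\<triangleleft>\<index>\<close> 70)

locale left_module = R?: nonunital_ring R + M?: abelian_group M
  for R (structure) and M :: "('r, 'a, 's) bimodule" (structure) +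
  assumes lact_closed: "\<lbrakk>a \<in> carrier R; x \<in> carrier M\<rbrakk> \<Longrightarrow> a \<odot>\<^bsub>M\<^esub> x \<in> carrier M"
    and lact_add_ring: "\<lbrakk>a \<in> carrier R; b \<in> carrier R; x \<in> carrier M\<rbrakk>
      \<Longrightarrow> (a \<oplus>\<^bsub>R\<^esub> b) \<odot>\<^bsub>M\<^esub> x = a \<odot>\<^bsub>M\<^esub> x \<oplus>\<^bsub>M\<^esub> b \<odot>\<^bsub>M\<^esub> x"
    and lact_add_module: "\<lbrakk>a \<in> carrier R; x \<in> carrier M; y \<in> carrier M\<rbrakk>
      \<Longrightarrow> a \<odot>\<^bsub>M\<^esub> (x \<oplus>\<^bsub>M\<^esub> y) = a \<odot>\<^bsub>M\<^esub> x \<oplus>\<^bsub>M\<^esub> a \<odot>\<^bsub>M\<^esub> y"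
    and lact_mult: "\<lbrakk>a \<in> carrier R; b \<in> carrier R; x \<in> carrier M\<rbrakk>
      \<Longrightarrow> (a \<otimes>\<^bsub>R\<^esub> b) \<odot>\<^bsub>M\<^esub> x = a \<odot>\<^bsub>M\<^esub> (b \<odot>\<^bsub>M\<^esub> x)"

locale right_module = S?: nonunital_ring S + M?: abelian_group M
  for S (structure) and M :: "('r, 'a, 's) bimodule" (structure) +
  assumes ract_closed: "\<lbrakk>b \<in> carrier S; x \<in> carrier M\<rbrakk> \<Longrightarrow> x \<triangleleft>\<^bsub>M\<^esub> b \<in> carrier M"
    and ract_add_ring: "\<lbrakk>a \<in> carrier S; b \<in> carrier S; x \<in> carrier M\<rbrakk>
      \<Longrightarrow> x \<triangleleft>\<^bsub>M\<^esub> (a \<oplus>\<^bsub>S\<^esub> b) = x \<triangleleft>\<^bsub>M\<^esub> a \<oplus>\<^bsub>M\<^esub> x \<triangleleft>\<^bsub>M\<^esub> b"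
    and ract_add_module: "\<lbrakk>b \<in> carrier S; x \<in> carrier M; y \<in> carrier M\<rbrakk>
      \<Longrightarrow> (x \<oplus>\<^bsub>M\<^esub> y) \<triangleleft>\<^bsub>M\<^esub> b = x \<triangleleft>\<^bsub>M\<^esub> b \<oplus>\<^bsub>M\<^esub> y \<triangleleft>\<^bsub>M\<^esub> b"
    and ract_mult: "\<lbrakk>a \<in> carrier S; b \<in> carrier S; x \<in> carrier M\<rbrakk>
      \<Longrightarrow> x \<triangleleft>\<^bsub>M\<^esub> (a \<otimes>\<^bsub>S\<^esub> b) = (x \<triangleleft>\<^bsub>M\<^esub> a) \<triangleleft>\<^bsub>M\<^esub> b"

locale bimodule = left_module R M + right_module S M
  for R (structure) and S (structure) and M :: "('r, 'a, 's) bimodule" (structure) +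
  assumes lact_ract: "\<lbrakk>a \<in> carrier R; x \<in> carrier M; b \<in> carrier S\<rbrakk>
    \<Longrightarrow> (a \<odot>\<^bsub>M\<^esub> x) \<triangleleft>\<^bsub>M\<^esub> b = a \<odot>\<^bsub>M\<^esub> (x \<triangleleft>\<^bsub>M\<^esub> b)"

definition regular_bimodule :: "('a, 'm) ring_scheme \<Rightarrow> ('a, 'a, 'a) bimodule" where
  "regular_bimodule R =
    \<lparr>carrier = carrier R, mult = mult R, one = one R, zero = zero R, add = add R,
     smult = mult R, ract = mult R\<rparr>"

definition bimodule_iso ::
  "('r, 'k) ring_scheme \<Rightarrow> ('s, 'm) ring_scheme \<Rightarrow> ('r, 'a, 's) bimodule
    \<Rightarrow> ('r, 'b, 's) bimodule \<Rightarrow> ('a \<Rightarrow> 'b) set" where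
  "bimodule_iso R S M N =
    {h \<in> iso (add_monoid M) (add_monoid N).
      (\<forall>a\<in>carrier R. \<forall>x\<in>carrier M. h (a \<odot>\<^bsub>M\<^esub> x) = a \<odot>\<^bsub>N\<^esub> h x) \<and>
      (\<forall>x\<in>carrier M. \<forall>b\<in>carrier S. h (x \<triangleleft>\<^bsub>M\<^esub> b) = h x \<triangleleft>\<^bsub>N\<^esub> b)}"

text \<open>Right module maps are extensional, so that equal maps are equal as functions.\<close>

definition right_hom ::
  "('s, 'm) ring_scheme \<Rightarrow> ('r, 'a, 's) bimodule \<Rightarrow> ('t, 'b, 's) bimodule \<Rightarrow> ('a \<Rightarrow> 'b) set" where
  "right_hom S M N =
    {f \<in> carrier M \<rightarrow>\<^sub>E carrier N.
      f \<in> hom (add_monoid M) (add_monoid N) \<and>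
      (\<forall>x\<in>carrier M. \<forall>b\<in>carrier S. f (x \<triangleleft>\<^bsub>M\<^esub> b) = f x \<triangleleft>\<^bsub>N\<^esub> b)}"


section \<open>Balanced tensor products\<close>

text \<open>
  The tensor product \<open>M \<otimes>\<^sub>R N\<close> is the free Abelian group on pairs modulo the usual relations; its
  elements are cosets of formal integer combinations of pairs.
\<close>

definition tensor_relations ::
  "('r, 'm) ring_scheme \<Rightarrow> ('l, 'a, 'r) bimodule \<Rightarrow> ('r, 'b, 's) bimodule
    \<Rightarrow> (('a \<times> 'b) \<Rightarrow>\<^sub>0 int) set" where
  "tensor_relations R M N =
    {frag_of (x \<oplus>\<^bsub>M\<^esub> x', y) - frag_of (x, y) - frag_of (x', y) | x x' y.
      x \<in> carrier M \<and> x' \<in> carrier M \<and> y \<in> carrier N} \<union>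
    {frag_of (x, y \<oplus>\<^bsub>N\<^esub> y') - frag_of (x, y) - frag_of (x, y') | x y y'.
      x \<in> carrier M \<and> y \<in> carrier N \<and> y' \<in> carrier N} \<union>
    {frag_of (x \<triangleleft>\<^bsub>M\<^esub> r, y) - frag_of (x, r \<odot>\<^bsub>N\<^esub> y) | x r y.
      x \<in> carrier M \<and> r \<in> carrier R \<and> y \<in> carrier N}"

definition tensor_coset ::
  "('r, 'm) ring_scheme \<Rightarrow> ('l, 'a, 'r) bimodule \<Rightarrow> ('r, 'b, 's) bimodule
    \<Rightarrow> (('a \<times> 'b) \<Rightarrow>\<^sub>0 int) \<Rightarrow> (('a \<times> 'b) \<Rightarrow>\<^sub>0 int) set" where
  "tensor_coset R M N c =
    generate (free_Abelian_group (carrier M \<times> carrier N)) (tensor_relations R M N)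
      #>\<^bsub>free_Abelian_group (carrier M \<times> carrier N)\<^esub> c"

definition tensor_elem ::
  "('r, 'm) ring_scheme \<Rightarrow> ('l, 'a, 'r) bimodule \<Rightarrow> ('r, 'b, 's) bimodule
    \<Rightarrow> 'a \<Rightarrow> 'b \<Rightarrow> (('a \<times> 'b) \<Rightarrow>\<^sub>0 int) set" where
  "tensor_elem R M N x y = tensor_coset R M N (frag_of (x, y))"

text \<open>
  The map \<open>f \<otimes> g : M \<otimes>\<^sub>R N \<rightarrow> M' \<otimes>\<^sub>R N'\<close>: every representative of a coset is sent to the same
  coset if \<open>f\<close> is right \<open>R\<close>-linear and \<open>g\<close> is left \<open>R\<close>-linear.
\<close>

definition tensor_map ::
  "('r, 'm) ring_scheme \<Rightarrow> ('l, 'a, 'r) bimodule \<Rightarrow> ('r, 'b, 's) bimodule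
    \<Rightarrow> ('k, 'c, 'r) bimodule \<Rightarrow> ('r, 'd, 't) bimodule
    \<Rightarrow> ('a \<Rightarrow> 'c) \<Rightarrow> ('b \<Rightarrow> 'd)
    \<Rightarrow> (('a \<times> 'b) \<Rightarrow>\<^sub>0 int) set \<Rightarrow> (('c \<times> 'd) \<Rightarrow>\<^sub>0 int) set" where
  "tensor_map R M N M' N' f g X =
    the_elem ((\<lambda>c. tensor_coset R M' N'
      (frag_extend (\<lambda>(x, y). frag_of (f x, g y)) c)) ` X)"

definition tensor ::
  "('r, 'm) ring_scheme \<Rightarrow> ('l, 'a, 'r) bimodule \<Rightarrow> ('r, 'b, 's) bimodule
    \<Rightarrow> ('l, (('a \<times> 'b) \<Rightarrow>\<^sub>0 int) set, 's) bimodule" where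
  "tensor R M N =
    (let A = free_Abelian_group (carrier M \<times> carrier N);
         T = A Mod generate A (tensor_relations R M N)
     in \<lparr>carrier = carrier T, mult = undefined, one = undefined,
         zero = one T, add = mult T,
         smult = (\<lambda>a. tensor_map R M N M N (\<lambda>x. a \<odot>\<^bsub>M\<^esub> x) (\<lambda>y. y)),
         ract = (\<lambda>X b. tensor_map R M N M N (\<lambda>x. x) (\<lambda>y. y \<triangleleft>\<^bsub>N\<^esub> b) X)\<rparr>)"

text \<open>
  The additive map \<open>M \<otimes>\<^sub>R N \<rightarrow> K\<close> with \<open>x \<otimes> y \<mapsto> \<beta> x y\<close> is an isomorphism.  There is at most one
  such map because the elements \<open>x \<otimes> y\<close> generate the tensor product.
\<close>

definition tensor_iso_by ::
  "('r, 'm) ring_scheme \<Rightarrow> ('l, 'a, 'r) bimodule \<Rightarrow> ('r, 'b, 's) bimodule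
    \<Rightarrow> ('c, 'n) ring_scheme \<Rightarrow> ('a \<Rightarrow> 'b \<Rightarrow> 'c) \<Rightarrow> bool" where
  "tensor_iso_by R M N K \<beta> \<longleftrightarrow>
    (\<exists>h \<in> iso (add_monoid (tensor R M N)) (add_monoid K).
      \<forall>x\<in>carrier M. \<forall>y\<in>carrier N. h (tensor_elem R M N x y) = \<beta> x y)"


section \<open>Smooth and proper bimodules\<close>

definition smooth_left :: "('r, 'm) ring_scheme \<Rightarrow> ('r, 'a, 's) bimodule \<Rightarrow> bool" where
  "smooth_left R M \<longleftrightarrow> tensor_iso_by R (regular_bimodule R) M M (\<lambda>a x. a \<odot>\<^bsub>M\<^esub> x)"

definition smooth_right :: "('s, 'm) ring_scheme \<Rightarrow> ('r, 'a, 's) bimodule \<Rightarrow> bool" where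
  "smooth_right S M \<longleftrightarrow> tensor_iso_by S M (regular_bimodule S) M (\<lambda>x b. x \<triangleleft>\<^bsub>M\<^esub> b)"

locale smooth_bimodule = bimodule +
  assumes smooth_left: "smooth_left R M"
    and smooth_right: "smooth_right S M"

definition fin_gen_right :: "('s, 'm) ring_scheme \<Rightarrow> ('r, 'a, 's) bimodule \<Rightarrow> bool" where
  "fin_gen_right S M \<longleftrightarrow>
    (\<exists>X. finite X \<and> X \<subseteq> carrier M \<and>
      (\<forall>N. additive_subgroup N M \<and> X \<subseteq> N \<and> (\<forall>x\<in>N. \<forall>b\<in>carrier S. x \<triangleleft>\<^bsub>M\<^esub> b \<in> N)
        \<longrightarrow> N = carrier M))"

text \<open>
  Projectivity in the category of smooth right \<open>S\<close>-modules, by lifting along surjections \<open>N \<rightarrow> Q\<close>.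
  Test modules have to be restricted to fixed types.  This loses nothing:
  \<open>Q = M\<close> is allowed, and so is \<open>N = \<Oplus>\<^bsub>x \<in> M\<^esub> e\<^sub>x S\<close> with idempotents \<open>e\<^sub>x\<close> such that
  \<open>x = x e\<^sub>x\<close>, whose elements are functions of type \<open>'a \<Rightarrow> 's\<close>.  This \<open>N\<close> maps onto \<open>M\<close> and
  is projective, so that \<open>M\<close>, being a direct summand, lifts along all surjections.
\<close>

definition projective_right :: "('s, 'm) ring_scheme \<Rightarrow> ('r, 'a, 's) bimodule \<Rightarrow> bool" where
  "projective_right S M \<longleftrightarrow>
    (\<forall>(N :: ('r, 'a \<Rightarrow> 's, 's) bimodule) (Q :: ('r, 'a, 's) bimodule) g f.
      right_module S N \<and> smooth_right S N \<and> right_module S Q \<and> smooth_right S Q \<and>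
      g \<in> right_hom S N Q \<and> g ` carrier N = carrier Q \<and> f \<in> right_hom S M Q
      \<longrightarrow> (\<exists>h\<in>right_hom S M N. \<forall>x\<in>carrier M. g (h x) = f x))"

definition corner :: "'r \<Rightarrow> ('r, 'a, 's) bimodule \<Rightarrow> ('r, 'a, 's) bimodule" where
  "corner e M = M\<lparr>carrier := (\<lambda>x. e \<odot>\<^bsub>M\<^esub> x) ` carrier M\<rparr>"

locale proper_bimodule = smooth_bimodule +
  assumes corner_fin_gen: "e \<in> idempotents R \<Longrightarrow> fin_gen_right S (corner e M)"
    and corner_projective: "e \<in> idempotents R \<Longrightarrow> projective_right S (corner e M)"


section \<open>Ore monoids\<close>

locale ore_monoid = monoid P for P (structure) +
  assumes ore_common: "\<lbrakk>x1 \<in> carrier P; x2 \<in> carrier P\<rbrakk>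
      \<Longrightarrow> \<exists>y1\<in>carrier P. \<exists>y2\<in>carrier P. x1 \<otimes> y1 = x2 \<otimes> y2"
    and ore_cancel: "\<lbrakk>x \<in> carrier P; y1 \<in> carrier P; y2 \<in> carrier P; x \<otimes> y1 = x \<otimes> y2\<rbrakk>
      \<Longrightarrow> \<exists>z\<in>carrier P. y1 \<otimes> z = y2 \<otimes> z"

definition ore_rel :: "('p, 'm) monoid_scheme \<Rightarrow> (('p \<times> 'p) \<times> ('p \<times> 'p)) set" where
  "ore_rel P =
    {((p1, p2), (q1, q2)).
      p1 \<in> carrier P \<and> p2 \<in> carrier P \<and> q1 \<in> carrier P \<and> q2 \<in> carrier P \<and>
      (\<exists>t1\<in>carrier P. \<exists>t2\<in>carrier P.
        p1 \<otimes>\<^bsub>P\<^esub> t1 = q1 \<otimes>\<^bsub>P\<^esub> t2 \<and> p2 \<otimes>\<^bsub>P\<^esub> t1 = q2 \<otimes>\<^bsub>P\<^esub> t2)}"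

definition ore_frac :: "('p, 'm) monoid_scheme \<Rightarrow> 'p \<Rightarrow> 'p \<Rightarrow> ('p \<times> 'p) set" where
  "ore_frac P p1 p2 = ore_rel P `` {(p1, p2)}"

text \<open>
  Here and below, operations on equivalence classes are defined with \<^const>\<open>the_elem\<close>, applied to the
  set of results for all admissible choices, which is a singleton.
\<close>

definition ore_group :: "('p, 'm) monoid_scheme \<Rightarrow> ('p \<times> 'p) set monoid" where
  "ore_group P =
    \<lparr>carrier = (carrier P \<times> carrier P) // ore_rel P,
     mult = (\<lambda>g h. the_elem
       {ore_frac P (p1 \<otimes>\<^bsub>P\<^esub> t1) (q2 \<otimes>\<^bsub>P\<^esub> t2) | p1 p2 q1 q2 t1 t2.
         (p1, p2) \<in> g \<and> (q1, q2) \<in> h \<and> t1 \<in> carrier P \<and> t2 \<in> carrier P \<and>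
         p2 \<otimes>\<^bsub>P\<^esub> t1 = q1 \<otimes>\<^bsub>P\<^esub> t2}),
     one = ore_frac P \<one>\<^bsub>P\<^esub> \<one>\<^bsub>P\<^esub>\<rparr>"

definition ore_reps :: "('p, 'm) monoid_scheme \<Rightarrow> ('p \<times> 'p) set \<Rightarrow> ('p \<times> 'p) set" where
  "ore_reps P g = {(p1, p2). p1 \<in> carrier P \<and> p2 \<in> carrier P \<and> ore_frac P p1 p2 = g}"


section \<open>Proper Ore diagrams\<close>

text \<open>
  The bimodules \<open>F\<^sub>p\<close> all have carriers in one type.  The ring \<open>F\<^sub>1\<close> is the record \<open>F \<one>\<close> with its
  ring multiplication; the multiplication components of the records \<open>F p\<close> for \<open>p \<noteq> \<one>\<close> are
  ignored.
\<close>

locale proper_ore_diagram = ore_monoid P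
  for P :: "'p monoid" (structure)
    and F :: "'p \<Rightarrow> ('a, 'a, 'a) bimodule"
    and \<mu> :: "'p \<Rightarrow> 'p \<Rightarrow> (('a \<times> 'a) \<Rightarrow>\<^sub>0 int) set \<Rightarrow> 'a" +
  assumes base_ring: "ring_with_local_units (F \<one>)"
    and base_lact: "\<lbrakk>a \<in> carrier (F \<one>); x \<in> carrier (F \<one>)\<rbrakk>
      \<Longrightarrow> a \<odot>\<^bsub>F \<one>\<^esub> x = a \<otimes>\<^bsub>F \<one>\<^esub> x"
    and base_ract: "\<lbrakk>a \<in> carrier (F \<one>); x \<in> carrier (F \<one>)\<rbrakk>
      \<Longrightarrow> x \<triangleleft>\<^bsub>F \<one>\<^esub> a = x \<otimes>\<^bsub>F \<one>\<^esub> a"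
    and proper: "p \<in> carrier P \<Longrightarrow> proper_bimodule (F \<one>) (F \<one>) (F p)"
    and mu_iso: "\<lbrakk>p \<in> carrier P; q \<in> carrier P\<rbrakk>
      \<Longrightarrow> \<mu> p q \<in> bimodule_iso (F \<one>) (F \<one>) (tensor (F \<one>) (F p) (F q)) (F (p \<otimes> q))"
    and mu_one_left: "\<lbrakk>q \<in> carrier P; a \<in> carrier (F \<one>); x \<in> carrier (F q)\<rbrakk>
      \<Longrightarrow> \<mu> \<one> q (tensor_elem (F \<one>) (F \<one>) (F q) a x) = a \<odot>\<^bsub>F q\<^esub> x"
    and mu_one_right: "\<lbrakk>q \<in> carrier P; x \<in> carrier (F q); a \<in> carrier (F \<one>)\<rbrakk>
      \<Longrightarrow> \<mu> q \<one> (tensor_elem (F \<one>) (F q) (F \<one>) x a) = x \<triangleleft>\<^bsub>F q\<^esub> a"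
    and mu_assoc: "\<lbrakk>p \<in> carrier P; q \<in> carrier P; t \<in> carrier P;
        x \<in> carrier (F p); y \<in> carrier (F q); z \<in> carrier (F t)\<rbrakk>
      \<Longrightarrow> \<mu> (p \<otimes> q) t (tensor_elem (F \<one>) (F (p \<otimes> q)) (F t)
            (\<mu> p q (tensor_elem (F \<one>) (F p) (F q) x y)) z)
        = \<mu> p (q \<otimes> t) (tensor_elem (F \<one>) (F p) (F (q \<otimes> t))
            x (\<mu> q t (tensor_elem (F \<one>) (F q) (F t) y z)))"


section \<open>Covariant representations\<close>

definition nondegenerate_hom ::
  "('a, 'm) ring_scheme \<Rightarrow> ('b, 'n) ring_scheme \<Rightarrow> ('a \<Rightarrow> 'b) \<Rightarrow> bool" where
  "nondegenerate_hom A B f \<longleftrightarrow>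
    generate (add_monoid B) {f a \<otimes>\<^bsub>B\<^esub> b | a b. a \<in> carrier A \<and> b \<in> carrier B} = carrier B"

definition nondegenerate_ring_homs ::
  "('a, 'm) ring_scheme \<Rightarrow> ('b, 'n) ring_scheme \<Rightarrow> ('a \<Rightarrow> 'b) set" where
  "nondegenerate_ring_homs A B =
    {f \<in> carrier A \<rightarrow>\<^sub>E carrier B.
      f \<in> hom (add_monoid A) (add_monoid B) \<and>
      (\<forall>x\<in>carrier A. \<forall>y\<in>carrier A. f (x \<otimes>\<^bsub>A\<^esub> y) = f x \<otimes>\<^bsub>B\<^esub> f y) \<and>
      nondegenerate_hom A B f}"

text \<open>\<open>D\<close> as a left module along \<open>f\<close>.\<close>

definition pullback_bimodule ::
  "('a \<Rightarrow> 'd) \<Rightarrow> ('d, 'm) ring_scheme \<Rightarrow> ('a, 'd, 'd) bimodule" where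
  "pullback_bimodule f D =
    \<lparr>carrier = carrier D, mult = mult D, one = one D, zero = zero D, add = add D,
     smult = (\<lambda>a d. f a \<otimes>\<^bsub>D\<^esub> d), ract = mult D\<rparr>"

definition covariant_representations ::
  "'p monoid \<Rightarrow> ('p \<Rightarrow> ('a, 'a, 'a) bimodule)
    \<Rightarrow> ('p \<Rightarrow> 'p \<Rightarrow> (('a \<times> 'a) \<Rightarrow>\<^sub>0 int) set \<Rightarrow> 'a)
    \<Rightarrow> ('d, 'm) ring_scheme \<Rightarrow> ('p \<Rightarrow> 'a \<Rightarrow> 'd) set" where
  "covariant_representations P F \<mu> D =
    {\<nu> \<in> extensional (carrier P).
      (\<forall>p\<in>carrier P. \<nu> p \<in> extensional (carrier (F p)) \<and>
        \<nu> p \<in> hom (add_monoid (F p)) (add_monoid D)) \<and>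
      (\<forall>p\<in>carrier P. \<forall>q\<in>carrier P. \<forall>x\<in>carrier (F p). \<forall>y\<in>carrier (F q).
        \<nu> p x \<otimes>\<^bsub>D\<^esub> \<nu> q y
          = \<nu> (p \<otimes>\<^bsub>P\<^esub> q) (\<mu> p q (tensor_elem (F \<one>\<^bsub>P\<^esub>) (F p) (F q) x y))) \<and>
      (\<forall>p\<in>carrier P. tensor_iso_by (F \<one>\<^bsub>P\<^esub>) (F p) (pullback_bimodule (\<nu> \<one>\<^bsub>P\<^esub>) D) D
        (\<lambda>x d. \<nu> p x \<otimes>\<^bsub>D\<^esub> d))}"


section \<open>The ring of a proper Ore diagram\<close>

definition hom_bimodule ::
  "('s, 'm) ring_scheme \<Rightarrow> ('r, 'a, 's) bimodule \<Rightarrow> ('t, 'b, 's) bimodule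
    \<Rightarrow> ('t, 'a \<Rightarrow> 'b, 'r) bimodule" where
  "hom_bimodule S M N =
    \<lparr>carrier = right_hom S M N, mult = undefined, one = undefined,
     zero = (\<lambda>x\<in>carrier M. \<zero>\<^bsub>N\<^esub>),
     add = (\<lambda>f g. \<lambda>x\<in>carrier M. f x \<oplus>\<^bsub>N\<^esub> g x),
     smult = (\<lambda>a f. \<lambda>x\<in>carrier M. a \<odot>\<^bsub>N\<^esub> f x),
     ract = (\<lambda>f b. \<lambda>x\<in>carrier M. f (b \<odot>\<^bsub>M\<^esub> x))\<rparr>"

text \<open>\<open>Hom\<^bsub>-,F\<^sub>1\<^esub>(F\<^bsub>p2\<^esub>, F\<^bsub>p1\<^esub>) F\<^sub>1\<close>, the additive span of the products \<open>f \<cdot> b\<close>.\<close>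

definition diagram_hom ::
  "'p monoid \<Rightarrow> ('p \<Rightarrow> ('a, 'a, 'a) bimodule) \<Rightarrow> 'p \<Rightarrow> 'p \<Rightarrow> ('a \<Rightarrow> 'a) set" where
  "diagram_hom P F p1 p2 =
    (let H = hom_bimodule (F \<one>\<^bsub>P\<^esub>) (F p2) (F p1)
     in generate (add_monoid H) {f \<triangleleft>\<^bsub>H\<^esub> b | f b. f \<in> carrier H \<and> b \<in> carrier (F \<one>\<^bsub>P\<^esub>)})"

text \<open>\<open>shift P F \<mu> p1 p2 q T = \<mu>\<^bsub>p1,q\<^esub> \<circ> (T \<otimes> id) \<circ> \<mu>\<^bsub>p2,q\<^esub>\<^sup>-\<^sup>1\<close>\<close>

definition shift ::
  "'p monoid \<Rightarrow> ('p \<Rightarrow> ('a, 'a, 'a) bimodule)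
    \<Rightarrow> ('p \<Rightarrow> 'p \<Rightarrow> (('a \<times> 'a) \<Rightarrow>\<^sub>0 int) set \<Rightarrow> 'a)
    \<Rightarrow> 'p \<Rightarrow> 'p \<Rightarrow> 'p \<Rightarrow> ('a \<Rightarrow> 'a) \<Rightarrow> ('a \<Rightarrow> 'a)" where
  "shift P F \<mu> p1 p2 q T =
    (\<lambda>z\<in>carrier (F (p2 \<otimes>\<^bsub>P\<^esub> q)).
      \<mu> p1 q (tensor_map (F \<one>\<^bsub>P\<^esub>) (F p2) (F q) (F p1) (F q) T (\<lambda>y. y)
        (inv_into (carrier (tensor (F \<one>\<^bsub>P\<^esub>) (F p2) (F q))) (\<mu> p2 q) z)))"

text \<open>
  Inductive limits over \<open>R\<^sub>g\<close>: two elements are identified if they become equal at a common target.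
  The relation is stated for all \<open>g\<close> at once because arrows do not change \<open>p1 p2\<^sup>-\<^sup>1\<close>.
\<close>

definition limit_rel ::
  "'p monoid \<Rightarrow> ('p \<Rightarrow> ('a, 'a, 'a) bimodule)
    \<Rightarrow> ('p \<Rightarrow> 'p \<Rightarrow> (('a \<times> 'a) \<Rightarrow>\<^sub>0 int) set \<Rightarrow> 'a)
    \<Rightarrow> ((('a \<Rightarrow> 'a) \<times> 'p \<times> 'p) \<times> (('a \<Rightarrow> 'a) \<times> 'p \<times> 'p)) set" where
  "limit_rel P F \<mu> =
    {((x, p1, p2), (y, q1, q2)).
      p1 \<in> carrier P \<and> p2 \<in> carrier P \<and> x \<in> diagram_hom P F p1 p2 \<and>
      q1 \<in> carrier P \<and> q2 \<in> carrier P \<and> y \<in> diagram_hom P F q1 q2 \<and>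
      (\<exists>t1\<in>carrier P. \<exists>t2\<in>carrier P.
        p1 \<otimes>\<^bsub>P\<^esub> t1 = q1 \<otimes>\<^bsub>P\<^esub> t2 \<and> p2 \<otimes>\<^bsub>P\<^esub> t1 = q2 \<otimes>\<^bsub>P\<^esub> t2 \<and>
        shift P F \<mu> p1 p2 t1 x = shift P F \<mu> q1 q2 t2 y)}"

definition limit_class ::
  "'p monoid \<Rightarrow> ('p \<Rightarrow> ('a, 'a, 'a) bimodule)
    \<Rightarrow> ('p \<Rightarrow> 'p \<Rightarrow> (('a \<times> 'a) \<Rightarrow>\<^sub>0 int) set \<Rightarrow> 'a)
    \<Rightarrow> ('a \<Rightarrow> 'a) \<Rightarrow> 'p \<Rightarrow> 'p \<Rightarrow> (('a \<Rightarrow> 'a) \<times> 'p \<times> 'p) set" where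
  "limit_class P F \<mu> x p1 p2 = limit_rel P F \<mu> `` {(x, p1, p2)}"

text \<open>The Abelian group \<open>\<O>\<^sub>g\<close>, as a ring record of which only the additive part is used.\<close>

definition O_component ::
  "'p monoid \<Rightarrow> ('p \<Rightarrow> ('a, 'a, 'a) bimodule)
    \<Rightarrow> ('p \<Rightarrow> 'p \<Rightarrow> (('a \<times> 'a) \<Rightarrow>\<^sub>0 int) set \<Rightarrow> 'a)
    \<Rightarrow> ('p \<times> 'p) set \<Rightarrow> (('a \<Rightarrow> 'a) \<times> 'p \<times> 'p) set ring" where
  "O_component P F \<mu> g =
    \<lparr>carrier = {limit_class P F \<mu> x p1 p2 | x p1 p2.
       (p1, p2) \<in> ore_reps P g \<and> x \<in> diagram_hom P F p1 p2},
     mult = undefined, one = undefined,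
     zero = the_elem {limit_class P F \<mu> (\<lambda>z\<in>carrier (F p2). \<zero>\<^bsub>F p1\<^esub>) p1 p2 | p1 p2.
       (p1, p2) \<in> ore_reps P g},
     add = (\<lambda>X Y. the_elem
       {limit_class P F \<mu>
          (shift P F \<mu> p1 p2 t1 x
            \<oplus>\<^bsub>hom_bimodule (F \<one>\<^bsub>P\<^esub>) (F (p2 \<otimes>\<^bsub>P\<^esub> t1)) (F (p1 \<otimes>\<^bsub>P\<^esub> t1))\<^esub>
           shift P F \<mu> q1 q2 t2 y)
          (p1 \<otimes>\<^bsub>P\<^esub> t1) (p2 \<otimes>\<^bsub>P\<^esub> t1) | x p1 p2 y q1 q2 t1 t2.
         (x, p1, p2) \<in> X \<and> (y, q1, q2) \<in> Y \<and> t1 \<in> carrier P \<and> t2 \<in> carrier P \<and>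
         p1 \<otimes>\<^bsub>P\<^esub> t1 = q1 \<otimes>\<^bsub>P\<^esub> t2 \<and> p2 \<otimes>\<^bsub>P\<^esub> t1 = q2 \<otimes>\<^bsub>P\<^esub> t2})\<rparr>"

definition O_component_mult ::
  "'p monoid \<Rightarrow> ('p \<Rightarrow> ('a, 'a, 'a) bimodule)
    \<Rightarrow> ('p \<Rightarrow> 'p \<Rightarrow> (('a \<times> 'a) \<Rightarrow>\<^sub>0 int) set \<Rightarrow> 'a)
    \<Rightarrow> (('a \<Rightarrow> 'a) \<times> 'p \<times> 'p) set \<Rightarrow> (('a \<Rightarrow> 'a) \<times> 'p \<times> 'p) set
    \<Rightarrow> (('a \<Rightarrow> 'a) \<times> 'p \<times> 'p) set" where
  "O_component_mult P F \<mu> X Y = the_elem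
    {limit_class P F \<mu>
       (compose (carrier (F (q2 \<otimes>\<^bsub>P\<^esub> t2))) (shift P F \<mu> p1 p2 t1 x) (shift P F \<mu> q1 q2 t2 y))
       (p1 \<otimes>\<^bsub>P\<^esub> t1) (q2 \<otimes>\<^bsub>P\<^esub> t2) | x p1 p2 y q1 q2 t1 t2.
      (x, p1, p2) \<in> X \<and> (y, q1, q2) \<in> Y \<and> t1 \<in> carrier P \<and> t2 \<in> carrier P \<and>
      p2 \<otimes>\<^bsub>P\<^esub> t1 = q1 \<otimes>\<^bsub>P\<^esub> t2}"

definition O_ring ::
  "'p monoid \<Rightarrow> ('p \<Rightarrow> ('a, 'a, 'a) bimodule)
    \<Rightarrow> ('p \<Rightarrow> 'p \<Rightarrow> (('a \<times> 'a) \<Rightarrow>\<^sub>0 int) set \<Rightarrow> 'a)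
    \<Rightarrow> (('p \<times> 'p) set \<Rightarrow> (('a \<Rightarrow> 'a) \<times> 'p \<times> 'p) set) ring" where
  "O_ring P F \<mu> =
    (let G = ore_group P;
         A = O_component P F \<mu>;
         S = sum_group (carrier G) (\<lambda>g. add_monoid (A g))
     in \<lparr>carrier = carrier S,
         mult = (\<lambda>\<xi> \<eta>. \<lambda>g\<in>carrier G.
           finsum (A g) (\<lambda>(h, k). O_component_mult P F \<mu> (\<xi> h) (\<eta> k))
             {(h, k). h \<in> carrier G \<and> k \<in> carrier G \<and> h \<otimes>\<^bsub>G\<^esub> k = g \<and>
                \<xi> h \<noteq> \<zero>\<^bsub>A h\<^esub> \<and> \<eta> k \<noteq> \<zero>\<^bsub>A k\<^esub>}),
         one = undefined,
         zero = one S,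
         add = mult S\<rparr>)"

definition O_canonical ::
  "'p monoid \<Rightarrow> ('p \<Rightarrow> ('a, 'a, 'a) bimodule)
    \<Rightarrow> ('p \<Rightarrow> 'p \<Rightarrow> (('a \<times> 'a) \<Rightarrow>\<^sub>0 int) set \<Rightarrow> 'a)
    \<Rightarrow> 'p \<Rightarrow> 'a \<Rightarrow> (('p \<times> 'p) set \<Rightarrow> (('a \<Rightarrow> 'a) \<times> 'p \<times> 'p) set)" where
  "O_canonical P F \<mu> =
    (\<lambda>p\<in>carrier P. \<lambda>x\<in>carrier (F p). \<lambda>g\<in>carrier (ore_group P).
      if g = ore_frac P p \<one>\<^bsub>P\<^esub>
      then limit_class P F \<mu> (\<lambda>z\<in>carrier (F \<one>\<^bsub>P\<^esub>). x \<triangleleft>\<^bsub>F p\<^esub> z) p \<one>\<^bsub>P\<^esub>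
      else \<zero>\<^bsub>O_component P F \<mu> g\<^esub>)"

end

theory Submission
  imports Defs
begin

text \<open>
  A covariant representation \<open>\<nu>\<close> in \<open>D\<close> identifies \<open>F\<^sub>p \<otimes> D\<close> with \<open>D\<close>.  A right module map
  \<open>T : F\<^bsub>p2\<^esub> \<rightarrow> F\<^bsub>p1\<^esub>\<close> with \<open>T = T \<cdot> e\<close> for an idempotent \<open>e\<close> of \<open>F\<^sub>1\<close> therefore acts on \<open>D\<close>, and it acts by
  left multiplication with the unique \<open>d\<close> such that \<open>d \<nu>\<^bsub>p2\<^esub>(x) = \<nu>\<^bsub>p1\<^esub>(T x)\<close> for all \<open>x\<close>.  This \<open>d\<close> does
  not change when \<open>T\<close> is replaced by \<open>T \<otimes> id\<close>, so \<open>T \<mapsto> d\<close> descends to the inductive limits and gives the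
  ring homomorphism extending \<open>\<nu>\<close>.  It is unique because \<open>[T, (p\<^sub>1, p\<^sub>2)] \<cdot> \<kappa>\<^bsub>p2\<^esub>(x) = \<kappa>\<^bsub>p1\<^esub>(T x)\<close> in the ring of
  the diagram.

  Properness enters in two places.  Finite generation of \<open>e F\<^bsub>p2\<^esub>\<close> gives \<open>T = e' \<cdot> T\<close> for some idempotent
  \<open>e'\<close>, hence local units.  A dual basis \<open>(x\<^sub>i, \<phi>\<^sub>i)\<close> of \<open>e F\<^sub>p\<close> provides elements \<open>v\<^sub>i = [\<phi>\<^sub>i, (1, p)]\<close> with
  \<open>\<Sum> \<kappa>\<^sub>p(x\<^sub>i) v\<^sub>i = \<kappa>\<^sub>1(e)\<close> and \<open>v\<^sub>i \<kappa>\<^sub>p(y) = \<kappa>\<^sub>1(\<phi>\<^sub>i(y))\<close>.  For a nondegenerate homomorphism \<open>f\<close> these relations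
  show that the maps \<open>x \<otimes> d \<mapsto> f(\<kappa>\<^sub>p(x)) d\<close> are isomorphisms; \<open>f = id\<close> is the case of \<open>\<kappa>\<close> itself.
\<close>

section \<open>Additive maps and balanced tensor products\<close>

text \<open>Two obstacles shape the proof. First, units are missing. A right D-linear endomorphism
  of D need not be left multiplication by an element; it is the cutoff T = T e that makes the
  operator of T such a multiplication. Likewise a finite dual basis exists for each corner e F_p,
  but in general not for F_p itself, so that the map sending x \<otimes> d to \<nu>_p(x) d has no
  inverse given by one formula: elements are reached, and finitely many tensors are separated, by
  one idempotent at a time. Unit conditions are therefore phrased with \<open>for_large\<close>,
  which is stable under finite conjunctions. Second, P need not be cancellative, and every operation
  on limits is the common value of all choices of representatives and arrows. Two choices are
  compared by matching one coordinate of the pairs (p1, p2) with (O1); by (O2), the other coordinate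
  and the maps then agree after a further arrow. Afterwards elements are represented at a common
  object, or at composable objects (p1, p2) and (p2, p3), where sums and products are those of
  maps.\<close>

abbreviation add_hom :: "('a, 'm) ring_scheme \<Rightarrow> ('b, 'n) ring_scheme \<Rightarrow> ('a \<Rightarrow> 'b) set" where
  "add_hom M N \<equiv> hom (add_monoid M) (add_monoid N)"

lemma add_hom_closed: "h \<in> add_hom M N \<Longrightarrow> x \<in> carrier M \<Longrightarrow> h x \<in> carrier N"
  by (auto simp: hom_def)

lemma add_hom_add:
  "h \<in> add_hom M N \<Longrightarrow> x \<in> carrier M \<Longrightarrow> y \<in> carrier M \<Longrightarrow> h (x \<oplus>\<^bsub>M\<^esub> y) = h x \<oplus>\<^bsub>N\<^esub> h y"
  by (auto simp: hom_def)

lemma add_homI: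
  assumes "\<And>x. x \<in> carrier M \<Longrightarrow> h x \<in> carrier N"
    and "\<And>x y. x \<in> carrier M \<Longrightarrow> y \<in> carrier M \<Longrightarrow> h (x \<oplus>\<^bsub>M\<^esub> y) = h x \<oplus>\<^bsub>N\<^esub> h y"
  shows "h \<in> add_hom M N"
  using assms by (auto simp: hom_def)

lemma add_hom_zero:
  assumes "abelian_group M" "abelian_group N" "h \<in> add_hom M N"
  shows "h \<zero>\<^bsub>M\<^esub> = \<zero>\<^bsub>N\<^esub>"
  using hom_one[OF assms(3) abelian_group.a_group abelian_group.a_group] assms by simp

lemma add_hom_minus:
  assumes "abelian_group M" "abelian_group N" "h \<in> add_hom M N" "x \<in> carrier M"
  shows "h (\<ominus>\<^bsub>M\<^esub> x) = \<ominus>\<^bsub>N\<^esub> h x"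
proof -
  interpret group_hom "add_monoid M" "add_monoid N" h
    using assms by (simp add: group_hom_def group_hom_axioms_def abelian_group.a_group)
  show ?thesis using hom_inv[of x] assms(4) by (simp add: a_inv_def)
qed

lemma add_hom_compose:
  assumes "h \<in> add_hom M N" "k \<in> add_hom N L"
  shows "(\<lambda>x. k (h x)) \<in> add_hom M L"
  by (rule add_homI) (simp_all add: add_hom_closed[OF assms(1)] add_hom_closed[OF assms(2)]
    add_hom_add[OF assms(1)] add_hom_add[OF assms(2)])

lemma add_hom_finsum:
  assumes "abelian_group M" "abelian_group N" "h \<in> add_hom M N" "g \<in> X \<rightarrow> carrier M"
  shows "h (finsum M g X) = finsum N (\<lambda>x. h (g x)) X"
proof -
  interpret M: abelian_group M by fact
  interpret N: abelian_group N by fact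
  show ?thesis using assms(4)
  proof (induction X rule: infinite_finite_induct)
    case (insert x X)
    then have "g \<in> X \<rightarrow> carrier M" "g x \<in> carrier M" by auto
    moreover from this have "(\<lambda>x. h (g x)) \<in> X \<rightarrow> carrier N" "h (g x) \<in> carrier N"
      using add_hom_closed[OF assms(3)] by auto
    ultimately show ?case using insert
      by (simp add: M.finsum_insert N.finsum_insert add_hom_add[OF assms(3)] M.finsum_closed)
  qed (auto simp: add_hom_zero[OF assms(1-3)])
qed

lemma add_hom_of_finsum:
  assumes "abelian_group N" "\<And>i. i \<in> X \<Longrightarrow> h i \<in> add_hom M N"
  shows "(\<lambda>x. finsum N (\<lambda>i. h i x) X) \<in> add_hom M N"
proof (rule add_homI)
  interpret N: abelian_group N by fact
  show "finsum N (\<lambda>i. h i x) X \<in> carrier N" if "x \<in> carrier M" for x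
    using that add_hom_closed[OF assms(2)] by (auto intro!: N.finsum_closed)
  show "finsum N (\<lambda>i. h i (x \<oplus>\<^bsub>M\<^esub> y)) X = finsum N (\<lambda>i. h i x) X \<oplus>\<^bsub>N\<^esub> finsum N (\<lambda>i. h i y) X"
    if "x \<in> carrier M" "y \<in> carrier M" for x y
  proof -
    have "finsum N (\<lambda>i. h i (x \<oplus>\<^bsub>M\<^esub> y)) X = finsum N (\<lambda>i. h i x \<oplus>\<^bsub>N\<^esub> h i y) X"
      using that add_hom_closed[OF assms(2)] add_hom_add[OF assms(2)] by (intro N.finsum_cong') auto
    also have "\<dots> = finsum N (\<lambda>i. h i x) X \<oplus>\<^bsub>N\<^esub> finsum N (\<lambda>i. h i y) X"
      using that add_hom_closed[OF assms(2)] by (intro N.finsum_addf) auto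
    finally show ?thesis .
  qed
qed

context nonunital_ring
begin

lemma lmult_add_hom: "a \<in> carrier R \<Longrightarrow> (\<lambda>x. a \<otimes> x) \<in> add_hom R R"
  by (rule add_homI) (auto simp: m_closed r_distr)

lemma rmult_add_hom: "a \<in> carrier R \<Longrightarrow> (\<lambda>x. x \<otimes> a) \<in> add_hom R R"
  by (rule add_homI) (auto simp: m_closed l_distr)

lemma abel: "abelian_group R"
  by unfold_locales

lemma m_zero_right: "a \<in> carrier R \<Longrightarrow> a \<otimes> \<zero> = \<zero>"
  using add_hom_zero[OF abel abel lmult_add_hom] by simp

end

section \<open>Balanced maps and the universal property of the tensor product\<close>

definition balanced ::
  "('r, 'm) ring_scheme \<Rightarrow> ('l, 'a, 'r) bimodule \<Rightarrow> ('r, 'b, 's) bimodule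
    \<Rightarrow> ('c, 'n) ring_scheme \<Rightarrow> ('a \<Rightarrow> 'b \<Rightarrow> 'c) \<Rightarrow> bool" where
  "balanced R M N K \<beta> \<longleftrightarrow>
    (\<forall>x\<in>carrier M. (\<lambda>y. \<beta> x y) \<in> add_hom N K) \<and>
    (\<forall>y\<in>carrier N. (\<lambda>x. \<beta> x y) \<in> add_hom M K) \<and>
    (\<forall>x\<in>carrier M. \<forall>r\<in>carrier R. \<forall>y\<in>carrier N. \<beta> (x \<triangleleft>\<^bsub>M\<^esub> r) y = \<beta> x (r \<odot>\<^bsub>N\<^esub> y))"

lemma balancedD:
  assumes "balanced R M N K \<beta>"
  shows "x \<in> carrier M \<Longrightarrow> \<beta> x \<in> add_hom N K"
    and "y \<in> carrier N \<Longrightarrow> (\<lambda>x. \<beta> x y) \<in> add_hom M K"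
    and "x \<in> carrier M \<Longrightarrow> r \<in> carrier R \<Longrightarrow> y \<in> carrier N \<Longrightarrow> \<beta> (x \<triangleleft>\<^bsub>M\<^esub> r) y = \<beta> x (r \<odot>\<^bsub>N\<^esub> y)"
    and "x \<in> carrier M \<Longrightarrow> y \<in> carrier N \<Longrightarrow> \<beta> x y \<in> carrier K"
  using assms by (auto simp: balanced_def hom_def)

text \<open>Closure of the two actions of R is what places the balancing relations in the free
  group. With no more demanded than this, the locale covers the pullback of D along any map with
  values in D.\<close>

locale tensor_pair = M: abelian_group M + N: abelian_group N
  for R :: "('r, 'm) ring_scheme" and M :: "('l, 'a, 'r) bimodule" and N :: "('r, 'b, 's) bimodule" +
  assumes pair_ract_closed: "x \<in> carrier M \<Longrightarrow> r \<in> carrier R \<Longrightarrow> x \<triangleleft>\<^bsub>M\<^esub> r \<in> carrier M"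
    and pair_lact_closed: "y \<in> carrier N \<Longrightarrow> r \<in> carrier R \<Longrightarrow> r \<odot>\<^bsub>N\<^esub> y \<in> carrier N"
begin

abbreviation "formal \<equiv> free_Abelian_group (carrier M \<times> carrier N)"
abbreviation "null \<equiv> generate formal (tensor_relations R M N)"

lemma formal_diff:
  "a \<in> carrier formal \<Longrightarrow> b \<in> carrier formal \<Longrightarrow> a - b \<in> carrier formal"
  using keys_diff[of a b] by auto

lemma formal_add:
  "a \<in> carrier formal \<Longrightarrow> b \<in> carrier formal \<Longrightarrow> a + b \<in> carrier formal"
  using monoid.m_closed[OF group.is_monoid[OF group_free_Abelian_group], of a "carrier M \<times> carrier N" b]
  by simp

lemma formal_of: "x \<in> carrier M \<Longrightarrow> y \<in> carrier N \<Longrightarrow> frag_of (x, y) \<in> carrier formal"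
  by simp

lemma formal_minus: "a \<in> carrier formal \<Longrightarrow> - a \<in> carrier formal"
  by simp

lemma formal_zero: "0 \<in> carrier formal"
  by simp

lemmas formal_closed = formal_of formal_diff formal_add formal_minus formal_zero

lemma tensor_relations_subset: "tensor_relations R M N \<subseteq> carrier formal"
  unfolding tensor_relations_def
  by (auto intro!: formal_diff formal_of simp: pair_ract_closed pair_lact_closed
      simp del: carrier_free_Abelian_group_iff)

lemma null_subgroup: "subgroup null formal"
  by (rule group.generate_is_subgroup[OF group_free_Abelian_group tensor_relations_subset])

lemma null_normal: "null \<lhd> formal"
  by (rule comm_group.subgroup_imp_normal[OF abelian_free_Abelian_group null_subgroup])

lemma coset_eq_iff:
  assumes "a \<in> carrier formal" "b \<in> carrier formal"
  shows "tensor_coset R M N a = tensor_coset R M N b \<longleftrightarrow> a - b \<in> null"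
proof -
  interpret G: group formal by simp
  have b: "inv\<^bsub>formal\<^esub> b = - b" using assms by simp
  show ?thesis
  proof
    assume "tensor_coset R M N a = tensor_coset R M N b"
    then have "a \<in> null #>\<^bsub>formal\<^esub> b"
      using G.rcos_self[OF assms(1) null_subgroup] by (simp add: tensor_coset_def)
    then show "a - b \<in> null"
      by (auto simp: r_coset_def)
  next
    assume "a - b \<in> null"
    then have "a \<in> null #>\<^bsub>formal\<^esub> b"
      by (force simp: r_coset_def)
    then show "tensor_coset R M N a = tensor_coset R M N b"
      using G.repr_independence[OF _ assms(2) null_subgroup] by (simp add: tensor_coset_def)
  qed
qed

lemma coset_mem:
  assumes "c' \<in> tensor_coset R M N c" "c \<in> carrier formal"
  shows "c' \<in> carrier formal" "tensor_coset R M N c' = tensor_coset R M N c"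
proof -
  interpret G: group formal by simp
  show "c' \<in> carrier formal"
    using G.r_coset_subset_G[OF subgroup.subset[OF null_subgroup] assms(2)] assms(1)
    unfolding tensor_coset_def by blast
  show "tensor_coset R M N c' = tensor_coset R M N c"
    using G.repr_independence[OF _ assms(2) null_subgroup] assms(1) by (simp add: tensor_coset_def)
qed

lemma coset_self: "c \<in> carrier formal \<Longrightarrow> c \<in> tensor_coset R M N c"
  unfolding tensor_coset_def by (rule group.rcos_self[OF group_free_Abelian_group _ null_subgroup])

lemma tensor_carrier: "carrier (tensor R M N) = tensor_coset R M N ` carrier formal"
  by (auto simp: tensor_def Let_def FactGroup_def RCOSETS_def tensor_coset_def)

lemma tensor_add:
  assumes "a \<in> carrier formal" "b \<in> carrier formal"
  shows "tensor_coset R M N a \<oplus>\<^bsub>tensor R M N\<^esub> tensor_coset R M N b = tensor_coset R M N (a + b)"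
  using normal.rcos_sum[OF null_normal assms]
  by (simp add: tensor_def Let_def FactGroup_def tensor_coset_def)

lemma tensor_zero: "\<zero>\<^bsub>tensor R M N\<^esub> = tensor_coset R M N 0"
proof -
  have "null #>\<^bsub>formal\<^esub> 0 = null"
    using group.coset_join2[OF group_free_Abelian_group _ null_subgroup, of 0]
      subgroup.one_closed[OF null_subgroup] by simp
  then show ?thesis
    by (simp add: tensor_def Let_def FactGroup_def tensor_coset_def)
qed

lemma tensor_abelian: "abelian_group (tensor R M N)"
proof (rule abelian_groupI)
  fix X Y Z assume *: "X \<in> carrier (tensor R M N)" "Y \<in> carrier (tensor R M N)"
  then obtain a b where ab: "a \<in> carrier formal" "b \<in> carrier formal"
    "X = tensor_coset R M N a" "Y = tensor_coset R M N b"
    by (auto simp only: tensor_carrier)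
  show "X \<oplus>\<^bsub>tensor R M N\<^esub> Y \<in> carrier (tensor R M N)"
    unfolding ab(3,4) tensor_add[OF ab(1,2)] tensor_carrier using formal_add[OF ab(1,2)] by blast
  show "X \<oplus>\<^bsub>tensor R M N\<^esub> Y = Y \<oplus>\<^bsub>tensor R M N\<^esub> X"
    unfolding ab(3,4) tensor_add[OF ab(1,2)] tensor_add[OF ab(2,1)] by (simp add: add.commute)
  assume "Z \<in> carrier (tensor R M N)"
  then obtain c where c: "c \<in> carrier formal" "Z = tensor_coset R M N c"
    by (auto simp only: tensor_carrier)
  show "(X \<oplus>\<^bsub>tensor R M N\<^esub> Y) \<oplus>\<^bsub>tensor R M N\<^esub> Z = X \<oplus>\<^bsub>tensor R M N\<^esub> (Y \<oplus>\<^bsub>tensor R M N\<^esub> Z)"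
    using ab c by (simp add: tensor_add formal_add add.assoc del: carrier_free_Abelian_group_iff)
next
  show "\<zero>\<^bsub>tensor R M N\<^esub> \<in> carrier (tensor R M N)"
    unfolding tensor_zero tensor_carrier using formal_zero by blast
  fix X assume "X \<in> carrier (tensor R M N)"
  then obtain a where a: "a \<in> carrier formal" "X = tensor_coset R M N a"
    by (auto simp only: tensor_carrier)
  show "\<zero>\<^bsub>tensor R M N\<^esub> \<oplus>\<^bsub>tensor R M N\<^esub> X = X"
    unfolding tensor_zero a(2) tensor_add[OF formal_zero a(1)] by simp
  have "tensor_coset R M N (- a) \<oplus>\<^bsub>tensor R M N\<^esub> X = \<zero>\<^bsub>tensor R M N\<^esub>"
    unfolding tensor_zero a(2) tensor_add[OF formal_minus[OF a(1)] a(1)] by simp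
  then show "\<exists>Y\<in>carrier (tensor R M N). Y \<oplus>\<^bsub>tensor R M N\<^esub> X = \<zero>\<^bsub>tensor R M N\<^esub>"
    using formal_minus[OF a(1)] unfolding tensor_carrier by blast
qed

lemma tensor_elem_closed:
  "x \<in> carrier M \<Longrightarrow> y \<in> carrier N \<Longrightarrow> tensor_elem R M N x y \<in> carrier (tensor R M N)"
  by (auto simp: tensor_elem_def tensor_carrier)

lemma tensor_elem_balanced: "balanced R M N (tensor R M N) (tensor_elem R M N)"
proof -
  have rel: "tensor_coset R M N a = tensor_coset R M N b"
    if "a \<in> carrier formal" "b \<in> carrier formal" "a - b \<in> tensor_relations R M N" for a b
    using that coset_eq_iff generate.incl by metis
  show ?thesis
    unfolding balanced_def
  proof (intro conjI ballI)
    fix x y r assume *: "x \<in> carrier M" "r \<in> carrier R" "y \<in> carrier N"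
    then show "tensor_elem R M N (x \<triangleleft>\<^bsub>M\<^esub> r) y = tensor_elem R M N x (r \<odot>\<^bsub>N\<^esub> y)"
      unfolding tensor_elem_def
      by (intro rel) (auto simp: pair_ract_closed pair_lact_closed tensor_relations_def)
  next
    fix x assume x: "x \<in> carrier M"
    show "tensor_elem R M N x \<in> add_hom N (tensor R M N)"
    proof (rule add_homI)
      fix y y' assume y: "y \<in> carrier N" "y' \<in> carrier N"
      have "tensor_elem R M N x (y \<oplus>\<^bsub>N\<^esub> y') = tensor_coset R M N (frag_of (x, y) + frag_of (x, y'))"
        unfolding tensor_elem_def using x y
        by (intro rel formal_closed) (auto simp: tensor_relations_def diff_diff_add[symmetric])
      then show "tensor_elem R M N x (y \<oplus>\<^bsub>N\<^esub> y')
        = tensor_elem R M N x y \<oplus>\<^bsub>tensor R M N\<^esub> tensor_elem R M N x y'"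
        using x y by (simp add: tensor_add tensor_elem_def)
    qed (use x tensor_elem_closed in auto)
  next
    fix y assume y: "y \<in> carrier N"
    show "(\<lambda>x. tensor_elem R M N x y) \<in> add_hom M (tensor R M N)"
    proof (rule add_homI)
      fix x x' assume x: "x \<in> carrier M" "x' \<in> carrier M"
      have "tensor_elem R M N (x \<oplus>\<^bsub>M\<^esub> x') y = tensor_coset R M N (frag_of (x, y) + frag_of (x', y))"
        unfolding tensor_elem_def using x y
        by (intro rel formal_closed) (auto simp: tensor_relations_def diff_diff_add[symmetric])
      then show "tensor_elem R M N (x \<oplus>\<^bsub>M\<^esub> x') y
        = tensor_elem R M N x y \<oplus>\<^bsub>tensor R M N\<^esub> tensor_elem R M N x' y"
        using x y by (simp add: tensor_add tensor_elem_def)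
    qed (use y tensor_elem_closed in auto)
  qed
qed

lemmas tensor_elem_hom = balancedD(1,2)[OF tensor_elem_balanced]

text \<open>There is no case for negatives because -(x \<otimes> y) = (-x) \<otimes> y, and none for
  zero because zero is the elementary tensor of two zeros.\<close>

lemma tensor_induct [consumes 1, case_names elem add]:
  assumes "t \<in> carrier (tensor R M N)"
    and elem: "\<And>x y. x \<in> carrier M \<Longrightarrow> y \<in> carrier N \<Longrightarrow> Q (tensor_elem R M N x y)"
    and add: "\<And>s t. s \<in> carrier (tensor R M N) \<Longrightarrow> t \<in> carrier (tensor R M N) \<Longrightarrow> Q s \<Longrightarrow> Q t
      \<Longrightarrow> Q (s \<oplus>\<^bsub>tensor R M N\<^esub> t)"
  shows "Q t"
proof -
  interpret T: abelian_group "tensor R M N" by (rule tensor_abelian)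
  have clo: "tensor_coset R M N a \<in> carrier (tensor R M N)" if "a \<in> carrier formal" for a
    using that by (auto simp: tensor_carrier)
  have minus: "\<ominus>\<^bsub>tensor R M N\<^esub> tensor_coset R M N a = tensor_coset R M N (- a)" if "a \<in> carrier formal" for a
  proof (rule T.minus_equality)
    have "- a \<in> carrier formal" using that by simp
    then show "tensor_coset R M N (- a) \<in> carrier (tensor R M N)"
      "tensor_coset R M N (- a) \<oplus>\<^bsub>tensor R M N\<^esub> tensor_coset R M N a = \<zero>\<^bsub>tensor R M N\<^esub>"
      using that clo by (auto simp: tensor_add tensor_zero simp del: carrier_free_Abelian_group_iff)
  qed (use that clo in auto)
  \<comment> \<open>\<open>frag_induction\<close> builds combinations by subtraction, while the
    hypotheses only allow sums; hence a and -a are treated together. The support is carried along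
    because the case \<open>diff\<close> has to know that both parts are formal combinations of
    pairs in the carriers.\<close>
  have "Poly_Mapping.keys a \<subseteq> carrier M \<times> carrier N \<and> Q (tensor_coset R M N a) \<and> Q (tensor_coset R M N (- a))"
    if "Poly_Mapping.keys a \<subseteq> carrier M \<times> carrier N" for a
    using that
  proof (induction rule: frag_induction)
    case zero
    have "tensor_elem R M N \<zero>\<^bsub>M\<^esub> \<zero>\<^bsub>N\<^esub> = \<zero>\<^bsub>tensor R M N\<^esub>"
      using add_hom_zero[OF N.abelian_group_axioms tensor_abelian tensor_elem_hom(1)[of "\<zero>\<^bsub>M\<^esub>"]] by simp
    then have "Q (tensor_coset R M N 0)"
      using elem[of "\<zero>\<^bsub>M\<^esub>" "\<zero>\<^bsub>N\<^esub>"] by (simp add: tensor_zero)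
    then show ?case by simp
  next
    case (one p)
    then obtain x y where p: "p = (x, y)" "x \<in> carrier M" "y \<in> carrier N" by auto
    have "\<ominus>\<^bsub>tensor R M N\<^esub> tensor_elem R M N x y = tensor_elem R M N (\<ominus>\<^bsub>M\<^esub> x) y"
      using add_hom_minus[OF M.abelian_group_axioms tensor_abelian tensor_elem_hom(2)] p by simp
    moreover have "Q (tensor_elem R M N (\<ominus>\<^bsub>M\<^esub> x) y)" "Q (tensor_elem R M N x y)"
      using p by (simp_all add: elem)
    ultimately show ?case
      using p minus[of "frag_of (x, y)"] by (auto simp: tensor_elem_def)
  next
    case (diff a b)
    then have c: "a \<in> carrier formal" "b \<in> carrier formal" "- a \<in> carrier formal" "- b \<in> carrier formal"
      by auto
    have "Poly_Mapping.keys (a - b) \<subseteq> carrier M \<times> carrier N"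
      using diff keys_diff[of a b] by blast
    moreover have "Q (tensor_coset R M N (a - b))" "Q (tensor_coset R M N (b - a))"
      using add[of "tensor_coset R M N a" "tensor_coset R M N (- b)"]
        add[of "tensor_coset R M N b" "tensor_coset R M N (- a)"] c diff clo
      by (simp_all add: tensor_add del: carrier_free_Abelian_group_iff)
    ultimately show ?case by simp
  qed
  then show ?thesis
    using assms(1) by (auto simp: tensor_carrier)
qed

text \<open>The additive extension of \<beta> to the free group kills the three kinds of relations,
  so that it factors through the quotient.\<close>

lemma tensor_universal:
  assumes "abelian_group K" and bal: "balanced R M N K \<beta>"
  shows "\<exists>h \<in> add_hom (tensor R M N) K. \<forall>x\<in>carrier M. \<forall>y\<in>carrier N. h (tensor_elem R M N x y) = \<beta> x y"
proof -
  interpret K: abelian_group K by fact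
  have "(\<lambda>(x, y). \<beta> x y) ` (carrier M \<times> carrier N) \<subseteq> carrier (add_monoid K)"
    using balancedD(4)[OF bal] by auto
  then obtain h where h: "h \<in> hom formal (add_monoid K)"
    and hf: "\<And>p. p \<in> carrier M \<times> carrier N \<Longrightarrow> h (frag_of p) = (\<lambda>(x, y). \<beta> x y) p"
    using comm_group.free_Abelian_group_universal[OF K.a_comm_group] by blast
  interpret h: group_hom formal "add_monoid K" h
    by (simp add: group_hom_def group_hom_axioms_def h K.a_group)
  have hdiff: "h (a - b) = h a \<ominus>\<^bsub>K\<^esub> h b" if "a \<in> carrier formal" "b \<in> carrier formal" for a b
  proof -
    have "h (a \<otimes>\<^bsub>formal\<^esub> inv\<^bsub>formal\<^esub> b) = h a \<oplus>\<^bsub>K\<^esub> h (inv\<^bsub>formal\<^esub> b)"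
      using that h.hom_mult[of a "inv\<^bsub>formal\<^esub> b"] group.inv_closed[OF group_free_Abelian_group that(2)]
      by (simp del: carrier_free_Abelian_group_iff)
    then show ?thesis
      using that h.hom_inv[of b] by (simp add: a_minus_def a_inv_def)
  qed
  have cancel: "(u \<oplus>\<^bsub>K\<^esub> v) \<ominus>\<^bsub>K\<^esub> u \<ominus>\<^bsub>K\<^esub> v = \<zero>\<^bsub>K\<^esub>"
    if "u \<in> carrier K" "v \<in> carrier K" for u v
    using that by (metis K.a_assoc K.a_comm K.a_inv_closed K.add.m_closed K.minus_eq K.r_neg K.r_neg2)
  have "h r = \<zero>\<^bsub>K\<^esub>" if "r \<in> tensor_relations R M N" for r
    using that unfolding tensor_relations_def
  proof (elim UnE CollectE exE conjE)
    fix x x' y assume r: "r = frag_of (x \<oplus>\<^bsub>M\<^esub> x', y) - frag_of (x, y) - frag_of (x', y)"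
      and m: "x \<in> carrier M" "x' \<in> carrier M" "y \<in> carrier N"
    have "h r = \<beta> (x \<oplus>\<^bsub>M\<^esub> x') y \<ominus>\<^bsub>K\<^esub> \<beta> x y \<ominus>\<^bsub>K\<^esub> \<beta> x' y"
      using m unfolding r by (simp add: hdiff hf formal_closed del: carrier_free_Abelian_group_iff)
    also have "\<dots> = \<zero>\<^bsub>K\<^esub>"
      using m cancel[of "\<beta> x y" "\<beta> x' y"] balancedD(4)[OF bal] add_hom_add[OF balancedD(2)[OF bal m(3)] m(1,2)]
      by simp
    finally show ?thesis .
  next
    fix x y y' assume r: "r = frag_of (x, y \<oplus>\<^bsub>N\<^esub> y') - frag_of (x, y) - frag_of (x, y')"
      and m: "x \<in> carrier M" "y \<in> carrier N" "y' \<in> carrier N"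
    have "h r = \<beta> x (y \<oplus>\<^bsub>N\<^esub> y') \<ominus>\<^bsub>K\<^esub> \<beta> x y \<ominus>\<^bsub>K\<^esub> \<beta> x y'"
      using m unfolding r by (simp add: hdiff hf formal_closed del: carrier_free_Abelian_group_iff)
    also have "\<dots> = \<zero>\<^bsub>K\<^esub>"
      using m cancel[of "\<beta> x y" "\<beta> x y'"] balancedD(4)[OF bal] add_hom_add[OF balancedD(1)[OF bal m(1)] m(2,3)]
      by simp
    finally show ?thesis .
  next
    fix x s y assume r: "r = frag_of (x \<triangleleft>\<^bsub>M\<^esub> s, y) - frag_of (x, s \<odot>\<^bsub>N\<^esub> y)"
      and m: "x \<in> carrier M" "s \<in> carrier R" "y \<in> carrier N"
    have "h r = \<beta> (x \<triangleleft>\<^bsub>M\<^esub> s) y \<ominus>\<^bsub>K\<^esub> \<beta> x (s \<odot>\<^bsub>N\<^esub> y)"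
      using m unfolding r
      by (simp add: hdiff hf formal_closed pair_ract_closed pair_lact_closed del: carrier_free_Abelian_group_iff)
    also have "\<dots> = \<zero>\<^bsub>K\<^esub>"
      using m balancedD(3,4)[OF bal] by (simp add: K.minus_eq K.r_neg pair_lact_closed)
    finally show ?thesis .
  qed
  then have "tensor_relations R M N \<subseteq> kernel formal (add_monoid K) h"
    using tensor_relations_subset by (auto simp: kernel_def simp del: carrier_free_Abelian_group_iff)
  then have "null \<subseteq> kernel formal (add_monoid K) h"
    using group.generate_subgroup_incl[OF group_free_Abelian_group] h.subgroup_kernel by blast
  from h.FactGroup_universal_kernel[OF null_normal this] obtain g where
    g: "g \<in> hom (formal Mod null) (add_monoid K)" "\<And>x. x \<in> carrier formal \<Longrightarrow> g (null #>\<^bsub>formal\<^esub> x) = h x"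
    by blast
  have "g \<in> add_hom (tensor R M N) K"
    using g(1) by (auto simp: hom_def tensor_def Let_def)
  moreover have "g (tensor_elem R M N x y) = \<beta> x y" if "x \<in> carrier M" "y \<in> carrier N" for x y
    using g(2)[OF formal_of[OF that]] hf that by (simp add: tensor_elem_def tensor_coset_def)
  ultimately show ?thesis by blast
qed

text \<open>\<open>tensor_map\<close> is a \<open>the_elem\<close> over all representatives of a
  coset. The universal property yields a homomorphism h with the desired values on elementary
  tensors; by \<open>ext\<close> every representative of t is sent to h t, so that the set of
  results is a singleton.\<close>

lemma tensor_map:
  assumes N': "tensor_pair R M' N'"
    and f: "f \<in> add_hom M M'" "\<And>x r. x \<in> carrier M \<Longrightarrow> r \<in> carrier R \<Longrightarrow> f (x \<triangleleft>\<^bsub>M\<^esub> r) = f x \<triangleleft>\<^bsub>M'\<^esub> r"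
    and g: "g \<in> add_hom N N'" "\<And>y r. y \<in> carrier N \<Longrightarrow> r \<in> carrier R \<Longrightarrow> g (r \<odot>\<^bsub>N\<^esub> y) = r \<odot>\<^bsub>N'\<^esub> g y"
  shows "tensor_map R M N M' N' f g \<in> add_hom (tensor R M N) (tensor R M' N')"
    and "x \<in> carrier M \<Longrightarrow> y \<in> carrier N
      \<Longrightarrow> tensor_map R M N M' N' f g (tensor_elem R M N x y) = tensor_elem R M' N' (f x) (g y)"
proof -
  interpret T': tensor_pair R M' N' by fact
  interpret A': abelian_group "tensor R M' N'" by (rule T'.tensor_abelian)
  note f' = add_hom_closed[OF f(1)] and g' = add_hom_closed[OF g(1)]
  have "balanced R M N (tensor R M' N') (\<lambda>x y. tensor_elem R M' N' (f x) (g y))"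
    unfolding balanced_def
  proof (intro conjI ballI)
    fix x assume "x \<in> carrier M"
    then show "(\<lambda>y. tensor_elem R M' N' (f x) (g y)) \<in> add_hom N (tensor R M' N')"
      by (intro add_hom_compose[OF g(1) T'.tensor_elem_hom(1)] f')
  next
    fix y assume "y \<in> carrier N"
    then show "(\<lambda>x. tensor_elem R M' N' (f x) (g y)) \<in> add_hom M (tensor R M' N')"
      by (intro add_hom_compose[OF f(1) T'.tensor_elem_hom(2)] g')
  next
    fix x r y assume "x \<in> carrier M" "r \<in> carrier R" "y \<in> carrier N"
    then show "tensor_elem R M' N' (f (x \<triangleleft>\<^bsub>M\<^esub> r)) (g y) = tensor_elem R M' N' (f x) (g (r \<odot>\<^bsub>N\<^esub> y))"
      by (simp add: f(2) g(2) balancedD(3)[OF T'.tensor_elem_balanced] f' g')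
  qed
  from tensor_universal[OF T'.tensor_abelian this] obtain h
    where h: "h \<in> add_hom (tensor R M N) (tensor R M' N')"
      "\<And>x y. x \<in> carrier M \<Longrightarrow> y \<in> carrier N \<Longrightarrow> h (tensor_elem R M N x y) = tensor_elem R M' N' (f x) (g y)"
    by blast
  let ?e = "frag_extend (\<lambda>(x, y). frag_of (f x, g y))"
  have ext: "?e c \<in> carrier T'.formal \<and> h (tensor_coset R M N c) = tensor_coset R M' N' (?e c)"
    if "Poly_Mapping.keys c \<subseteq> carrier M \<times> carrier N" for c
  proof -
    interpret group T'.formal by simp
    have "Poly_Mapping.keys c \<subseteq> carrier M \<times> carrier N \<and> ?e c \<in> carrier T'.formal
       \<and> h (tensor_coset R M N c) = tensor_coset R M' N' (?e c)"
      using that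
    proof (induction rule: frag_induction)
      case zero
      then show ?case
        using add_hom_zero[OF tensor_abelian T'.tensor_abelian h(1)]
        by (simp add: tensor_zero T'.tensor_zero)
    next
      case (one p)
      then show ?case using h(2) f' g' by (auto simp: tensor_elem_def)
    next
      case (diff a b)
      interpret Te: abelian_group "tensor R M N" by (rule tensor_abelian)
      have k: "Poly_Mapping.keys (a - b) \<subseteq> carrier M \<times> carrier N"
        using diff keys_diff[of a b] by blast
      have k': "?e (a - b) \<in> carrier T'.formal"
        using diff keys_diff[of "?e a" "?e b"] by (auto simp: frag_extend_diff)
      have c: "a \<in> carrier formal" "b \<in> carrier formal" "a - b \<in> carrier formal" using diff k by auto
      then have tc: "tensor_coset R M N a \<in> carrier (tensor R M N)" "tensor_coset R M N b \<in> carrier (tensor R M N)"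
        "tensor_coset R M N (a - b) \<in> carrier (tensor R M N)"
        by (auto simp: tensor_carrier simp del: carrier_free_Abelian_group_iff)
      have "tensor_coset R M N (a - b) \<oplus>\<^bsub>tensor R M N\<^esub> tensor_coset R M N b = tensor_coset R M N a"
        using tensor_add[OF c(3,2)] by simp
      then have 1: "h (tensor_coset R M N (a - b)) \<oplus>\<^bsub>tensor R M' N'\<^esub> h (tensor_coset R M N b) = h (tensor_coset R M N a)"
        using add_hom_add[OF h(1) tc(3,2)] by simp
      have 2: "tensor_coset R M' N' (?e (a - b)) \<oplus>\<^bsub>tensor R M' N'\<^esub> tensor_coset R M' N' (?e b) = tensor_coset R M' N' (?e a)"
        using T'.tensor_add[of "?e (a - b)" "?e b"] k' diff by (simp add: frag_extend_diff)
      have 3: "tensor_coset R M' N' (?e (a - b)) \<in> carrier (tensor R M' N')"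
        using k' by (auto simp: T'.tensor_carrier simp del: carrier_free_Abelian_group_iff)
      have "h (tensor_coset R M N (a - b)) = tensor_coset R M' N' (?e (a - b))"
        using 1 2 3 diff add_hom_closed[OF h(1) tc(3)] add_hom_closed[OF h(1) tc(2)]
        by (metis A'.add.right_cancel)
      then show ?case using k k' by blast
    qed
    then show ?thesis by blast
  qed
  have eq: "tensor_map R M N M' N' f g t = h t" if t: "t \<in> carrier (tensor R M N)" for t
  proof -
    obtain c where c: "c \<in> carrier formal" "t = tensor_coset R M N c"
      using t unfolding tensor_carrier by blast
    have "(\<lambda>c. tensor_coset R M' N' (?e c)) ` t = {h t}"
    proof -
      have "tensor_coset R M' N' (?e c') = h t" if "c' \<in> t" for c'
        using coset_mem[OF that[unfolded c(2)] c(1)] ext[of c'] c(2) by simp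
      then show ?thesis using coset_self[OF c(1)] c(2) by blast
    qed
    then show ?thesis by (simp add: tensor_map_def)
  qed
  show "tensor_map R M N M' N' f g \<in> add_hom (tensor R M N) (tensor R M' N')"
    using h(1) abelian_group.a_group[OF tensor_abelian]
    by (intro add_homI) (auto simp: eq add_hom_closed add_hom_add abelian_groupE(1)[OF tensor_abelian])
  show "x \<in> carrier M \<Longrightarrow> y \<in> carrier N
      \<Longrightarrow> tensor_map R M N M' N' f g (tensor_elem R M N x y) = tensor_elem R M' N' (f x) (g y)"
    by (simp add: eq h(2) tensor_elem_closed)
qed

text \<open>\<beta> inherits the laws of elementary tensors through the isomorphism. In this way the
  algebraic laws of the product defined by \<mu> are extracted from a bare isomorphism.\<close>

lemma tensor_iso_by_balanced:
  assumes "tensor_iso_by R M N K \<beta>"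
  shows "balanced R M N K \<beta>"
proof -
  obtain h where h: "h \<in> add_hom (tensor R M N) K"
      "\<And>x y. x \<in> carrier M \<Longrightarrow> y \<in> carrier N \<Longrightarrow> h (tensor_elem R M N x y) = \<beta> x y"
    using assms by (auto simp: tensor_iso_by_def iso_def)
  show ?thesis
    unfolding balanced_def
  proof (intro conjI ballI)
    fix x assume x: "x \<in> carrier M"
    show "\<beta> x \<in> add_hom N K"
      using add_hom_compose[OF tensor_elem_hom(1)[OF x] h(1)] x h(2)
      by (simp add: hom_def Pi_iff)
  next
    fix y assume y: "y \<in> carrier N"
    show "(\<lambda>x. \<beta> x y) \<in> add_hom M K"
      using add_hom_compose[OF tensor_elem_hom(2)[OF y] h(1)] y h(2)
      by (simp add: hom_def Pi_iff)
  next
    fix x r y assume "x \<in> carrier M" "r \<in> carrier R" "y \<in> carrier N"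
    then show "\<beta> (x \<triangleleft>\<^bsub>M\<^esub> r) y = \<beta> x (r \<odot>\<^bsub>N\<^esub> y)"
      using balancedD(3)[OF tensor_elem_balanced] h(2) by (metis pair_lact_closed pair_ract_closed)
  qed
qed

text \<open>The isomorphism is onto, so that the values of \<beta> span K. The instances used are
  the products x b in a smooth module, the products in \<open>F (p \<otimes> q)\<close>, and the
  products of \<nu>_p(x) with elements of D.\<close>

lemma tensor_iso_by_induct [consumes 2, case_names elem add]:
  assumes "tensor_iso_by R M N K \<beta>" "k \<in> carrier K"
    and elem: "\<And>x y. x \<in> carrier M \<Longrightarrow> y \<in> carrier N \<Longrightarrow> Q (\<beta> x y)"
    and add: "\<And>k l. k \<in> carrier K \<Longrightarrow> l \<in> carrier K \<Longrightarrow> Q k \<Longrightarrow> Q l \<Longrightarrow> Q (k \<oplus>\<^bsub>K\<^esub> l)"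
  shows "Q k"
proof -
  obtain h where h: "h \<in> add_hom (tensor R M N) K" "bij_betw h (carrier (tensor R M N)) (carrier K)"
      "\<And>x y. x \<in> carrier M \<Longrightarrow> y \<in> carrier N \<Longrightarrow> h (tensor_elem R M N x y) = \<beta> x y"
    using assms(1) by (auto simp: tensor_iso_by_def iso_def)
  obtain t where t: "t \<in> carrier (tensor R M N)" "k = h t"
    using h(2) assms(2) by (auto simp: bij_betw_def)
  have "Q (h t)"
    using t(1) by (induction rule: tensor_induct) (auto simp: h(3) elem add_hom_add[OF h(1)] add_hom_closed[OF h(1)] add)
  then show ?thesis by (simp add: t)
qed

text \<open>Inverting the isomorphism transfers the universal property to K. An operator on D is
  later obtained in this way from a map on F_p.\<close>

lemma tensor_iso_by_universal:
  assumes iso: "tensor_iso_by R M N K \<beta>" and "abelian_group L" "balanced R M N L \<gamma>" "abelian_group K"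
  shows "\<exists>h \<in> add_hom K L. \<forall>x\<in>carrier M. \<forall>y\<in>carrier N. h (\<beta> x y) = \<gamma> x y"
proof -
  obtain h where h: "h \<in> iso (add_monoid (tensor R M N)) (add_monoid K)"
      "\<And>x y. x \<in> carrier M \<Longrightarrow> y \<in> carrier N \<Longrightarrow> h (tensor_elem R M N x y) = \<beta> x y"
    using assms(1) by (auto simp: tensor_iso_by_def)
  obtain k where k: "k \<in> add_hom (tensor R M N) L"
    "\<forall>x\<in>carrier M. \<forall>y\<in>carrier N. k (tensor_elem R M N x y) = \<gamma> x y"
    using tensor_universal[OF assms(2,3)] by blast
  let ?i = "inv_into (carrier (tensor R M N)) h"
  have "?i \<in> add_hom K (tensor R M N)"
    using group.iso_set_sym[OF abelian_group.a_group[OF tensor_abelian] h(1)] by (auto simp: iso_def)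
  moreover have "?i (\<beta> x y) = tensor_elem R M N x y" if "x \<in> carrier M" "y \<in> carrier N" for x y
    using h that tensor_elem_closed[OF that] by (auto simp: iso_def bij_betw_def simp flip: h(2))
  ultimately show ?thesis
    using add_hom_compose[of ?i K "tensor R M N" k L] k by (intro bexI[of _ "\<lambda>x. k (?i x)"]) auto
qed

text \<open>
  Injectivity is tested with partial inverses: an element of the tensor product involves only
  finitely many elementary tensors, and a homomorphism that inverts \<open>\<beta>\<close> on these recovers it.
\<close>

lemma tensor_iso_byI:
  assumes K: "abelian_group K" and bal: "balanced R M N K \<beta>"
    and surj: "\<And>k. k \<in> carrier K \<Longrightarrow> \<exists>X\<subseteq>carrier M. \<exists>y\<in>X \<rightarrow> carrier N. k = finsum K (\<lambda>x. \<beta> x (y x)) X"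
    and inj: "\<And>U. finite U \<Longrightarrow> U \<subseteq> carrier M \<times> carrier N \<Longrightarrow>
      \<exists>s\<in>add_hom K (tensor R M N). \<forall>(x, y)\<in>U. s (\<beta> x y) = tensor_elem R M N x y"
  shows "tensor_iso_by R M N K \<beta>"
proof -
  interpret K: abelian_group K by fact
  obtain h where h: "h \<in> add_hom (tensor R M N) K"
      "\<And>x y. x \<in> carrier M \<Longrightarrow> y \<in> carrier N \<Longrightarrow> h (tensor_elem R M N x y) = \<beta> x y"
    using tensor_universal[OF K bal] by blast
  \<comment> \<open>Because all partial inverses on U are quantified over, the property survives
    enlarging U. So unions take care of sums, and of two elements at once.\<close>
  define determined where "determined U t \<longleftrightarrow> finite U \<and> U \<subseteq> carrier M \<times> carrier N \<and>
      (\<forall>s\<in>add_hom K (tensor R M N). (\<forall>(x, y)\<in>U. s (\<beta> x y) = tensor_elem R M N x y) \<longrightarrow> s (h t) = t)" for U t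
  have detD: "s (h t) = t" if "determined U t" "s \<in> add_hom K (tensor R M N)" "\<forall>(x, y)\<in>U. s (\<beta> x y) = tensor_elem R M N x y"
    for U s t
    using that unfolding determined_def by blast
  have split: "\<exists>U. determined U t"
    if "t \<in> carrier (tensor R M N)" for t
    using that
  proof (induction rule: tensor_induct)
    case (elem x y)
    show ?case
      unfolding determined_def
    proof (intro exI[of _ "{(x, y)}"] conjI ballI impI)
      fix s assume "\<forall>(x', y')\<in>{(x, y)}. s (\<beta> x' y') = tensor_elem R M N x' y'"
      then have "s (\<beta> x y) = tensor_elem R M N x y" by blast
      then show "s (h (tensor_elem R M N x y)) = tensor_elem R M N x y" by (simp only: h(2)[OF elem])
    qed (use elem in auto)
  next
    case (add s t)
    obtain U where U: "determined U s" using add(3) by (rule exE)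
    obtain V where V: "determined V t" using add(4) by (rule exE)
    have "w (h (s \<oplus>\<^bsub>tensor R M N\<^esub> t)) = s \<oplus>\<^bsub>tensor R M N\<^esub> t"
      if w: "w \<in> add_hom K (tensor R M N)" and "\<forall>(x, y)\<in>U \<union> V. w (\<beta> x y) = tensor_elem R M N x y" for w
      using that(2) detD[OF U w] detD[OF V w]
      by (simp add: add_hom_add[OF h(1)] add_hom_add[OF w] add_hom_closed[OF h(1)] ball_Un add(1,2))
    then have "determined (U \<union> V) (s \<oplus>\<^bsub>tensor R M N\<^esub> t)"
      using U V unfolding determined_def by (meson finite_UnI Un_least)
    then show ?case by (rule exI)
  qed
  have "h \<in> iso (add_monoid (tensor R M N)) (add_monoid K)"
  proof -
    have "inj_on h (carrier (tensor R M N))"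
    proof (rule inj_onI)
      fix s t assume *: "s \<in> carrier (tensor R M N)" "t \<in> carrier (tensor R M N)" "h s = h t"
      obtain U where U: "determined U s" using split[OF *(1)] by (rule exE)
      obtain V where V: "determined V t" using split[OF *(2)] by (rule exE)
      have "finite (U \<union> V)" "U \<union> V \<subseteq> carrier M \<times> carrier N"
        using U V unfolding determined_def by (meson finite_UnI Un_least)+
      from inj[OF this] obtain w where
        w: "w \<in> add_hom K (tensor R M N)" "\<forall>(x, y)\<in>U \<union> V. w (\<beta> x y) = tensor_elem R M N x y"
        by (rule bexE)
      have "w (h s) = s" "w (h t) = t"
        using detD[OF U w(1)] detD[OF V w(1)] w(2) unfolding ball_Un by (meson)+
      then show "s = t" using *(3) by metis
    qed
    moreover have "h ` carrier (tensor R M N) = carrier K"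
    proof
      show "h ` carrier (tensor R M N) \<subseteq> carrier K" using add_hom_closed[OF h(1)] by blast
      show "carrier K \<subseteq> h ` carrier (tensor R M N)"
      proof
        fix k assume "k \<in> carrier K"
        then obtain X y where xy: "X \<subseteq> carrier M" "y \<in> X \<rightarrow> carrier N"
          "k = finsum K (\<lambda>x. \<beta> x (y x)) X" using surj by blast
        let ?t = "finsum (tensor R M N) (\<lambda>x. tensor_elem R M N x (y x)) X"
        have c: "(\<lambda>x. tensor_elem R M N x (y x)) \<in> X \<rightarrow> carrier (tensor R M N)"
          using xy by (auto intro!: tensor_elem_closed)
        have "h ?t = finsum K (\<lambda>x. h (tensor_elem R M N x (y x))) X"
          by (rule add_hom_finsum[OF tensor_abelian K h(1) c])
        also have "\<dots> = k"
          unfolding xy(3) using xy(1,2) balancedD(4)[OF bal] by (intro K.finsum_cong') (auto simp: h(2) Pi_iff subset_iff)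
        finally show "k \<in> h ` carrier (tensor R M N)"
          using abelian_monoid.finsum_closed[OF abelian_group.axioms(1)[OF tensor_abelian] c] by blast
      qed
    qed
    ultimately show ?thesis
      using h(1) by (auto simp: iso_def bij_betw_def)
  qed
  then show ?thesis using h(2) by (auto simp: tensor_iso_by_def)
qed

end

section \<open>Local units and dual bases\<close>

lemma abelian_group_cong:
  assumes "abelian_group R" "carrier R' = carrier R" "add R' = add R" "zero R' = zero R"
  shows "abelian_group R'"
proof -
  interpret abelian_group R by fact
  show ?thesis
    by (rule abelian_groupI) (auto simp: assms(2-4) a_ac intro: l_neg)
qed

lemma regular_bimodule_simps [simp]:
  "carrier (regular_bimodule R) = carrier R" "add (regular_bimodule R) = add R"
  "zero (regular_bimodule R) = zero R" "smult (regular_bimodule R) = mult R"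
  "ract (regular_bimodule R) = mult R"
  by (simp_all add: regular_bimodule_def)

lemma right_module_add_hom:
  assumes "right_module S M"
  shows "b \<in> carrier S \<Longrightarrow> (\<lambda>x. x \<triangleleft>\<^bsub>M\<^esub> b) \<in> add_hom M M"
    and "x \<in> carrier M \<Longrightarrow> (\<lambda>b. x \<triangleleft>\<^bsub>M\<^esub> b) \<in> add_hom S M"
  using right_module.ract_closed[OF assms] right_module.ract_add_module[OF assms]
    right_module.ract_add_ring[OF assms]
  by (auto intro!: add_homI)

lemma left_module_add_hom:
  assumes "left_module R M"
  shows "b \<in> carrier R \<Longrightarrow> (\<lambda>x. b \<odot>\<^bsub>M\<^esub> x) \<in> add_hom M M"
    and "x \<in> carrier M \<Longrightarrow> (\<lambda>b. b \<odot>\<^bsub>M\<^esub> x) \<in> add_hom R M"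
  using left_module.lact_closed[OF assms] left_module.lact_add_module[OF assms]
    left_module.lact_add_ring[OF assms]
  by (auto intro!: add_homI)

lemma idempotentsD: "e \<in> idempotents R \<Longrightarrow> e \<in> carrier R" "e \<in> idempotents R \<Longrightarrow> e \<otimes>\<^bsub>R\<^esub> e = e"
  by (auto simp: idempotents_def)

lemma tensor_pair_right_regular:
  assumes "right_module S M"
  shows "tensor_pair S M (regular_bimodule S)"
proof -
  interpret right_module S M by fact
  have "abelian_group (regular_bimodule S)"
    by (rule abelian_group_cong[OF S.abel]) auto
  then show ?thesis
    by (auto simp: tensor_pair_def tensor_pair_axioms_def M.abelian_group_axioms ract_closed S.m_closed)
qed

lemma tensor_pair_left_regular:
  assumes "left_module R M"
  shows "tensor_pair R (regular_bimodule R) M"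
proof -
  interpret left_module R M by fact
  have "abelian_group (regular_bimodule R)"
    by (rule abelian_group_cong[OF R.abel]) auto
  then show ?thesis
    by (auto simp: tensor_pair_def tensor_pair_axioms_def M.abelian_group_axioms lact_closed R.m_closed)
qed

text \<open>
  With local units, absorption directs the idempotents; \<open>for_large R Q\<close> says that \<open>Q\<close> holds eventually
  along this net.
\<close>

definition absorbs :: "('r, 'm) ring_scheme \<Rightarrow> 'r \<Rightarrow> 'r \<Rightarrow> bool" where
  "absorbs R e d \<longleftrightarrow> e \<in> idempotents R \<and> d \<in> idempotents R \<and> e \<otimes>\<^bsub>R\<^esub> d = d \<and> d \<otimes>\<^bsub>R\<^esub> e = d"

definition for_large :: "('r, 'm) ring_scheme \<Rightarrow> ('r \<Rightarrow> bool) \<Rightarrow> bool" where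
  "for_large R Q \<longleftrightarrow> (\<exists>d\<in>idempotents R. \<forall>e. absorbs R e d \<longrightarrow> Q e)"

context ring_with_local_units
begin

lemma absorbs_ex:
  assumes "d \<in> idempotents R" "d' \<in> idempotents R"
  shows "\<exists>e. absorbs R e d \<and> absorbs R e d'"
proof -
  have "finite {d, d'}" "{d, d'} \<subseteq> carrier R" using assms by (auto dest: idempotentsD(1))
  from local_units[OF this] show ?thesis using assms by (auto simp: absorbs_def)
qed

lemma absorbs_unit:
  assumes "absorbs R e d" "b \<in> carrier R"
  shows "d \<otimes> b = b \<Longrightarrow> e \<otimes> b = b" "b \<otimes> d = b \<Longrightarrow> b \<otimes> e = b"
  using assms m_assoc[of e d b] m_assoc[of b d e] by (auto simp: absorbs_def idempotents_def)

lemma absorbs_trans: "absorbs R e d \<Longrightarrow> absorbs R d c \<Longrightarrow> absorbs R e c"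
  using absorbs_unit[of e d c] by (auto simp: absorbs_def idempotents_def)

lemma for_large_mono:
  assumes "for_large R Q" "\<And>e. e \<in> carrier R \<Longrightarrow> Q e \<Longrightarrow> Q' e"
  shows "for_large R Q'"
  using assms by (auto simp: for_large_def absorbs_def idempotents_def)

lemma for_large_conj: "for_large R Q \<Longrightarrow> for_large R Q' \<Longrightarrow> for_large R (\<lambda>e. Q e \<and> Q' e)"
  unfolding for_large_def by (elim bexE) (metis absorbs_ex absorbs_trans absorbs_def)

lemma for_large_True: "for_large R (\<lambda>e. True)"
  using local_units[of "{}"] by (auto simp: for_large_def)

lemma for_large_finite:
  "finite X \<Longrightarrow> (\<And>x. x \<in> X \<Longrightarrow> for_large R (Q x)) \<Longrightarrow> for_large R (\<lambda>e. \<forall>x\<in>X. Q x e)"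
  by (induction X rule: finite_induct) (simp_all add: for_large_True for_large_conj)

lemma for_largeE:
  assumes "for_large R Q"
  obtains e where "e \<in> idempotents R" "e \<in> carrier R" "Q e"
proof -
  obtain d where d: "d \<in> idempotents R" "\<forall>e. absorbs R e d \<longrightarrow> Q e"
    using assms unfolding for_large_def by (rule bexE)
  then have "Q d" by (simp add: absorbs_def idempotentsD)
  then show thesis using that d(1) by (simp add: idempotentsD)
qed

lemma for_large_unit: "b \<in> carrier R \<Longrightarrow> for_large R (\<lambda>e. e \<otimes> b = b \<and> b \<otimes> e = b)"
  using local_units[of "{b}"] absorbs_unit[of _ _ b] unfolding for_large_def
  by (clarsimp, intro bexI) auto

end

text \<open>Elements are sums of products x b, and a right unit of b fixes x b. Sums cause no
  trouble, since two conditions that hold for large e hold jointly for large e.\<close>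

lemma smooth_right_unit:
  assumes "ring_with_local_units S" "right_module S M" "smooth_right S M" "x \<in> carrier M"
  shows "for_large S (\<lambda>e. x \<triangleleft>\<^bsub>M\<^esub> e = x)"
proof -
  interpret S: ring_with_local_units S by fact
  interpret right_module S M by fact
  interpret T: tensor_pair S M "regular_bimodule S" by (rule tensor_pair_right_regular) fact
  from assms(3)[unfolded smooth_right_def] assms(4) show ?thesis
  proof (induction rule: T.tensor_iso_by_induct)
    case (elem x y)
    then show ?case
      using S.for_large_unit[of y] by (auto simp: ract_mult[symmetric] elim: S.for_large_mono)
  next
    case (add k l)
    show ?case
      using S.for_large_conj[OF add(3,4)] by (rule S.for_large_mono) (simp add: ract_add_module add(1,2))
  qed
qed

lemma smooth_left_unit:
  assumes "ring_with_local_units R" "left_module R M" "smooth_left R M" "x \<in> carrier M"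
  shows "for_large R (\<lambda>e. e \<odot>\<^bsub>M\<^esub> x = x)"
proof -
  interpret R: ring_with_local_units R by fact
  interpret left_module R M by fact
  interpret T: tensor_pair R "regular_bimodule R" M by (rule tensor_pair_left_regular) fact
  from assms(3)[unfolded smooth_left_def] assms(4) show ?thesis
  proof (induction rule: T.tensor_iso_by_induct)
    case (elem y x)
    then show ?case
      using R.for_large_unit[of y] by (auto simp: lact_mult[symmetric] elim: R.for_large_mono)
  next
    case (add k l)
    show ?case
      using R.for_large_conj[OF add(3,4)] by (rule R.for_large_mono) (simp add: lact_add_module add(1,2))
  qed
qed

text \<open>A converse of \<open>smooth_right_unit\<close>. Surjectivity is k = k e. For finitely
  many tensors x \<otimes> y, choose e with y e = y for all of them; then x \<mapsto> x \<otimes> e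
  is a partial inverse of multiplication, because (x y) \<otimes> e = x \<otimes> (y e) = x
  \<otimes> y.\<close>

lemma smooth_rightI:
  assumes "ring_with_local_units S" "right_module S M"
    and unit: "\<And>x. x \<in> carrier M \<Longrightarrow> \<exists>e\<in>idempotents S. x \<triangleleft>\<^bsub>M\<^esub> e = x"
  shows "smooth_right S M"
proof -
  interpret S: ring_with_local_units S by fact
  interpret right_module S M by fact
  interpret T: tensor_pair S M "regular_bimodule S" by (rule tensor_pair_right_regular) fact
  show ?thesis
    unfolding smooth_right_def
  proof (rule T.tensor_iso_byI[OF M.abelian_group_axioms])
    show "balanced S M (regular_bimodule S) M (\<lambda>x b. x \<triangleleft>\<^bsub>M\<^esub> b)"
      unfolding balanced_def using right_module_add_hom[OF assms(2)]
      by (auto simp: ract_mult hom_def)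
  next
    fix k assume k: "k \<in> carrier M"
    then obtain e where e: "e \<in> idempotents S" "k \<triangleleft>\<^bsub>M\<^esub> e = k" using unit by blast
    then have "k = finsum M (\<lambda>x. x \<triangleleft>\<^bsub>M\<^esub> e) {k}" using k by (simp add: M.finsum_insert)
    then show "\<exists>X\<subseteq>carrier M. \<exists>y\<in>X \<rightarrow> carrier (regular_bimodule S). k = finsum M (\<lambda>x. x \<triangleleft>\<^bsub>M\<^esub> y x) X"
      using k e idempotentsD(1) by (intro exI[of _ "{k}"] conjI bexI[of _ "\<lambda>x. e"]) auto
  next
    fix U assume U: "finite U" "U \<subseteq> carrier M \<times> carrier (regular_bimodule S)"
    then have "finite (snd ` U)" "snd ` U \<subseteq> carrier S" by auto
    from S.local_units[OF this] obtain e where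
      e: "e \<in> idempotents S" "\<forall>y\<in>snd ` U. e \<otimes>\<^bsub>S\<^esub> y = y \<and> y \<otimes>\<^bsub>S\<^esub> e = y"
      by (rule bexE)
    have "tensor_elem S M (regular_bimodule S) (x \<triangleleft>\<^bsub>M\<^esub> y) e = tensor_elem S M (regular_bimodule S) x y" if "(x, y) \<in> U" for x y
    proof -
      have "x \<in> carrier M" "y \<in> carrier S" "y \<otimes>\<^bsub>S\<^esub> e = y" using U(2) e(2) that by force+
      then show ?thesis
        using balancedD(3)[OF T.tensor_elem_balanced, of x y e] idempotentsD(1)[OF e(1)] by simp
    qed
    moreover have "(\<lambda>x. tensor_elem S M (regular_bimodule S) x e) \<in> add_hom M (tensor S M (regular_bimodule S))"
      using T.tensor_elem_hom(2) idempotentsD(1)[OF e(1)] by simp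
    ultimately show "\<exists>s\<in>add_hom M (tensor S M (regular_bimodule S)).
        \<forall>(x, y)\<in>U. s (x \<triangleleft>\<^bsub>M\<^esub> y) = tensor_elem S M (regular_bimodule S) x y"
      by (intro bexI[of _ "\<lambda>x. tensor_elem S M (regular_bimodule S) x e"]) auto
  qed
qed

section \<open>The dual basis lemma over a ring with local units\<close>

definition power_module ::
  "'a set \<Rightarrow> ('s, 'm) ring_scheme \<Rightarrow> ('r, 'a \<Rightarrow> 's, 's) bimodule" where
  "power_module X S =
    \<lparr>carrier = X \<rightarrow>\<^sub>E carrier S, mult = undefined, one = undefined,
     zero = (\<lambda>x\<in>X. \<zero>\<^bsub>S\<^esub>), add = (\<lambda>f g. \<lambda>x\<in>X. f x \<oplus>\<^bsub>S\<^esub> g x),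
     smult = undefined, ract = (\<lambda>f b. \<lambda>x\<in>X. f x \<otimes>\<^bsub>S\<^esub> b)\<rparr>"

lemma power_module_right_module:
  assumes "nonunital_ring S"
  shows "right_module S (power_module X S)"
proof -
  interpret S: nonunital_ring S by fact
  have "abelian_group (power_module X S)"
  proof (rule abelian_groupI)
    fix f assume "f \<in> carrier (power_module X S)"
    then show "\<exists>g\<in>carrier (power_module X S). g \<oplus>\<^bsub>power_module X S\<^esub> f = \<zero>\<^bsub>power_module X S\<^esub>"
      by (intro bexI[of _ "\<lambda>x\<in>X. \<ominus>\<^bsub>S\<^esub> f x"]) (auto simp: power_module_def S.l_neg PiE_iff intro!: restrict_ext)
  next
    fix f assume "f \<in> carrier (power_module X S)"
    then show "\<zero>\<^bsub>power_module X S\<^esub> \<oplus>\<^bsub>power_module X S\<^esub> f = f"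
      by (auto simp: power_module_def PiE_iff extensional_def fun_eq_iff)
  qed (auto simp: power_module_def PiE_iff S.a_ac intro!: restrict_ext)
  then show ?thesis
  proof (rule right_module.intro[OF assms], intro right_module_axioms.intro)
    fix f b assume "b \<in> carrier S" "f \<in> carrier (power_module X S)"
    then show "f \<triangleleft>\<^bsub>power_module X S\<^esub> b \<in> carrier (power_module X S)"
      by (auto simp: power_module_def PiE_iff S.m_closed)
  next
    fix a b f assume "a \<in> carrier S" "b \<in> carrier S" "f \<in> carrier (power_module X S)"
    then show "f \<triangleleft>\<^bsub>power_module X S\<^esub> (a \<oplus>\<^bsub>S\<^esub> b)
        = f \<triangleleft>\<^bsub>power_module X S\<^esub> a \<oplus>\<^bsub>power_module X S\<^esub> f \<triangleleft>\<^bsub>power_module X S\<^esub> b"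
      "f \<triangleleft>\<^bsub>power_module X S\<^esub> (a \<otimes>\<^bsub>S\<^esub> b) = f \<triangleleft>\<^bsub>power_module X S\<^esub> a \<triangleleft>\<^bsub>power_module X S\<^esub> b"
      by (auto simp: power_module_def PiE_iff fun_eq_iff S.r_distr S.m_assoc)
  next
    fix b f g assume "b \<in> carrier S" "f \<in> carrier (power_module X S)" "g \<in> carrier (power_module X S)"
    then show "(f \<oplus>\<^bsub>power_module X S\<^esub> g) \<triangleleft>\<^bsub>power_module X S\<^esub> b
        = f \<triangleleft>\<^bsub>power_module X S\<^esub> b \<oplus>\<^bsub>power_module X S\<^esub> g \<triangleleft>\<^bsub>power_module X S\<^esub> b"
      by (auto simp: power_module_def PiE_iff fun_eq_iff S.l_distr)
  qed
qed

text \<open>Finitely many generators X give a surjection g from S^X onto M, projectivity splits it,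
  and \<phi> x is the coordinate at x of the splitting h. As a set of functions, S^X lies in the
  type of the test modules of \<open>projective_right\<close>.\<close>

lemma dual_basis:
  fixes S :: "('s, 'm) ring_scheme" and M :: "('r, 'a, 's) bimodule"
  assumes "ring_with_local_units S" "right_module S M" "smooth_right S M"
    and fg: "fin_gen_right S M" and proj: "projective_right S M"
  shows "\<exists>X \<phi>. finite X \<and> X \<subseteq> carrier M \<and> (\<forall>x\<in>X. \<phi> x \<in> right_hom S M (regular_bimodule S)) \<and>
    (\<forall>y\<in>carrier M. finsum M (\<lambda>x. x \<triangleleft>\<^bsub>M\<^esub> \<phi> x y) X = y)"
proof -
  interpret S: ring_with_local_units S by fact
  interpret right_module S M by fact
  from fg[unfolded fin_gen_right_def] obtain X where X': "finite X \<and> X \<subseteq> carrier M \<and>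
      (\<forall>N. additive_subgroup N M \<and> X \<subseteq> N \<and> (\<forall>x\<in>N. \<forall>b\<in>carrier S. x \<triangleleft>\<^bsub>M\<^esub> b \<in> N) \<longrightarrow> N = carrier M)"
    by (rule exE)
  then have X: "finite X" "X \<subseteq> carrier M" by simp_all
  have gen: "N = carrier M"
    if "additive_subgroup N M" "X \<subseteq> N" "\<forall>x\<in>N. \<forall>b\<in>carrier S. x \<triangleleft>\<^bsub>M\<^esub> b \<in> N" for N
    using X'[THEN conjunct2, THEN conjunct2, rule_format, of N] that by simp
  define N :: "('r, 'a \<Rightarrow> 's, 's) bimodule" where "N = power_module X S"
  have N: "right_module S N" unfolding N_def by (rule power_module_right_module) unfold_locales
  interpret N: right_module S N by (rule N)
  have Nc: "carrier N = X \<rightarrow>\<^sub>E carrier S" by (simp add: N_def power_module_def)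
  \<comment> \<open>Finiteness of X enters here: one local unit serves all coordinates of f.\<close>
  have "smooth_right S N"
  proof (rule smooth_rightI[OF assms(1) N])
    fix f assume f: "f \<in> carrier N"
    then have "finite (f ` X)" "f ` X \<subseteq> carrier S" using X(1) by (auto simp: Nc)
    then obtain e where e: "e \<in> idempotents S" "\<And>x. x \<in> X \<Longrightarrow> f x \<otimes>\<^bsub>S\<^esub> e = f x"
      using S.local_units[of "f ` X"] by auto
    then have "f \<triangleleft>\<^bsub>N\<^esub> e = f"
      using f by (auto simp: N_def power_module_def PiE_iff extensional_def fun_eq_iff)
    then show "\<exists>e\<in>idempotents S. f \<triangleleft>\<^bsub>N\<^esub> e = f" using e(1) by blast
  qed
  define g where "g = (\<lambda>f\<in>carrier N. finsum M (\<lambda>x. x \<triangleleft>\<^bsub>M\<^esub> f x) X)"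
  have gcl: "(\<lambda>x. x \<triangleleft>\<^bsub>M\<^esub> f x) \<in> X \<rightarrow> carrier M" if "f \<in> carrier N" for f
    using that X(2) by (auto simp: Nc intro!: ract_closed)
  have g_hom: "g \<in> add_hom N M"
  proof (rule add_homI)
    fix f assume "f \<in> carrier N"
    then show "g f \<in> carrier M" using gcl by (simp add: g_def M.finsum_closed)
  next
    fix f f' assume f: "f \<in> carrier N" "f' \<in> carrier N"
    have "finsum M (\<lambda>x. x \<triangleleft>\<^bsub>M\<^esub> (f \<oplus>\<^bsub>N\<^esub> f') x) X = finsum M (\<lambda>x. x \<triangleleft>\<^bsub>M\<^esub> f x \<oplus>\<^bsub>M\<^esub> x \<triangleleft>\<^bsub>M\<^esub> f' x) X"
      using f gcl[OF f(1)] gcl[OF f(2)] X(2)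
      by (intro M.finsum_cong') (auto simp: N_def power_module_def intro!: ract_add_ring)
    also have "\<dots> = finsum M (\<lambda>x. x \<triangleleft>\<^bsub>M\<^esub> f x) X \<oplus>\<^bsub>M\<^esub> finsum M (\<lambda>x. x \<triangleleft>\<^bsub>M\<^esub> f' x) X"
      using f gcl by (intro M.finsum_addf) auto
    finally show "g (f \<oplus>\<^bsub>N\<^esub> f') = g f \<oplus>\<^bsub>M\<^esub> g f'" using f by (simp add: g_def)
  qed
  have g_ract: "g (f \<triangleleft>\<^bsub>N\<^esub> b) = g f \<triangleleft>\<^bsub>M\<^esub> b" if f: "f \<in> carrier N" and b: "b \<in> carrier S" for f b
  proof -
    have "g f \<triangleleft>\<^bsub>M\<^esub> b = finsum M (\<lambda>x. x \<triangleleft>\<^bsub>M\<^esub> f x \<triangleleft>\<^bsub>M\<^esub> b) X"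
      using add_hom_finsum[OF M.abelian_group_axioms M.abelian_group_axioms right_module_add_hom(1)[OF assms(2) b] gcl[OF f]] f
      by (simp add: g_def)
    also have "\<dots> = finsum M (\<lambda>x. x \<triangleleft>\<^bsub>M\<^esub> (f \<triangleleft>\<^bsub>N\<^esub> b) x) X"
      using gcl[OF N.ract_closed[OF b f]] X(2) f b
      by (intro M.finsum_cong') (auto simp: N_def power_module_def PiE_iff subset_iff intro!: ract_mult[symmetric])
    finally show ?thesis using N.ract_closed[OF b f] by (simp add: g_def)
  qed
  have surj: "g ` carrier N = carrier M"
  proof (rule gen)
    interpret gh: group_hom "add_monoid N" "add_monoid M" g
      using g_hom by (simp add: group_hom_def group_hom_axioms_def N.M.a_group M.a_group)
    show "additive_subgroup (g ` carrier N) M"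
      using gh.img_is_subgroup by (simp add: additive_subgroup_def)
    show "X \<subseteq> g ` carrier N"
    proof
      fix x assume x: "x \<in> X"
      obtain e where e: "e \<in> idempotents S" "x \<triangleleft>\<^bsub>M\<^esub> e = x"
        using smooth_right_unit[OF assms(1-3) subsetD[OF X(2) x]] by (rule S.for_largeE)
      \<comment> \<open>Since S has only local units, the generator x is reached as x = x e, by the
        vector with e at x and zero elsewhere.\<close>
      define f where "f = (\<lambda>y\<in>X. if x = y then e else \<zero>\<^bsub>S\<^esub>)"
      have f: "f \<in> carrier N" using idempotentsD(1)[OF e(1)] by (auto simp: f_def Nc)
      have z: "y \<triangleleft>\<^bsub>M\<^esub> \<zero>\<^bsub>S\<^esub> = \<zero>\<^bsub>M\<^esub>" if "y \<in> carrier M" for y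
        using add_hom_zero[OF S.abel M.abelian_group_axioms right_module_add_hom(2)[OF assms(2) that]] .
      have "g f = finsum M (\<lambda>y. if x = y then y \<triangleleft>\<^bsub>M\<^esub> e else \<zero>\<^bsub>M\<^esub>) X"
        using f X(2) z idempotentsD(1)[OF e(1)] unfolding g_def
        by (auto simp: f_def subset_iff ract_closed intro!: M.finsum_cong')
      also have "\<dots> = x"
        using M.finsum_singleton[OF x X(1), of "\<lambda>y. y \<triangleleft>\<^bsub>M\<^esub> e"] X(2) e idempotentsD(1)[OF e(1)]
        by (auto simp: ract_closed subset_iff)
      finally show "x \<in> g ` carrier N" using f by blast
    qed
    show "\<forall>x\<in>g ` carrier N. \<forall>b\<in>carrier S. x \<triangleleft>\<^bsub>M\<^esub> b \<in> g ` carrier N"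
    proof (intro ballI)
      fix x b assume "x \<in> g ` carrier N" "b \<in> carrier S"
      then obtain f where "f \<in> carrier N" "x = g f" by blast
      then show "x \<triangleleft>\<^bsub>M\<^esub> b \<in> g ` carrier N"
        using g_ract[of f b] N.ract_closed[of b f] \<open>b \<in> carrier S\<close> by (metis imageI)
    qed
  qed
  have g: "g \<in> right_hom S N M"
    using g_hom g_ract add_hom_closed[OF g_hom] by (auto simp: right_hom_def g_def)
  \<comment> \<open>The map to be lifted along g is the identity, restricted to the carrier because
    \<open>right_hom\<close> consists of extensional maps.\<close>
  have "(\<lambda>x\<in>carrier M. x) \<in> right_hom S M M"
    by (auto simp: right_hom_def ract_closed intro!: homI)
  then obtain h where h: "h \<in> right_hom S M N" "\<And>x. x \<in> carrier M \<Longrightarrow> g (h x) = x"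
    using proj[unfolded projective_right_def, rule_format, of N M g "\<lambda>x\<in>carrier M. x"]
      N assms(2,3) \<open>smooth_right S N\<close> g surj by auto
  have hc: "h y \<in> carrier N" if "y \<in> carrier M" for y
    using h(1) that by (auto simp: right_hom_def)
  define \<phi> where "\<phi> x = (\<lambda>y\<in>carrier M. h y x)" for x
  have "\<phi> x \<in> right_hom S M (regular_bimodule S)" if "x \<in> X" for x
  proof -
    have "\<phi> x \<in> carrier M \<rightarrow>\<^sub>E carrier S" using hc that by (auto simp: \<phi>_def Nc)
    moreover have "\<phi> x (y \<oplus>\<^bsub>M\<^esub> y') = \<phi> x y \<oplus>\<^bsub>S\<^esub> \<phi> x y'" if "y \<in> carrier M" "y' \<in> carrier M" for y y'
      using h(1) that \<open>x \<in> X\<close> add_hom_add[of h M N y y']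
      by (simp add: right_hom_def \<phi>_def) (simp add: N_def power_module_def)
    moreover have "\<phi> x (y \<triangleleft>\<^bsub>M\<^esub> b) = \<phi> x y \<otimes>\<^bsub>S\<^esub> b" if "y \<in> carrier M" "b \<in> carrier S" for y b
      using h(1) that \<open>x \<in> X\<close> by (simp add: right_hom_def \<phi>_def ract_closed N_def power_module_def)
    ultimately show ?thesis by (auto simp: right_hom_def intro!: homI)
  qed
  moreover have "finsum M (\<lambda>x. x \<triangleleft>\<^bsub>M\<^esub> \<phi> x y) X = y" if "y \<in> carrier M" for y
    using h(2)[OF that] hc[OF that] that by (simp add: g_def \<phi>_def)
  ultimately show ?thesis using X by (intro exI[of _ X] exI[of _ \<phi>]) simp
qed

section \<open>The bimodules of a diagram\<close>

lemma right_homD: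
  assumes "f \<in> right_hom S M N"
  shows "f \<in> add_hom M N" "f \<in> extensional (carrier M)"
    "x \<in> carrier M \<Longrightarrow> f x \<in> carrier N"
    "x \<in> carrier M \<Longrightarrow> b \<in> carrier S \<Longrightarrow> f (x \<triangleleft>\<^bsub>M\<^esub> b) = f x \<triangleleft>\<^bsub>N\<^esub> b"
    "x \<in> carrier M \<Longrightarrow> y \<in> carrier M \<Longrightarrow> f (x \<oplus>\<^bsub>M\<^esub> y) = f x \<oplus>\<^bsub>N\<^esub> f y"
  using assms by (auto simp: right_hom_def add_hom_add PiE_iff)

lemma right_homI:
  assumes "\<And>x. x \<in> carrier M \<Longrightarrow> f x \<in> carrier N" "f \<in> extensional (carrier M)"
    "\<And>x y. x \<in> carrier M \<Longrightarrow> y \<in> carrier M \<Longrightarrow> f (x \<oplus>\<^bsub>M\<^esub> y) = f x \<oplus>\<^bsub>N\<^esub> f y"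
    "\<And>x b. x \<in> carrier M \<Longrightarrow> b \<in> carrier S \<Longrightarrow> f (x \<triangleleft>\<^bsub>M\<^esub> b) = f x \<triangleleft>\<^bsub>N\<^esub> b"
  shows "f \<in> right_hom S M N"
  using assms add_homI[of M f N] by (auto simp: right_hom_def PiE_iff)

lemma right_hom_eqI:
  assumes "f \<in> right_hom S M N" "g \<in> right_hom S' M N'" "\<And>x. x \<in> carrier M \<Longrightarrow> f x = g x"
  shows "f = g"
  by (rule extensionalityI[OF right_homD(2)[OF assms(1)] right_homD(2)[OF assms(2)]]) (rule assms(3))

lemma right_hom_compose:
  assumes "f \<in> right_hom S N L" "g \<in> right_hom S M N" "right_module S M"
  shows "compose (carrier M) f g \<in> right_hom S M L"
proof -
  interpret right_module S M by fact
  show ?thesis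
    using right_homD[OF assms(1)] right_homD[OF assms(2)]
    by (intro right_homI) (auto simp: compose_def ract_closed)
qed

lemma hom_bimodule_simps [simp]:
  "carrier (hom_bimodule S M N) = right_hom S M N"
  "zero (hom_bimodule S M N) = (\<lambda>x\<in>carrier M. \<zero>\<^bsub>N\<^esub>)"
  "add (hom_bimodule S M N) = (\<lambda>f g. \<lambda>x\<in>carrier M. f x \<oplus>\<^bsub>N\<^esub> g x)"
  "ract (hom_bimodule S M N) = (\<lambda>f b. \<lambda>x\<in>carrier M. f (b \<odot>\<^bsub>M\<^esub> x))"
  by (simp_all add: hom_bimodule_def)

lemma right_module_zero_act:
  assumes "right_module S N" "b \<in> carrier S"
  shows "\<zero>\<^bsub>N\<^esub> \<triangleleft>\<^bsub>N\<^esub> b = \<zero>\<^bsub>N\<^esub>"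
proof -
  interpret right_module S N by fact
  show ?thesis
    using add_hom_zero[OF M.abelian_group_axioms M.abelian_group_axioms right_module_add_hom(1)[OF assms]] .
qed

lemma right_module_minus_act:
  assumes "right_module S N" "b \<in> carrier S" "x \<in> carrier N"
  shows "(\<ominus>\<^bsub>N\<^esub> x) \<triangleleft>\<^bsub>N\<^esub> b = \<ominus>\<^bsub>N\<^esub> (x \<triangleleft>\<^bsub>N\<^esub> b)"
proof -
  interpret right_module S N by fact
  show ?thesis
    using add_hom_minus[OF M.abelian_group_axioms M.abelian_group_axioms right_module_add_hom(1)[OF assms(1,2)] assms(3)] .
qed

lemma
  assumes M: "right_module S M" and N: "right_module S N"
  shows hom_bimodule_abelian: "abelian_group (hom_bimodule S M N)"
    and hom_bimodule_minus: "f \<in> right_hom S M N \<Longrightarrow> \<ominus>\<^bsub>hom_bimodule S M N\<^esub> f = (\<lambda>x\<in>carrier M. \<ominus>\<^bsub>N\<^esub> f x)"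
proof -
  interpret M: right_module S M by (rule M)
  interpret N: right_module S N by (rule N)
  have add: "(\<lambda>x\<in>carrier M. f x \<oplus>\<^bsub>N\<^esub> g x) \<in> right_hom S M N" if "f \<in> right_hom S M N" "g \<in> right_hom S M N" for f g
    using right_homD[OF that(1)] right_homD[OF that(2)]
    by (intro right_homI) (auto simp: M.ract_closed N.ract_add_module N.M.a_ac)
  have zero: "(\<lambda>x\<in>carrier M. \<zero>\<^bsub>N\<^esub>) \<in> right_hom S M N"
    by (intro right_homI) (auto simp: M.ract_closed right_module_zero_act[OF N])
  have minus: "(\<lambda>x\<in>carrier M. \<ominus>\<^bsub>N\<^esub> f x) \<in> right_hom S M N" if "f \<in> right_hom S M N" for f
    using right_homD[OF that]
    by (intro right_homI) (auto simp: M.ract_closed right_module_minus_act[OF N] N.M.minus_add)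
  have l_minus: "(\<lambda>x\<in>carrier M. (\<lambda>x\<in>carrier M. \<ominus>\<^bsub>N\<^esub> f x) x \<oplus>\<^bsub>N\<^esub> f x) = (\<lambda>x\<in>carrier M. \<zero>\<^bsub>N\<^esub>)"
    if "f \<in> right_hom S M N" for f
    using right_homD[OF that] by (auto simp: N.M.l_neg intro!: restrict_ext)
  show ab: "abelian_group (hom_bimodule S M N)"
  proof (rule abelian_groupI)
    fix f assume "f \<in> carrier (hom_bimodule S M N)"
    then have f: "f \<in> right_hom S M N" by simp
    then show "\<zero>\<^bsub>hom_bimodule S M N\<^esub> \<oplus>\<^bsub>hom_bimodule S M N\<^esub> f = f"
      using right_homD[OF f] by (auto simp: fun_eq_iff extensional_def)
    show "\<exists>g\<in>carrier (hom_bimodule S M N). g \<oplus>\<^bsub>hom_bimodule S M N\<^esub> f = \<zero>\<^bsub>hom_bimodule S M N\<^esub>"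
      using minus[OF f] l_minus[OF f] by (intro bexI[of _ "\<lambda>x\<in>carrier M. \<ominus>\<^bsub>N\<^esub> f x"]) simp_all
  next
    fix f g h assume "f \<in> carrier (hom_bimodule S M N)" "g \<in> carrier (hom_bimodule S M N)"
    then have f: "f \<in> right_hom S M N" and g: "g \<in> right_hom S M N" by simp_all
    show "f \<oplus>\<^bsub>hom_bimodule S M N\<^esub> g \<in> carrier (hom_bimodule S M N)"
      using add[OF f g] by simp
    show "f \<oplus>\<^bsub>hom_bimodule S M N\<^esub> g = g \<oplus>\<^bsub>hom_bimodule S M N\<^esub> f"
      using right_homD(3)[OF f] right_homD(3)[OF g] by (auto simp: N.M.a_comm intro!: restrict_ext)
    assume "h \<in> carrier (hom_bimodule S M N)"
    then have h: "h \<in> right_hom S M N" by simp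
    show "f \<oplus>\<^bsub>hom_bimodule S M N\<^esub> g \<oplus>\<^bsub>hom_bimodule S M N\<^esub> h = f \<oplus>\<^bsub>hom_bimodule S M N\<^esub> (g \<oplus>\<^bsub>hom_bimodule S M N\<^esub> h)"
      using right_homD(3)[OF f] right_homD(3)[OF g] right_homD(3)[OF h] by (auto simp: N.M.a_assoc intro!: restrict_ext)
  qed (simp add: zero)
  show "\<ominus>\<^bsub>hom_bimodule S M N\<^esub> f = (\<lambda>x\<in>carrier M. \<ominus>\<^bsub>N\<^esub> f x)" if "f \<in> right_hom S M N" for f
    using that minus[OF that] l_minus[OF that] by (intro abelian_group.minus_equality[OF ab]) simp_all
qed

section \<open>Products of elements of the bimodules in the diagram\<close>

context proper_ore_diagram
begin

abbreviation "A \<equiv> F \<one>"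

lemma bimodule_F: "p \<in> carrier P \<Longrightarrow> bimodule A A (F p)"
  using proper by (auto simp: proper_bimodule_def smooth_bimodule_def)

lemma left_F: "p \<in> carrier P \<Longrightarrow> left_module A (F p)"
  using bimodule_F by (auto simp: bimodule_def)

lemma right_F: "p \<in> carrier P \<Longrightarrow> right_module A (F p)"
  using bimodule_F by (auto simp: bimodule_def)

lemma abelian_F: "p \<in> carrier P \<Longrightarrow> abelian_group (F p)"
  using right_F by (auto simp: right_module_def)

lemma smooth_F: "p \<in> carrier P \<Longrightarrow> smooth_left A (F p)" "p \<in> carrier P \<Longrightarrow> smooth_right A (F p)"
  using proper[of p] smooth_bimodule.smooth_left[of A A "F p"] smooth_bimodule.smooth_right[of A A "F p"]
  by (auto simp: proper_bimodule_def)

lemmas lact_F = left_module.lact_closed[OF left_F]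
lemmas ract_F = right_module.ract_closed[OF right_F]
lemmas lact_ract_F = bimodule.lact_ract[OF bimodule_F]

sublocale A: ring_with_local_units A by (rule base_ring)

lemma pair_F: "p \<in> carrier P \<Longrightarrow> q \<in> carrier P \<Longrightarrow> tensor_pair A (F p) (F q)"
  by (auto simp: tensor_pair_def tensor_pair_axioms_def abelian_F lact_F ract_F)

text \<open>The multiplication of the P-graded ring formed by the F_p. Identities of maps on the
  tensor products become identities between such products of elements.\<close>

definition dmul :: "'p \<Rightarrow> 'p \<Rightarrow> 'a \<Rightarrow> 'a \<Rightarrow> 'a" where
  "dmul p q x y = \<mu> p q (tensor_elem A (F p) (F q) x y)"

lemma dmul_iso:
  assumes "p \<in> carrier P" "q \<in> carrier P"
  shows "tensor_iso_by A (F p) (F q) (F (p \<otimes> q)) (dmul p q)"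
  unfolding tensor_iso_by_def dmul_def
  using mu_iso[OF assms] by (intro bexI[of _ "\<mu> p q"]) (auto simp: bimodule_iso_def)

lemma dmul_balanced: "p \<in> carrier P \<Longrightarrow> q \<in> carrier P \<Longrightarrow> balanced A (F p) (F q) (F (p \<otimes> q)) (dmul p q)"
  by (rule tensor_pair.tensor_iso_by_balanced[OF pair_F dmul_iso])

lemmas dmul_hom_right = balancedD(1)[OF dmul_balanced]
lemmas dmul_hom_left = balancedD(2)[OF dmul_balanced]
lemmas dmul_mid = balancedD(3)[OF dmul_balanced]
lemmas dmul_closed = balancedD(4)[OF dmul_balanced]

lemma dmul_add_left:
  "p \<in> carrier P \<Longrightarrow> q \<in> carrier P \<Longrightarrow> y \<in> carrier (F q) \<Longrightarrow> x \<in> carrier (F p) \<Longrightarrow> x' \<in> carrier (F p)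
    \<Longrightarrow> dmul p q (x \<oplus>\<^bsub>F p\<^esub> x') y = dmul p q x y \<oplus>\<^bsub>F (p \<otimes> q)\<^esub> dmul p q x' y"
  by (rule add_hom_add[OF dmul_hom_left])

lemma dmul_assoc:
  "\<lbrakk>p \<in> carrier P; q \<in> carrier P; t \<in> carrier P; x \<in> carrier (F p); y \<in> carrier (F q); z \<in> carrier (F t)\<rbrakk>
    \<Longrightarrow> dmul (p \<otimes> q) t (dmul p q x y) z = dmul p (q \<otimes> t) x (dmul q t y z)"
  by (simp add: dmul_def mu_assoc)

lemma dmul_one_left: "\<lbrakk>q \<in> carrier P; a \<in> carrier A; x \<in> carrier (F q)\<rbrakk> \<Longrightarrow> dmul \<one> q a x = a \<odot>\<^bsub>F q\<^esub> x"
  by (simp add: dmul_def mu_one_left)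

lemma dmul_one_right: "\<lbrakk>q \<in> carrier P; x \<in> carrier (F q); a \<in> carrier A\<rbrakk> \<Longrightarrow> dmul q \<one> x a = x \<triangleleft>\<^bsub>F q\<^esub> a"
  by (simp add: dmul_def mu_one_right)

text \<open>The left action on a tensor product is a \<open>tensor_map\<close>, whose values on
  elementary tensors are known, and \<mu> is a map of bimodules.\<close>

lemma dmul_lact:
  assumes "p \<in> carrier P" "q \<in> carrier P" "x \<in> carrier (F p)" "y \<in> carrier (F q)" "a \<in> carrier A"
  shows "a \<odot>\<^bsub>F (p \<otimes> q)\<^esub> dmul p q x y = dmul p q (a \<odot>\<^bsub>F p\<^esub> x) y"
proof -
  interpret T: tensor_pair A "F p" "F q" using assms by (intro pair_F)
  have "a \<odot>\<^bsub>tensor A (F p) (F q)\<^esub> tensor_elem A (F p) (F q) x y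
      = tensor_map A (F p) (F q) (F p) (F q) (\<lambda>x. a \<odot>\<^bsub>F p\<^esub> x) (\<lambda>y. y) (tensor_elem A (F p) (F q) x y)"
    by (simp add: tensor_def Let_def)
  also have "\<dots> = tensor_elem A (F p) (F q) (a \<odot>\<^bsub>F p\<^esub> x) y"
    using assms left_module_add_hom(1)[OF left_F] lact_ract_F
    by (intro T.tensor_map(2)[OF T.tensor_pair_axioms]) (auto simp: hom_def)
  finally have eq: "a \<odot>\<^bsub>tensor A (F p) (F q)\<^esub> tensor_elem A (F p) (F q) x y
      = tensor_elem A (F p) (F q) (a \<odot>\<^bsub>F p\<^esub> x) y" .
  have "\<forall>a\<in>carrier A. \<forall>t\<in>carrier (tensor A (F p) (F q)).
      \<mu> p q (a \<odot>\<^bsub>tensor A (F p) (F q)\<^esub> t) = a \<odot>\<^bsub>F (p \<otimes> q)\<^esub> \<mu> p q t"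
    using mu_iso[OF assms(1,2)] unfolding bimodule_iso_def by blast
  from this[rule_format, OF assms(5) T.tensor_elem_closed[OF assms(3,4)]] show ?thesis
    unfolding eq dmul_def by (rule sym)
qed

lemma dmul_ract:
  assumes "p \<in> carrier P" "q \<in> carrier P" "x \<in> carrier (F p)" "y \<in> carrier (F q)" "a \<in> carrier A"
  shows "dmul p q x y \<triangleleft>\<^bsub>F (p \<otimes> q)\<^esub> a = dmul p q x (y \<triangleleft>\<^bsub>F q\<^esub> a)"
proof -
  interpret T: tensor_pair A "F p" "F q" using assms by (intro pair_F)
  have "tensor_elem A (F p) (F q) x y \<triangleleft>\<^bsub>tensor A (F p) (F q)\<^esub> a
      = tensor_map A (F p) (F q) (F p) (F q) (\<lambda>x. x) (\<lambda>y. y \<triangleleft>\<^bsub>F q\<^esub> a) (tensor_elem A (F p) (F q) x y)"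
    by (simp add: tensor_def Let_def)
  also have "\<dots> = tensor_elem A (F p) (F q) x (y \<triangleleft>\<^bsub>F q\<^esub> a)"
    using assms right_module_add_hom(1)[OF right_F] lact_ract_F
    by (intro T.tensor_map(2)[OF T.tensor_pair_axioms]) (auto simp: hom_def)
  finally have eq: "tensor_elem A (F p) (F q) x y \<triangleleft>\<^bsub>tensor A (F p) (F q)\<^esub> a
      = tensor_elem A (F p) (F q) x (y \<triangleleft>\<^bsub>F q\<^esub> a)" .
  have "\<forall>t\<in>carrier (tensor A (F p) (F q)). \<forall>a\<in>carrier A.
      \<mu> p q (t \<triangleleft>\<^bsub>tensor A (F p) (F q)\<^esub> a) = \<mu> p q t \<triangleleft>\<^bsub>F (p \<otimes> q)\<^esub> a"
    using mu_iso[OF assms(1,2)] unfolding bimodule_iso_def by blast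
  from this[rule_format, OF T.tensor_elem_closed[OF assms(3,4)] assms(5)] show ?thesis
    unfolding eq dmul_def by (rule sym)
qed

text \<open>\<mu> is onto, so that products span F_pq. Identities between additive maps on F_pq are
  from now on checked on products.\<close>

lemma F_induct [consumes 3, case_names dmul add]:
  assumes "p \<in> carrier P" "q \<in> carrier P" "z \<in> carrier (F (p \<otimes> q))"
    and "\<And>x y. x \<in> carrier (F p) \<Longrightarrow> y \<in> carrier (F q) \<Longrightarrow> Q (dmul p q x y)"
    and "\<And>k l. k \<in> carrier (F (p \<otimes> q)) \<Longrightarrow> l \<in> carrier (F (p \<otimes> q)) \<Longrightarrow> Q k \<Longrightarrow> Q l \<Longrightarrow> Q (k \<oplus>\<^bsub>F (p \<otimes> q)\<^esub> l)"
  shows "Q z"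
  using tensor_pair.tensor_iso_by_induct[OF pair_F dmul_iso, OF assms(1,2,1,2,3), of Q] assms(4,5) by blast

section \<open>Right module maps and their shifts\<close>

abbreviation "RH p1 p2 \<equiv> right_hom A (F p2) (F p1)"
abbreviation "H p1 p2 \<equiv> diagram_hom P F p1 p2"
abbreviation "sh \<equiv> shift P F \<mu>"
abbreviation "Hb p1 p2 \<equiv> hom_bimodule A (F p2) (F p1)"

lemma RH_dmul_eqI:
  assumes "p \<in> carrier P" "q \<in> carrier P" "S \<in> right_hom A (F (p \<otimes> q)) M" "T \<in> right_hom A (F (p \<otimes> q)) M"
    and "\<And>x y. x \<in> carrier (F p) \<Longrightarrow> y \<in> carrier (F q) \<Longrightarrow> S (dmul p q x y) = T (dmul p q x y)"
  shows "S = T"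
proof (rule right_hom_eqI[OF assms(3,4)])
  show "S z = T z" if "z \<in> carrier (F (p \<otimes> q))" for z
    using assms(1,2) that
    by (induction rule: F_induct) (simp_all add: assms(5) right_homD(5)[OF assms(3)] right_homD(5)[OF assms(4)])
qed

text \<open>The rule that x y is sent to T(x) y determines the shift, by \<open>F_induct\<close>;
  later arguments use this rule in place of the definition through \<mu> and its inverse.\<close>

lemma
  assumes "p1 \<in> carrier P" "p2 \<in> carrier P" "q \<in> carrier P" "T \<in> RH p1 p2"
  shows shift_dmul: "x \<in> carrier (F p2) \<Longrightarrow> y \<in> carrier (F q)
      \<Longrightarrow> sh p1 p2 q T (dmul p2 q x y) = dmul p1 q (T x) y"
    and shift_RH: "sh p1 p2 q T \<in> RH (p1 \<otimes> q) (p2 \<otimes> q)"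
proof -
  interpret T1: tensor_pair A "F p1" "F q" using assms by (intro pair_F)
  interpret T2: tensor_pair A "F p2" "F q" using assms by (intro pair_F)
  let ?i = "inv_into (carrier (tensor A (F p2) (F q))) (\<mu> p2 q)"
  let ?m = "tensor_map A (F p2) (F q) (F p1) (F q) T (\<lambda>y. y)"
  have mu2: "\<mu> p2 q \<in> iso (add_monoid (tensor A (F p2) (F q))) (add_monoid (F (p2 \<otimes> q)))"
    and mu1: "\<mu> p1 q \<in> add_hom (tensor A (F p1) (F q)) (F (p1 \<otimes> q))"
    using mu_iso assms by (auto simp: bimodule_iso_def iso_def)
  have "?i \<in> add_hom (F (p2 \<otimes> q)) (tensor A (F p2) (F q))"
    using group.iso_set_sym[OF abelian_group.a_group[OF T2.tensor_abelian] mu2] by (auto simp: iso_def)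
  moreover have m: "?m \<in> add_hom (tensor A (F p2) (F q)) (tensor A (F p1) (F q))"
    using right_homD[OF assms(4)] by (intro T2.tensor_map(1)[OF T1.tensor_pair_axioms]) (auto simp: hom_def)
  ultimately have hom: "(\<lambda>z. \<mu> p1 q (?m (?i z))) \<in> add_hom (F (p2 \<otimes> q)) (F (p1 \<otimes> q))"
    by (intro add_hom_compose[OF _ mu1] add_hom_compose[OF _ m])
  show dm: "sh p1 p2 q T (dmul p2 q x y) = dmul p1 q (T x) y" if "x \<in> carrier (F p2)" "y \<in> carrier (F q)" for x y
  proof -
    have "?i (dmul p2 q x y) = tensor_elem A (F p2) (F q) x y"
      using mu2 T2.tensor_elem_closed[OF that] by (auto simp: dmul_def iso_def bij_betw_def)
    moreover have "?m (tensor_elem A (F p2) (F q) x y) = tensor_elem A (F p1) (F q) (T x) y"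
      using right_homD[OF assms(4)] that
      by (intro T2.tensor_map(2)[OF T1.tensor_pair_axioms]) (auto simp: hom_def)
    ultimately show ?thesis
      using dmul_closed[OF assms(2,3) that] by (simp add: shift_def dmul_def)
  qed
  have sh: "sh p1 p2 q T z = \<mu> p1 q (?m (?i z))" if "z \<in> carrier (F (p2 \<otimes> q))" for z
    using that by (simp add: shift_def)
  interpret F2: abelian_group "F (p2 \<otimes> q)" using assms by (intro abelian_F) simp
  have sh_add: "sh p1 p2 q T (z \<oplus>\<^bsub>F (p2 \<otimes> q)\<^esub> w) = sh p1 p2 q T z \<oplus>\<^bsub>F (p1 \<otimes> q)\<^esub> sh p1 p2 q T w"
    if "z \<in> carrier (F (p2 \<otimes> q))" "w \<in> carrier (F (p2 \<otimes> q))" for z w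
    using that by (simp add: sh add_hom_add[OF hom])
  have sh_closed: "sh p1 p2 q T z \<in> carrier (F (p1 \<otimes> q))" if "z \<in> carrier (F (p2 \<otimes> q))" for z
    using that by (simp add: sh add_hom_closed[OF hom])
  show "sh p1 p2 q T \<in> RH (p1 \<otimes> q) (p2 \<otimes> q)"
  proof (rule right_homI)
    fix z b assume z: "z \<in> carrier (F (p2 \<otimes> q))" and b: "b \<in> carrier A"
    have pq: "p1 \<otimes> q \<in> carrier P" "p2 \<otimes> q \<in> carrier P" using assms by simp_all
    from assms(2,3) z show "sh p1 p2 q T (z \<triangleleft>\<^bsub>F (p2 \<otimes> q)\<^esub> b) = sh p1 p2 q T z \<triangleleft>\<^bsub>F (p1 \<otimes> q)\<^esub> b"
    proof (induction rule: F_induct)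
      case (dmul x y)
      then show ?case
        using assms b right_homD(3)[OF assms(4)] by (simp add: dmul_ract dm ract_F)
    next
      case (add k l)
      then show ?case
        using b right_module.ract_add_module[OF right_F[OF pq(1)]] right_module.ract_add_module[OF right_F[OF pq(2)]]
        by (simp add: sh_add sh_closed ract_F pq)
    qed
  qed (simp_all add: sh_closed sh_add, simp add: shift_def)
qed

text \<open>Both sides send x (y z) to (T(x) y) z by associativity of the product, and these
  elements span because the products y z span F_qr.\<close>

lemma RH_shift_shift:
  assumes "p1 \<in> carrier P" "p2 \<in> carrier P" "q \<in> carrier P" "r \<in> carrier P" "T \<in> RH p1 p2"
  shows "sh (p1 \<otimes> q) (p2 \<otimes> q) r (sh p1 p2 q T) = sh p1 p2 (q \<otimes> r) T"
proof -
  have c: "p1 \<otimes> q \<in> carrier P" "p2 \<otimes> q \<in> carrier P" "q \<otimes> r \<in> carrier P" using assms by simp_all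
  have T1: "sh p1 p2 q T \<in> RH (p1 \<otimes> q) (p2 \<otimes> q)" using assms by (intro shift_RH)
  have T2: "sh (p1 \<otimes> q) (p2 \<otimes> q) r (sh p1 p2 q T) \<in> RH (p1 \<otimes> (q \<otimes> r)) (p2 \<otimes> (q \<otimes> r))"
    using shift_RH[OF c(1,2) assms(4) T1] assms by (simp add: m_assoc)
  have T3: "sh p1 p2 (q \<otimes> r) T \<in> RH (p1 \<otimes> (q \<otimes> r)) (p2 \<otimes> (q \<otimes> r))"
    using assms c by (intro shift_RH)
  show ?thesis
  proof (rule RH_dmul_eqI[OF assms(2) c(3) T2 T3])
    fix x y assume x: "x \<in> carrier (F p2)" and "y \<in> carrier (F (q \<otimes> r))"
    from assms(3,4) this(2)
    show "sh (p1 \<otimes> q) (p2 \<otimes> q) r (sh p1 p2 q T) (dmul p2 (q \<otimes> r) x y) = sh p1 p2 (q \<otimes> r) T (dmul p2 (q \<otimes> r) x y)"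
    proof (induction rule: F_induct)
      case (dmul y z)
      have Tx: "T x \<in> carrier (F p1)" using right_homD(3)[OF assms(5) x] .
      have "sh p1 p2 (q \<otimes> r) T (dmul p2 (q \<otimes> r) x (dmul q r y z)) = dmul (p1 \<otimes> q) r (dmul p1 q (T x) y) z"
        using assms c x dmul Tx
        by (simp add: shift_dmul[OF assms(1,2) c(3) assms(5)] dmul_closed dmul_assoc)
      moreover have "sh (p1 \<otimes> q) (p2 \<otimes> q) r (sh p1 p2 q T) (dmul p2 (q \<otimes> r) x (dmul q r y z))
          = dmul (p1 \<otimes> q) r (dmul p1 q (T x) y) z"
        using assms c x dmul Tx
        by (simp add: dmul_assoc[symmetric] shift_dmul[OF c(1,2) assms(4) T1] shift_dmul[OF assms(1-3,5)] dmul_closed)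
      ultimately show ?case by simp
    next
      case (add k l)
      note h = dmul_hom_right[OF assms(2) c(3) x]
      show ?case
        using add by (simp add: add_hom_add[OF h] right_homD(5)[OF T2] right_homD(5)[OF T3] add_hom_closed[OF h])
    qed
  qed
qed

text \<open>Smoothness gives z = z e with e in F_1, and the shift by 1 sends the product z e to T(z)
  e = T(z e).\<close>

lemma RH_shift_one:
  assumes "p1 \<in> carrier P" "p2 \<in> carrier P" "T \<in> RH p1 p2"
  shows "sh p1 p2 \<one> T = T"
proof -
  have T: "sh p1 p2 \<one> T \<in> RH p1 (p2 \<otimes> \<one>)" using shift_RH[OF assms(1,2) one_closed assms(3)] assms by simp
  show ?thesis
  proof (rule right_hom_eqI[OF T[simplified r_one[OF assms(2)]] assms(3)])
    fix z assume z: "z \<in> carrier (F p2)"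
    obtain e where ec: "e \<in> carrier A" and e: "z \<triangleleft>\<^bsub>F p2\<^esub> e = z"
      using smooth_right_unit[OF base_ring right_F smooth_F(2), OF assms(2,2) z] by (rule A.for_largeE)
    have "sh p1 p2 \<one> T (dmul p2 \<one> z e) = dmul p1 \<one> (T z) e"
      by (rule shift_dmul[OF assms(1,2) one_closed assms(3) z ec])
    then show "sh p1 p2 \<one> T z = T z"
      using right_homD(3,4)[OF assms(3) z] e ec assms(1,2) z by (metis dmul_one_right)
  qed
qed

lemma RH_shift_compose:
  assumes "p1 \<in> carrier P" "p2 \<in> carrier P" "p3 \<in> carrier P" "q \<in> carrier P" "S \<in> RH p1 p2" "T \<in> RH p2 p3"
  shows "sh p1 p3 q (compose (carrier (F p3)) S T) = compose (carrier (F (p3 \<otimes> q))) (sh p1 p2 q S) (sh p2 p3 q T)"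
proof -
  have c: "compose (carrier (F p3)) S T \<in> RH p1 p3" by (rule right_hom_compose[OF assms(5,6) right_F[OF assms(3)]])
  have c': "compose (carrier (F (p3 \<otimes> q))) (sh p1 p2 q S) (sh p2 p3 q T) \<in> RH (p1 \<otimes> q) (p3 \<otimes> q)"
    using assms by (intro right_hom_compose[OF shift_RH shift_RH] right_F) simp_all
  show ?thesis
    using right_homD(3)[OF assms(6)] assms
    by (intro RH_dmul_eqI[OF assms(3,4) shift_RH[OF assms(1,3,4) c] c'])
      (simp add: shift_dmul[OF _ _ _ c] shift_dmul dmul_closed compose_eq)
qed

lemma abelian_Hb: "p1 \<in> carrier P \<Longrightarrow> p2 \<in> carrier P \<Longrightarrow> abelian_group (Hb p1 p2)"
  by (intro hom_bimodule_abelian right_F)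

lemma RH_shift_add:
  assumes "p1 \<in> carrier P" "p2 \<in> carrier P" "q \<in> carrier P" "S \<in> RH p1 p2" "T \<in> RH p1 p2"
  shows "sh p1 p2 q (S \<oplus>\<^bsub>Hb p1 p2\<^esub> T) = sh p1 p2 q S \<oplus>\<^bsub>Hb (p1 \<otimes> q) (p2 \<otimes> q)\<^esub> sh p1 p2 q T"
proof -
  have c: "S \<oplus>\<^bsub>Hb p1 p2\<^esub> T \<in> RH p1 p2"
    using abelian_groupE(1)[OF abelian_Hb[OF assms(1,2)], of S T] assms by simp
  have d: "sh p1 p2 q S \<oplus>\<^bsub>Hb (p1 \<otimes> q) (p2 \<otimes> q)\<^esub> sh p1 p2 q T \<in> RH (p1 \<otimes> q) (p2 \<otimes> q)"
    using abelian_groupE(1)[OF abelian_Hb[of "p1 \<otimes> q" "p2 \<otimes> q"], of "sh p1 p2 q S" "sh p1 p2 q T"] assms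
      shift_RH[OF assms(1-3)] by simp
  show ?thesis
  proof (rule RH_dmul_eqI[OF assms(2,3) shift_RH[OF assms(1-3) c] d])
    fix x y assume x: "x \<in> carrier (F p2)" "y \<in> carrier (F q)"
    show "sh p1 p2 q (S \<oplus>\<^bsub>Hb p1 p2\<^esub> T) (dmul p2 q x y)
        = (sh p1 p2 q S \<oplus>\<^bsub>Hb (p1 \<otimes> q) (p2 \<otimes> q)\<^esub> sh p1 p2 q T) (dmul p2 q x y)"
      unfolding shift_dmul[OF assms(1-3) c x]
      using x assms right_homD(3)[OF assms(4)] right_homD(3)[OF assms(5)]
      by (simp add: shift_dmul dmul_closed dmul_add_left)
  qed
qed

text \<open>A span is turned into a unit condition. A finite sum of maps f b is fixed by all large
  e, because each b has left units; conversely T = T e is itself one of the generators of the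
  span.\<close>

lemma mem_H:
  assumes "p1 \<in> carrier P" "p2 \<in> carrier P"
  shows "T \<in> H p1 p2 \<longleftrightarrow> T \<in> RH p1 p2 \<and> for_large A (\<lambda>e. \<forall>x\<in>carrier (F p2). T (e \<odot>\<^bsub>F p2\<^esub> x) = T x)"
    (is "_ \<longleftrightarrow> ?R T")
proof -
  interpret Hb: abelian_group "Hb p1 p2" using assms by (rule abelian_Hb)
  interpret F2: left_module A "F p2" using assms by (intro left_F)
  let ?G = "{f \<triangleleft>\<^bsub>Hb p1 p2\<^esub> b | f b. f \<in> RH p1 p2 \<and> b \<in> carrier A}"
  have H: "H p1 p2 = generate (add_monoid (Hb p1 p2)) ?G"
    by (simp add: diagram_hom_def)
  have gen: "?R f" if f: "f \<in> ?G" for f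
  proof -
    obtain g b where g: "g \<in> RH p1 p2" "b \<in> carrier A" "f = g \<triangleleft>\<^bsub>Hb p1 p2\<^esub> b" using f by blast
    have "f \<in> RH p1 p2"
      unfolding g(3) using g(1,2) assms right_homD[OF g(1)]
      by (intro right_homI) (auto simp: lact_F ract_F F2.lact_add_module lact_ract_F[symmetric])
    moreover have "for_large A (\<lambda>e. \<forall>x\<in>carrier (F p2). f (e \<odot>\<^bsub>F p2\<^esub> x) = f x)"
      using A.for_large_unit[OF g(2)]
      by (rule A.for_large_mono) (simp add: g F2.lact_mult[symmetric] F2.lact_closed)
    ultimately show ?thesis by blast
  qed
  have sub: "subgroup {f. ?R f} (add_monoid (Hb p1 p2))"
  proof (rule group.subgroupI[OF Hb.a_group])
    show "{f. ?R f} \<subseteq> carrier (add_monoid (Hb p1 p2))" by auto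
    have "\<zero>\<^bsub>Hb p1 p2\<^esub> \<in> RH p1 p2" using Hb.zero_closed by (simp only: hom_bimodule_simps)
    moreover have "for_large A (\<lambda>e. \<forall>x\<in>carrier (F p2). \<zero>\<^bsub>Hb p1 p2\<^esub> (e \<odot>\<^bsub>F p2\<^esub> x) = \<zero>\<^bsub>Hb p1 p2\<^esub> x)"
      using A.for_large_True by (rule A.for_large_mono) (simp add: F2.lact_closed)
    ultimately show "{f. ?R f} \<noteq> {}" by blast
  next
    fix f assume "f \<in> {f. ?R f}"
    then have f: "f \<in> RH p1 p2" and e: "for_large A (\<lambda>e. \<forall>x\<in>carrier (F p2). f (e \<odot>\<^bsub>F p2\<^esub> x) = f x)"
      by blast+
    have inv: "inv\<^bsub>add_monoid (Hb p1 p2)\<^esub> f = (\<lambda>x\<in>carrier (F p2). \<ominus>\<^bsub>F p1\<^esub> f x)"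
      using hom_bimodule_minus[OF right_F right_F f] assms by (simp add: a_inv_def)
    have "inv\<^bsub>add_monoid (Hb p1 p2)\<^esub> f \<in> RH p1 p2"
      using Hb.a_inv_closed[of f] f unfolding a_inv_def by (simp only: hom_bimodule_simps)
    moreover have "for_large A (\<lambda>e. \<forall>x\<in>carrier (F p2).
        (inv\<^bsub>add_monoid (Hb p1 p2)\<^esub> f) (e \<odot>\<^bsub>F p2\<^esub> x) = (inv\<^bsub>add_monoid (Hb p1 p2)\<^esub> f) x)"
      unfolding inv using e by (rule A.for_large_mono) (simp add: F2.lact_closed)
    ultimately show "inv\<^bsub>add_monoid (Hb p1 p2)\<^esub> f \<in> {f. ?R f}" by blast
  next
    fix f g assume "f \<in> {f. ?R f}" "g \<in> {f. ?R f}"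
    then have f: "f \<in> RH p1 p2" and e: "for_large A (\<lambda>e. \<forall>x\<in>carrier (F p2). f (e \<odot>\<^bsub>F p2\<^esub> x) = f x)"
      and g: "g \<in> RH p1 p2" and e': "for_large A (\<lambda>e. \<forall>x\<in>carrier (F p2). g (e \<odot>\<^bsub>F p2\<^esub> x) = g x)"
      by blast+
    have "for_large A (\<lambda>e. \<forall>x\<in>carrier (F p2). (f \<oplus>\<^bsub>Hb p1 p2\<^esub> g) (e \<odot>\<^bsub>F p2\<^esub> x) = (f \<oplus>\<^bsub>Hb p1 p2\<^esub> g) x)"
      using A.for_large_conj[OF e e'] by (rule A.for_large_mono) (simp add: F2.lact_closed)
    moreover have "f \<oplus>\<^bsub>Hb p1 p2\<^esub> g \<in> RH p1 p2"
      using Hb.a_closed[of f g] f g by (simp only: hom_bimodule_simps)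
    ultimately show "f \<otimes>\<^bsub>add_monoid (Hb p1 p2)\<^esub> g \<in> {f. ?R f}"
      by (simp only: monoid.simps) blast
  qed
  show ?thesis
  proof
    assume "T \<in> H p1 p2"
    moreover have "H p1 p2 \<subseteq> {f. ?R f}"
      unfolding H using gen by (intro group.generate_subgroup_incl[OF Hb.a_group _ sub]) blast
    ultimately show "?R T" by blast
  next
    assume "?R T"
    then have T: "T \<in> RH p1 p2" and "for_large A (\<lambda>e. \<forall>x\<in>carrier (F p2). T (e \<odot>\<^bsub>F p2\<^esub> x) = T x)" by blast+
    from this(2) obtain e where e: "e \<in> carrier A" "\<forall>x\<in>carrier (F p2). T (e \<odot>\<^bsub>F p2\<^esub> x) = T x"
      by (rule A.for_largeE)
    have "T = T \<triangleleft>\<^bsub>Hb p1 p2\<^esub> e"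
      using right_homD(2)[OF T] e(2) by (auto simp: fun_eq_iff extensional_def)
    then have "T \<in> ?G" using T e(1) by blast
    then show "T \<in> H p1 p2" unfolding H by (rule generate.incl)
  qed
qed

end

section \<open>Corners of a bimodule\<close>

lemma corner_simps [simp]:
  "add (corner e M) = add M" "zero (corner e M) = zero M" "ract (corner e M) = ract M"
  "smult (corner e M) = smult M"
  by (simp_all add: corner_def)

context bimodule
begin

lemma corner_carrier:
  assumes "e \<in> idempotents R"
  shows "carrier (corner e M) = {x \<in> carrier M. e \<odot>\<^bsub>M\<^esub> x = x}"
proof -
  have e: "e \<in> carrier R" "e \<otimes>\<^bsub>R\<^esub> e = e" using assms by (auto simp: idempotents_def)
  have "e \<odot>\<^bsub>M\<^esub> (e \<odot>\<^bsub>M\<^esub> x) = e \<odot>\<^bsub>M\<^esub> x" if "x \<in> carrier M" for x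
    using lact_mult[OF e(1,1) that] e(2) by simp
  then show ?thesis
    using lact_closed[OF e(1)] by (auto simp: corner_def image_iff intro: rev_bexI dest: sym)
qed

lemma corner_right_module:
  assumes "e \<in> idempotents R"
  shows "right_module S (corner e M)"
proof -
  have e: "e \<in> carrier R" using assms by (auto simp: idempotents_def)
  have lm: "left_module R M" by unfold_locales
  note hom = left_module_add_hom(1)[OF lm e]
  have ab: "abelian_group M" by (rule M.abelian_group_axioms)
  have neg: "\<exists>y. y \<in> carrier M \<and> e \<odot>\<^bsub>M\<^esub> y = y \<and> x \<oplus>\<^bsub>M\<^esub> y = \<zero>\<^bsub>M\<^esub>" if "x \<in> carrier M" "e \<odot>\<^bsub>M\<^esub> x = x" for x
    using add_hom_minus[OF ab ab hom that(1)] that by (intro exI[of _ "\<ominus>\<^bsub>M\<^esub> x"]) (simp add: M.r_neg)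
  have "abelian_group (corner e M)"
    by (rule abelian_groupI)
      (auto simp: corner_carrier[OF assms] lact_add_module e M.a_ac add_hom_zero[OF ab ab hom] neg)
  then show ?thesis
    by (intro right_module.intro right_module_axioms.intro S.nonunital_ring_axioms)
      (simp_all add: corner_carrier[OF assms] ract_closed ract_add_ring ract_add_module ract_mult lact_ract[symmetric] e)
qed

end

section \<open>The groups Hom(F_p2, F_p1) F_1, their local units and dual bases\<close>

context proper_ore_diagram
begin

lemma H_RH: "p1 \<in> carrier P \<Longrightarrow> p2 \<in> carrier P \<Longrightarrow> T \<in> H p1 p2 \<Longrightarrow> T \<in> RH p1 p2"
  by (simp add: mem_H)

lemma H_unit:
  "p1 \<in> carrier P \<Longrightarrow> p2 \<in> carrier P \<Longrightarrow> T \<in> H p1 p2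
    \<Longrightarrow> for_large A (\<lambda>e. \<forall>x\<in>carrier (F p2). T (e \<odot>\<^bsub>F p2\<^esub> x) = T x)"
  by (simp add: mem_H)

lemma HI:
  "p1 \<in> carrier P \<Longrightarrow> p2 \<in> carrier P \<Longrightarrow> T \<in> RH p1 p2
    \<Longrightarrow> for_large A (\<lambda>e. \<forall>x\<in>carrier (F p2). T (e \<odot>\<^bsub>F p2\<^esub> x) = T x) \<Longrightarrow> T \<in> H p1 p2"
  by (simp add: mem_H)

lemma H_closed: "p1 \<in> carrier P \<Longrightarrow> p2 \<in> carrier P \<Longrightarrow> T \<in> H p1 p2 \<Longrightarrow> x \<in> carrier (F p2) \<Longrightarrow> T x \<in> carrier (F p1)"
  by (rule right_homD(3)[OF H_RH])

lemma H_ract: "p1 \<in> carrier P \<Longrightarrow> p2 \<in> carrier P \<Longrightarrow> T \<in> H p1 p2 \<Longrightarrow> x \<in> carrier (F p2) \<Longrightarrow> b \<in> carrier A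
    \<Longrightarrow> T (x \<triangleleft>\<^bsub>F p2\<^esub> b) = T x \<triangleleft>\<^bsub>F p1\<^esub> b"
  by (rule right_homD(4)[OF H_RH])

lemma H_eqI:
  assumes "p1 \<in> carrier P" "p2 \<in> carrier P" "S \<in> H p1 p2" "T \<in> H p1 p2" "\<And>x. x \<in> carrier (F p2) \<Longrightarrow> S x = T x"
  shows "S = T"
  using right_hom_eqI[OF H_RH H_RH] assms by blast

lemma H_subgroup:
  assumes "p1 \<in> carrier P" "p2 \<in> carrier P"
  shows "subgroup (H p1 p2) (add_monoid (Hb p1 p2))"
proof -
  let ?G = "{f \<triangleleft>\<^bsub>Hb p1 p2\<^esub> b | f b. f \<in> carrier (Hb p1 p2) \<and> b \<in> carrier A}"
  have H: "H p1 p2 = generate (add_monoid (Hb p1 p2)) ?G" by (simp add: diagram_hom_def)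
  have "?G \<subseteq> H p1 p2" unfolding H by (auto intro: generate.incl)
  then have "?G \<subseteq> carrier (add_monoid (Hb p1 p2))" using H_RH[OF assms] by auto
  then show ?thesis
    unfolding H by (rule group.generate_is_subgroup[OF abelian_group.a_group[OF abelian_Hb[OF assms]]])
qed

lemma H_add: "p1 \<in> carrier P \<Longrightarrow> p2 \<in> carrier P \<Longrightarrow> S \<in> H p1 p2 \<Longrightarrow> T \<in> H p1 p2 \<Longrightarrow> S \<oplus>\<^bsub>Hb p1 p2\<^esub> T \<in> H p1 p2"
  using subgroup.m_closed[OF H_subgroup] by (simp only: monoid.simps)

lemma H_zero: "p1 \<in> carrier P \<Longrightarrow> p2 \<in> carrier P \<Longrightarrow> \<zero>\<^bsub>Hb p1 p2\<^esub> \<in> H p1 p2"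
  using subgroup.one_closed[OF H_subgroup] by (simp only: monoid.simps)

lemma H_minus: "p1 \<in> carrier P \<Longrightarrow> p2 \<in> carrier P \<Longrightarrow> S \<in> H p1 p2 \<Longrightarrow> \<ominus>\<^bsub>Hb p1 p2\<^esub> S \<in> H p1 p2"
  using subgroup.m_inv_closed[OF H_subgroup] unfolding a_inv_def .

text \<open>If T does not change under precomposition with the action of e, neither does its shift,
  because e (x y) = (e x) y.\<close>

lemma H_shift:
  assumes "p1 \<in> carrier P" "p2 \<in> carrier P" "q \<in> carrier P" "T \<in> H p1 p2"
  shows "sh p1 p2 q T \<in> H (p1 \<otimes> q) (p2 \<otimes> q)"
proof -
  note T = H_RH[OF assms(1,2,4)]
  note sT = shift_RH[OF assms(1-3) T]
  have pq: "p1 \<otimes> q \<in> carrier P" "p2 \<otimes> q \<in> carrier P" using assms by simp_all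
  have "\<forall>z\<in>carrier (F (p2 \<otimes> q)). sh p1 p2 q T (e \<odot>\<^bsub>F (p2 \<otimes> q)\<^esub> z) = sh p1 p2 q T z"
    if e: "e \<in> carrier A" "\<forall>x\<in>carrier (F p2). T (e \<odot>\<^bsub>F p2\<^esub> x) = T x" for e
  proof
    fix z assume "z \<in> carrier (F (p2 \<otimes> q))"
    with assms(2,3) show "sh p1 p2 q T (e \<odot>\<^bsub>F (p2 \<otimes> q)\<^esub> z) = sh p1 p2 q T z"
    proof (induction rule: F_induct)
      case (dmul x y)
      then show ?case
        using assms e by (simp add: dmul_lact shift_dmul[OF assms(1-3) T] lact_F)
    next
      case (add k l)
      then show ?case
        using e left_module.lact_add_module[OF left_F[OF pq(2)]]
        by (simp add: right_homD(5)[OF sT] lact_F pq)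
    qed
  qed
  with H_unit[OF assms(1,2,4)] show ?thesis using pq sT by (intro HI) (auto elim: A.for_large_mono)
qed

lemma H_compose:
  assumes "p1 \<in> carrier P" "p2 \<in> carrier P" "p3 \<in> carrier P" "S \<in> H p1 p2" "T \<in> H p2 p3"
  shows "compose (carrier (F p3)) S T \<in> H p1 p3"
proof (rule HI[OF assms(1,3)])
  show "compose (carrier (F p3)) S T \<in> RH p1 p3"
    using right_hom_compose[OF H_RH[OF assms(1,2,4)] H_RH[OF assms(2,3,5)] right_F[OF assms(3)]] .
  show "for_large A (\<lambda>e. \<forall>x\<in>carrier (F p3). compose (carrier (F p3)) S T (e \<odot>\<^bsub>F p3\<^esub> x) = compose (carrier (F p3)) S T x)"
    using H_unit[OF assms(2,3,5)] by (rule A.for_large_mono) (simp add: compose_eq lact_F assms)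
qed

lemmas shift_shift = RH_shift_shift[OF _ _ _ _ H_RH]
lemmas shift_one = RH_shift_one[OF _ _ H_RH]
lemmas shift_compose = RH_shift_compose[OF _ _ _ _ H_RH H_RH]
lemmas shift_add = RH_shift_add[OF _ _ _ H_RH H_RH]
lemmas H_shift_dmul = shift_dmul[OF _ _ _ H_RH]

lemma shift_zero:
  assumes "p1 \<in> carrier P" "p2 \<in> carrier P" "q \<in> carrier P"
  shows "sh p1 p2 q \<zero>\<^bsub>Hb p1 p2\<^esub> = \<zero>\<^bsub>Hb (p1 \<otimes> q) (p2 \<otimes> q)\<^esub>"
proof -
  interpret B: abelian_group "Hb p1 p2" using assms by (intro abelian_Hb)
  interpret C: abelian_group "Hb (p1 \<otimes> q) (p2 \<otimes> q)" using assms by (intro abelian_Hb) simp_all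
  have z: "sh p1 p2 q \<zero>\<^bsub>Hb p1 p2\<^esub> \<in> carrier (Hb (p1 \<otimes> q) (p2 \<otimes> q))"
    using H_RH[OF _ _ H_shift[OF assms H_zero]] assms by simp
  have "sh p1 p2 q \<zero>\<^bsub>Hb p1 p2\<^esub> \<oplus>\<^bsub>Hb (p1 \<otimes> q) (p2 \<otimes> q)\<^esub> sh p1 p2 q \<zero>\<^bsub>Hb p1 p2\<^esub> = sh p1 p2 q \<zero>\<^bsub>Hb p1 p2\<^esub>"
    using shift_add[OF assms assms(1,2) H_zero assms(1,2) H_zero] assms B.l_zero[OF B.zero_closed] by simp
  then show ?thesis
    using C.add.l_cancel_one'[OF z z] by (metis)
qed

lemma compose_add_left:
  assumes "p1 \<in> carrier P" "p2 \<in> carrier P" "p3 \<in> carrier P" "S \<in> H p1 p2" "S' \<in> H p1 p2" "T \<in> H p2 p3"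
  shows "compose (carrier (F p3)) (S \<oplus>\<^bsub>Hb p1 p2\<^esub> S') T
    = compose (carrier (F p3)) S T \<oplus>\<^bsub>Hb p1 p3\<^esub> compose (carrier (F p3)) S' T"
  using H_closed[OF assms(2,3,6)] by (auto simp: compose_def intro!: restrict_ext)

lemma compose_add_right:
  assumes "p1 \<in> carrier P" "p2 \<in> carrier P" "p3 \<in> carrier P" "S \<in> H p1 p2" "T \<in> H p2 p3" "T' \<in> H p2 p3"
  shows "compose (carrier (F p3)) S (T \<oplus>\<^bsub>Hb p2 p3\<^esub> T')
    = compose (carrier (F p3)) S T \<oplus>\<^bsub>Hb p1 p3\<^esub> compose (carrier (F p3)) S T'"
  using H_closed[OF assms(2,3,5)] H_closed[OF assms(2,3,6)] right_homD(5)[OF H_RH[OF assms(1,2,4)]]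
  by (auto simp: compose_def intro!: restrict_ext)

lemma compose_assoc_H:
  assumes "p3 \<in> carrier P" "p4 \<in> carrier P" "U \<in> H p3 p4"
  shows "compose (carrier (F p4)) (compose (carrier (F p3)) S T) U
    = compose (carrier (F p4)) S (compose (carrier (F p4)) T U)"
  using H_closed[OF assms] by (auto simp: compose_def intro!: restrict_ext)

definition lm :: "'p \<Rightarrow> 'a \<Rightarrow> 'a \<Rightarrow> 'a" where
  "lm p x = (\<lambda>z\<in>carrier A. x \<triangleleft>\<^bsub>F p\<^esub> z)"

text \<open>By smoothness x e = x for large e, whence x (e z) = x z; this is the unit condition of
  \<open>mem_H\<close>.\<close>

lemma lm_H:
  assumes "p \<in> carrier P" "x \<in> carrier (F p)"
  shows "lm p x \<in> H p \<one>"
proof -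
  interpret right_module A "F p" using assms by (intro right_F)
  show ?thesis
  proof (rule HI[OF assms(1) one_closed])
    show "lm p x \<in> RH p \<one>"
      using assms by (intro right_homI) (auto simp: lm_def base_ract A.m_closed ract_closed ract_add_ring ract_mult)
    show "for_large A (\<lambda>e. \<forall>z\<in>carrier A. lm p x (e \<odot>\<^bsub>A\<^esub> z) = lm p x z)"
      using smooth_right_unit[OF base_ring right_F smooth_F(2), OF assms(1,1,2)] assms(2)
      by (elim A.for_large_mono) (simp add: lm_def base_lact A.m_closed ract_mult)
  qed
qed

lemma lm_add:
  assumes "p \<in> carrier P" "x \<in> carrier (F p)" "y \<in> carrier (F p)"
  shows "lm p (x \<oplus>\<^bsub>F p\<^esub> y) = lm p x \<oplus>\<^bsub>Hb p \<one>\<^esub> lm p y"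
  using right_module.ract_add_module[OF right_F[OF assms(1)]] assms by (auto simp: lm_def intro!: restrict_ext)

text \<open>Right linearity, T(x z) = T(x) z. The rule \<open>single_canonical\<close> in the ring
  goes back to this.\<close>

lemma compose_lm:
  assumes "p1 \<in> carrier P" "p2 \<in> carrier P" "T \<in> H p1 p2" "x \<in> carrier (F p2)"
  shows "compose (carrier A) T (lm p2 x) = lm p1 (T x)"
  using H_ract[OF assms] by (auto simp: compose_def lm_def intro!: restrict_ext)

text \<open>Write y = e y with e in F_1. The shift sends the product of e and y to (x e) y = x (e
  y).\<close>

lemma shift_lm:
  assumes "p \<in> carrier P" "q \<in> carrier P" "x \<in> carrier (F p)"
  shows "sh p \<one> q (lm p x) = (\<lambda>y\<in>carrier (F q). dmul p q x y)"
proof -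
  have L: "lm p x \<in> RH p \<one>" using lm_H H_RH assms one_closed by blast
  have S: "sh p \<one> q (lm p x) \<in> RH (p \<otimes> q) q"
    using shift_RH[OF assms(1) one_closed assms(2) L] assms by simp
  show ?thesis
  proof (rule extensionalityI[OF right_homD(2)[OF S] restrict_extensional])
    fix y assume y: "y \<in> carrier (F q)"
    obtain e where ec: "e \<in> carrier A" and e: "e \<odot>\<^bsub>F q\<^esub> y = y"
      using smooth_left_unit[OF base_ring left_F smooth_F(1), OF assms(2,2) y] by (rule A.for_largeE)
    have "sh p \<one> q (lm p x) y = sh p \<one> q (lm p x) (dmul \<one> q e y)"
      using assms ec y e by (simp add: dmul_one_left)
    also have "\<dots> = dmul p q (x \<triangleleft>\<^bsub>F p\<^esub> e) y"
      using shift_dmul[OF assms(1) one_closed assms(2) L ec y] ec by (simp add: lm_def)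
    also have "\<dots> = dmul p q x y"
      using dmul_mid[OF assms ec y] e by simp
    finally show "sh p \<one> q (lm p x) y = (\<lambda>y\<in>carrier (F q). dmul p q x y) y" using y by simp
  qed
qed

text \<open>T is determined on a corner e F_p2, because T(x) = T(e x). If u fixes the values of T at
  finitely many generators of the corner, then the elements of the corner at which u fixes T form a
  submodule containing the generators, hence the whole corner.\<close>

lemma H_left_unit:
  assumes "p1 \<in> carrier P" "p2 \<in> carrier P" "T \<in> H p1 p2"
  shows "for_large A (\<lambda>u. \<forall>x\<in>carrier (F p2). u \<odot>\<^bsub>F p1\<^esub> T x = T x)"
proof -
  interpret B1: bimodule A A "F p1" using assms by (intro bimodule_F)
  interpret B2: bimodule A A "F p2" using assms by (intro bimodule_F)
  note T = H_RH[OF assms]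
  obtain e where e: "e \<in> idempotents A" "e \<in> carrier A" "\<forall>x\<in>carrier (F p2). T (e \<odot>\<^bsub>F p2\<^esub> x) = T x"
    using H_unit[OF assms] by (rule A.for_largeE)
  interpret C: right_module A "corner e (F p2)" by (rule B2.corner_right_module[OF e(1)])
  have "fin_gen_right A (corner e (F p2))"
    using proper[OF assms(2)] e(1) by (rule proper_bimodule.corner_fin_gen)
  from this[unfolded fin_gen_right_def] obtain X where X: "finite X \<and> X \<subseteq> carrier (corner e (F p2)) \<and>
      (\<forall>N. additive_subgroup N (corner e (F p2)) \<and> X \<subseteq> N \<and> (\<forall>x\<in>N. \<forall>b\<in>carrier A. x \<triangleleft>\<^bsub>corner e (F p2)\<^esub> b \<in> N)
        \<longrightarrow> N = carrier (corner e (F p2)))" by (rule exE)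
  have Xc: "X \<subseteq> carrier (F p2)" using X by (auto simp: B2.corner_carrier[OF e(1)])
  have "for_large A (\<lambda>u. \<forall>x\<in>X. u \<odot>\<^bsub>F p1\<^esub> T x = T x)"
    using X smooth_left_unit[OF base_ring left_F smooth_F(1) H_closed[OF assms subsetD[OF Xc]], OF assms(1,1)]
    by (intro A.for_large_finite) auto
  then show ?thesis
  proof (rule A.for_large_mono)
    fix u assume uc: "u \<in> carrier A" and u: "\<forall>x\<in>X. u \<odot>\<^bsub>F p1\<^esub> T x = T x"
    define N where "N = {x \<in> carrier (corner e (F p2)). u \<odot>\<^bsub>F p1\<^esub> T x = T x}"
    have Nc: "x \<in> carrier (F p2)" if "x \<in> carrier (corner e (F p2))" for x
      using that by (simp add: B2.corner_carrier[OF e(1)])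
    have incl: "(\<lambda>x. x) \<in> add_hom (corner e (F p2)) (F p2)"
      using Nc by (intro add_homI) simp_all
    have Th: "T \<in> add_hom (corner e (F p2)) (F p1)"
      using add_hom_compose[OF incl right_homD(1)[OF T]] .
    have uTh: "(\<lambda>x. u \<odot>\<^bsub>F p1\<^esub> T x) \<in> add_hom (corner e (F p2)) (F p1)"
      by (rule add_hom_compose[OF Th left_module_add_hom(1)[OF left_F[OF assms(1)] uc]])
    have "additive_subgroup N (corner e (F p2))"
      unfolding additive_subgroup_def
    proof (rule group.subgroupI[OF C.M.a_group])
      show "N \<subseteq> carrier (add_monoid (corner e (F p2)))" by (auto simp: N_def)
      have "\<zero>\<^bsub>corner e (F p2)\<^esub> \<in> N"
        using add_hom_zero[OF C.M.abelian_group_axioms B1.M.abelian_group_axioms Th]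
          add_hom_zero[OF C.M.abelian_group_axioms B1.M.abelian_group_axioms uTh] C.M.zero_closed
        by (simp add: N_def)
      then show "N \<noteq> {}" by blast
    next
      fix x assume "x \<in> N"
      then show "inv\<^bsub>add_monoid (corner e (F p2))\<^esub> x \<in> N"
        unfolding a_inv_def[symmetric]
        using add_hom_minus[OF C.M.abelian_group_axioms B1.M.abelian_group_axioms Th]
          add_hom_minus[OF C.M.abelian_group_axioms B1.M.abelian_group_axioms uTh] C.M.a_inv_closed
        by (simp add: N_def)
    next
      fix x y assume "x \<in> N" "y \<in> N"
      then show "x \<otimes>\<^bsub>add_monoid (corner e (F p2))\<^esub> y \<in> N"
        using add_hom_add[OF Th, of x y] add_hom_add[OF uTh, of x y] C.M.a_closed[of x y]
        by (simp add: N_def)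
    qed
    moreover have "X \<subseteq> N" using X u by (auto simp: N_def)
    moreover have "\<forall>x\<in>N. \<forall>b\<in>carrier A. x \<triangleleft>\<^bsub>corner e (F p2)\<^esub> b \<in> N"
    proof (intro ballI)
      fix x b assume "x \<in> N" and b: "b \<in> carrier A"
      then have x: "x \<in> carrier (corner e (F p2))" "u \<odot>\<^bsub>F p1\<^esub> T x = T x" by (auto simp: N_def)
      have "u \<odot>\<^bsub>F p1\<^esub> T (x \<triangleleft>\<^bsub>F p2\<^esub> b) = T (x \<triangleleft>\<^bsub>F p2\<^esub> b)"
        using H_ract[OF assms Nc[OF x(1)] b] B1.lact_ract[OF uc H_closed[OF assms Nc[OF x(1)]] b] x(2) by simp
      then show "x \<triangleleft>\<^bsub>corner e (F p2)\<^esub> b \<in> N"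
        using C.ract_closed[OF b x(1)] by (simp add: N_def)
    qed
    ultimately have N: "N = carrier (corner e (F p2))"
      using X[THEN conjunct2, THEN conjunct2, rule_format, of N] by simp
    have "u \<odot>\<^bsub>F p1\<^esub> T x = T x" if x: "x \<in> carrier (F p2)" for x
    proof -
      have "e \<odot>\<^bsub>F p2\<^esub> x \<in> carrier (corner e (F p2))" using x by (auto simp: corner_def)
      then have "e \<odot>\<^bsub>F p2\<^esub> x \<in> N" by (simp only: N)
      then show ?thesis using bspec[OF e(3) x] by (simp add: N_def)
    qed
    then show "\<forall>x\<in>carrier (F p2). u \<odot>\<^bsub>F p1\<^esub> T x = T x" by blast
  qed
qed

text \<open>The functionals \<psi> x of a dual basis of e F_p are extended to F_p by \<phi> x(y) =
  \<psi> x(e y). They belong to Hom(F_p, F_1) F_1 because e d = e for large d, and the expansion of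
  e y now makes sense for all y in F_p.\<close>

lemma corner_dual_basis:
  assumes p: "p \<in> carrier P" and e: "e \<in> idempotents A"
  shows "\<exists>X \<phi>. finite X \<and> X \<subseteq> carrier (F p) \<and> (\<forall>x\<in>X. \<phi> x \<in> H \<one> p) \<and>
    (\<forall>y\<in>carrier (F p). finsum (F p) (\<lambda>x. x \<triangleleft>\<^bsub>F p\<^esub> \<phi> x y) X = e \<odot>\<^bsub>F p\<^esub> y)"
proof -
  interpret B: bimodule A A "F p" using p by (rule bimodule_F)
  interpret C: right_module A "corner e (F p)" by (rule B.corner_right_module[OF e])
  have ec: "e \<in> carrier A" "e \<otimes>\<^bsub>A\<^esub> e = e" using e by (simp_all add: idempotentsD)
  have cc: "carrier (corner e (F p)) = {x \<in> carrier (F p). e \<odot>\<^bsub>F p\<^esub> x = x}" by (rule B.corner_carrier[OF e])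
  have "smooth_right A (corner e (F p))"
  proof (rule smooth_rightI[OF base_ring C.right_module_axioms])
    fix x assume "x \<in> carrier (corner e (F p))"
    then have "x \<in> carrier (F p)" by (simp add: cc)
    from smooth_right_unit[OF base_ring right_F smooth_F(2), OF p p this]
    show "\<exists>d\<in>idempotents A. x \<triangleleft>\<^bsub>corner e (F p)\<^esub> d = x" by (rule A.for_largeE) auto
  qed
  from dual_basis[OF base_ring C.right_module_axioms this proper_bimodule.corner_fin_gen[OF proper[OF p] e]
      proper_bimodule.corner_projective[OF proper[OF p] e]]
  obtain X \<psi> where X: "finite X" "X \<subseteq> carrier (corner e (F p))"
    and \<psi>: "\<forall>x\<in>X. \<psi> x \<in> right_hom A (corner e (F p)) (regular_bimodule A)"
    and sum: "\<forall>y\<in>carrier (corner e (F p)). finsum (corner e (F p)) (\<lambda>x. x \<triangleleft>\<^bsub>corner e (F p)\<^esub> \<psi> x y) X = y"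
    by (elim exE conjE)
  have ey: "e \<odot>\<^bsub>F p\<^esub> y \<in> carrier (corner e (F p))" if "y \<in> carrier (F p)" for y
    using that by (auto simp: corner_def)
  have Xc: "X \<subseteq> carrier (F p)" using X(2) cc by auto
  define \<phi> where "\<phi> x = (\<lambda>y\<in>carrier (F p). \<psi> x (e \<odot>\<^bsub>F p\<^esub> y))" for x
  have "\<phi> x \<in> H \<one> p" if x: "x \<in> X" for x
  proof (rule HI[OF one_closed p])
    have px: "\<psi> x \<in> right_hom A (corner e (F p)) (regular_bimodule A)" using \<psi> x by blast
    note pd = right_homD[OF px]
    show "\<phi> x \<in> RH \<one> p"
    proof (rule right_homI)
      fix y z assume y: "y \<in> carrier (F p)" "z \<in> carrier (F p)"
      have "\<psi> x (e \<odot>\<^bsub>F p\<^esub> y \<oplus>\<^bsub>F p\<^esub> e \<odot>\<^bsub>F p\<^esub> z) = \<psi> x (e \<odot>\<^bsub>F p\<^esub> y) \<oplus>\<^bsub>A\<^esub> \<psi> x (e \<odot>\<^bsub>F p\<^esub> z)"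
        using pd(5)[OF ey[OF y(1)] ey[OF y(2)]] by simp
      then show "\<phi> x (y \<oplus>\<^bsub>F p\<^esub> z) = \<phi> x y \<oplus>\<^bsub>A\<^esub> \<phi> x z"
        using y by (simp add: \<phi>_def B.lact_add_module ec)
    next
      fix y b assume y: "y \<in> carrier (F p)" "b \<in> carrier A"
      have "\<psi> x ((e \<odot>\<^bsub>F p\<^esub> y) \<triangleleft>\<^bsub>F p\<^esub> b) = \<psi> x (e \<odot>\<^bsub>F p\<^esub> y) \<otimes>\<^bsub>A\<^esub> b"
        using pd(4)[OF ey[OF y(1)] y(2)] by simp
      then show "\<phi> x (y \<triangleleft>\<^bsub>F p\<^esub> b) = \<phi> x y \<triangleleft>\<^bsub>A\<^esub> b"
        using y pd(3)[OF ey[OF y(1)]] by (simp add: \<phi>_def B.lact_ract ec base_ract B.ract_closed)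
    next
      fix y assume "y \<in> carrier (F p)"
      then show "\<phi> x y \<in> carrier A" using pd(3)[OF ey] by (simp add: \<phi>_def)
    qed (simp add: \<phi>_def)
    show "for_large A (\<lambda>d. \<forall>y\<in>carrier (F p). \<phi> x (d \<odot>\<^bsub>F p\<^esub> y) = \<phi> x y)"
      using A.for_large_unit[OF ec(1)]
      by (rule A.for_large_mono) (simp add: \<phi>_def B.lact_closed B.lact_mult[symmetric] ec)
  qed
  moreover have "finsum (F p) (\<lambda>x. x \<triangleleft>\<^bsub>F p\<^esub> \<phi> x y) X = e \<odot>\<^bsub>F p\<^esub> y" if y: "y \<in> carrier (F p)" for y
  proof -
    have incl: "(\<lambda>x. x) \<in> add_hom (corner e (F p)) (F p)"
      by (intro add_homI) (simp_all add: cc)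
    have mem: "(\<lambda>x. x \<triangleleft>\<^bsub>corner e (F p)\<^esub> \<psi> x (e \<odot>\<^bsub>F p\<^esub> y)) \<in> X \<rightarrow> carrier (corner e (F p))"
    proof
      fix x assume "x \<in> X"
      then have "\<psi> x (e \<odot>\<^bsub>F p\<^esub> y) \<in> carrier A" using right_homD(3)[OF _ ey[OF y]] \<psi> by force
      then show "x \<triangleleft>\<^bsub>corner e (F p)\<^esub> \<psi> x (e \<odot>\<^bsub>F p\<^esub> y) \<in> carrier (corner e (F p))"
        using X(2) \<open>x \<in> X\<close> by (intro C.ract_closed) auto
    qed
    have "e \<odot>\<^bsub>F p\<^esub> y = finsum (corner e (F p)) (\<lambda>x. x \<triangleleft>\<^bsub>corner e (F p)\<^esub> \<psi> x (e \<odot>\<^bsub>F p\<^esub> y)) X"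
      using sum[rule_format, OF ey[OF y]] by (rule sym)
    also have "\<dots> = finsum (F p) (\<lambda>x. x \<triangleleft>\<^bsub>corner e (F p)\<^esub> \<psi> x (e \<odot>\<^bsub>F p\<^esub> y)) X"
      using add_hom_finsum[OF C.M.abelian_group_axioms B.M.abelian_group_axioms incl mem] by simp
    also have "\<dots> = finsum (F p) (\<lambda>x. x \<triangleleft>\<^bsub>F p\<^esub> \<phi> x y) X"
      by (simp add: \<phi>_def y)
    finally show ?thesis by (rule sym)
  qed
  ultimately show ?thesis
    using X(1) Xc by (intro exI[of _ X] exI[of _ \<phi>]) simp
qed

end

section \<open>Fractions and inductive limits\<close>

lemma bex2I: "a \<in> A \<Longrightarrow> b \<in> B \<Longrightarrow> Q a b \<Longrightarrow> \<exists>x\<in>A. \<exists>y\<in>B. Q x y"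
  by blast

section \<open>Fractions over an Ore monoid\<close>

context ore_monoid
begin

lemma mult_eq_ext:
  assumes "a \<otimes> b = c \<otimes> d" "a \<in> carrier P" "b \<in> carrier P" "c \<in> carrier P" "d \<in> carrier P" "e \<in> carrier P"
  shows "a \<otimes> (b \<otimes> e) = c \<otimes> (d \<otimes> e)"
  using assms by (metis m_assoc)

text \<open>Two ways of matching p with p' become equal after further multiplication. (O1) gives u a
  = s b, hence p' u' a = p' s' b, and (O2) removes p' at the price of one more factor c. This takes
  the place of cancellation below.\<close>

lemma ore_common_refine:
  assumes "p \<in> carrier P" "p' \<in> carrier P" "s \<in> carrier P" "s' \<in> carrier P" "u \<in> carrier P" "u' \<in> carrier P"
    and "p \<otimes> s = p' \<otimes> s'" "p \<otimes> u = p' \<otimes> u'"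
  shows "\<exists>v\<in>carrier P. \<exists>b\<in>carrier P. u \<otimes> v = s \<otimes> b \<and> u' \<otimes> v = s' \<otimes> b"
proof -
  obtain a b where ab: "a \<in> carrier P" "b \<in> carrier P" "u \<otimes> a = s \<otimes> b"
    using ore_common[OF assms(5,3)] by blast
  have "p' \<otimes> (u' \<otimes> a) = p \<otimes> (u \<otimes> a)"
    using mult_eq_ext[OF assms(8) assms(1,5,2,6) ab(1)] by (rule sym)
  also have "\<dots> = p' \<otimes> (s' \<otimes> b)"
    unfolding ab(3) using mult_eq_ext[OF assms(7) assms(1,3,2,4) ab(2)] .
  finally obtain c where c: "c \<in> carrier P" "u' \<otimes> a \<otimes> c = s' \<otimes> b \<otimes> c"
    using ore_cancel[of p' "u' \<otimes> a" "s' \<otimes> b"] assms(1-6) ab(1,2) by blast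
  have "u \<otimes> (a \<otimes> c) = s \<otimes> (b \<otimes> c)" by (rule mult_eq_ext[OF ab(3) assms(5) ab(1) assms(3) ab(2) c(1)])
  moreover have "u' \<otimes> (a \<otimes> c) = s' \<otimes> (b \<otimes> c)" using c(2) m_assoc assms(4,6) ab(1,2) c(1) by simp
  ultimately show ?thesis
    using ab(1,2) c(1) by (intro bex2I[of "a \<otimes> c" _ "b \<otimes> c"]) simp_all
qed

abbreviation "fr \<equiv> ore_frac P"

lemma equiv_ore_rel: "equiv (carrier P \<times> carrier P) (ore_rel P)"
proof (rule equivI)
  show "ore_rel P \<subseteq> (carrier P \<times> carrier P) \<times> (carrier P \<times> carrier P)" by (auto simp: ore_rel_def)
  show "refl_on (carrier P \<times> carrier P) (ore_rel P)" by (auto simp: refl_on_def ore_rel_def)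
  show "sym (ore_rel P)" by (auto simp: sym_def ore_rel_def) (metis)
  show "trans (ore_rel P)"
  proof (rule transI, clarify)
    fix p1 p2 q1 q2 r1 r2 assume "((p1, p2), (q1, q2)) \<in> ore_rel P" "((q1, q2), (r1, r2)) \<in> ore_rel P"
    then obtain t1 t2 s1 s2 where c: "p1 \<in> carrier P" "p2 \<in> carrier P" "q1 \<in> carrier P" "q2 \<in> carrier P"
      "r1 \<in> carrier P" "r2 \<in> carrier P" "t1 \<in> carrier P" "t2 \<in> carrier P" "s1 \<in> carrier P" "s2 \<in> carrier P"
      and e: "p1 \<otimes> t1 = q1 \<otimes> t2" "p2 \<otimes> t1 = q2 \<otimes> t2" "q1 \<otimes> s1 = r1 \<otimes> s2" "q2 \<otimes> s1 = r2 \<otimes> s2"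
      by (auto simp: ore_rel_def)
    obtain a b where ab: "a \<in> carrier P" "b \<in> carrier P" "t2 \<otimes> a = s1 \<otimes> b"
      using ore_common[of t2 s1] c by blast
    have "p1 \<otimes> (t1 \<otimes> a) = r1 \<otimes> (s2 \<otimes> b)" "p2 \<otimes> (t1 \<otimes> a) = r2 \<otimes> (s2 \<otimes> b)"
      using mult_eq_ext[OF e(1), of a] mult_eq_ext[OF e(2), of a] mult_eq_ext[OF e(3), of b] mult_eq_ext[OF e(4), of b] c ab
      by simp_all
    then have "\<exists>t\<in>carrier P. \<exists>s\<in>carrier P. p1 \<otimes> t = r1 \<otimes> s \<and> p2 \<otimes> t = r2 \<otimes> s"
      using c ab(1,2) by (intro bex2I[of "t1 \<otimes> a" _ "s2 \<otimes> b"]) simp_all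
    then show "((p1, p2), (r1, r2)) \<in> ore_rel P"
      using c by (simp add: ore_rel_def)
  qed
qed

lemma fr_eq_iff:
  assumes "p1 \<in> carrier P" "p2 \<in> carrier P" "q1 \<in> carrier P" "q2 \<in> carrier P"
  shows "fr p1 p2 = fr q1 q2 \<longleftrightarrow>
    (\<exists>t\<in>carrier P. \<exists>s\<in>carrier P. p1 \<otimes> t = q1 \<otimes> s \<and> p2 \<otimes> t = q2 \<otimes> s)"
  using eq_equiv_class_iff[OF equiv_ore_rel, of "(p1, p2)" "(q1, q2)"] assms
  by (simp add: ore_frac_def ore_rel_def)

lemma fr_mem: "(q1, q2) \<in> fr p1 p2 \<Longrightarrow> q1 \<in> carrier P \<and> q2 \<in> carrier P \<and> fr q1 q2 = fr p1 p2"
  using equiv_class_eq[OF equiv_ore_rel, of "(p1, p2)" "(q1, q2)"]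
  by (auto simp: ore_frac_def ore_rel_def)

lemma fr_self: "p1 \<in> carrier P \<Longrightarrow> p2 \<in> carrier P \<Longrightarrow> (p1, p2) \<in> fr p1 p2"
  using equiv_class_self[OF equiv_ore_rel, of "(p1, p2)"] by (simp add: ore_frac_def)

lemma fr_shift: "p1 \<in> carrier P \<Longrightarrow> p2 \<in> carrier P \<Longrightarrow> t \<in> carrier P \<Longrightarrow> fr (p1 \<otimes> t) (p2 \<otimes> t) = fr p1 p2"
  by (subst fr_eq_iff) (simp_all, rule bex2I[of \<one> _ t], simp_all)

abbreviation "G \<equiv> ore_group P"

lemma G_carrier: "carrier G = {fr p1 p2 | p1 p2. p1 \<in> carrier P \<and> p2 \<in> carrier P}"
  by (auto simp: ore_group_def quotient_def ore_frac_def)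

lemma fr_closed: "p1 \<in> carrier P \<Longrightarrow> p2 \<in> carrier P \<Longrightarrow> fr p1 p2 \<in> carrier G"
  by (auto simp: G_carrier)

text \<open>Equal fractions have witnesses t, s that match both coordinates. A prescribed match u,
  u' of one coordinate becomes a multiple of these by \<open>ore_common_refine\<close>, and
  therefore matches both coordinates as well.\<close>

lemma fr_refine:
  assumes "p1 \<in> carrier P" "p2 \<in> carrier P" "q1 \<in> carrier P" "q2 \<in> carrier P" "u \<in> carrier P" "u' \<in> carrier P"
    and "fr p1 p2 = fr q1 q2" "p1 \<otimes> u = q1 \<otimes> u' \<or> p2 \<otimes> u = q2 \<otimes> u'"
  shows "\<exists>v\<in>carrier P. p1 \<otimes> (u \<otimes> v) = q1 \<otimes> (u' \<otimes> v) \<and> p2 \<otimes> (u \<otimes> v) = q2 \<otimes> (u' \<otimes> v)"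
proof -
  obtain t s where ts: "t \<in> carrier P" "s \<in> carrier P" "p1 \<otimes> t = q1 \<otimes> s" "p2 \<otimes> t = q2 \<otimes> s"
    using assms(7) unfolding fr_eq_iff[OF assms(1-4)] by blast
  obtain v b where vb: "v \<in> carrier P" "b \<in> carrier P" "u \<otimes> v = t \<otimes> b" "u' \<otimes> v = s \<otimes> b"
    using assms(8) ore_common_refine[OF assms(1,3) ts(1,2) assms(5,6) ts(3)]
      ore_common_refine[OF assms(2,4) ts(1,2) assms(5,6) ts(4)] by blast
  show ?thesis
    using mult_eq_ext[OF ts(3) assms(1) ts(1) assms(3) ts(2) vb(2)] mult_eq_ext[OF ts(4) assms(2) ts(1) assms(4) ts(2) vb(2)]
      vb(1) unfolding vb(3,4)[symmetric] by blast
qed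

text \<open>With a shared middle entry, products are read off without common multiples. The proof
  contains the well-definedness of the multiplication: an arbitrary admissible choice is compared
  with p1, p2, p3 by matching p2 with (O1), then p1, then p3 with \<open>fr_refine\<close>.\<close>

lemma fr_mult:
  assumes "p1 \<in> carrier P" "p2 \<in> carrier P" "p3 \<in> carrier P"
  shows "fr p1 p2 \<otimes>\<^bsub>G\<^esub> fr p2 p3 = fr p1 p3"
proof -
  let ?S = "{fr (p1' \<otimes> t1) (q2 \<otimes> t2) | p1' p2' q1 q2 t1 t2.
         (p1', p2') \<in> fr p1 p2 \<and> (q1, q2) \<in> fr p2 p3 \<and> t1 \<in> carrier P \<and> t2 \<in> carrier P \<and>
         p2' \<otimes> t1 = q1 \<otimes> t2}"
  have "fr (p1' \<otimes> t1) (q2 \<otimes> t2) = fr p1 p3"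
    if m: "(p1', p2') \<in> fr p1 p2" "(q1, q2) \<in> fr p2 p3" and t: "t1 \<in> carrier P" "t2 \<in> carrier P"
      and e: "p2' \<otimes> t1 = q1 \<otimes> t2" for p1' p2' q1 q2 t1 t2
  proof -
    have c: "p1' \<in> carrier P" "p2' \<in> carrier P" "q1 \<in> carrier P" "q2 \<in> carrier P"
      and f: "fr p1 p2 = fr p1' p2'" "fr p2 p3 = fr q1 q2"
      using fr_mem[OF m(1)] fr_mem[OF m(2)] by auto
    obtain w w' where w: "w \<in> carrier P" "w' \<in> carrier P" "p2 \<otimes> w = (p2' \<otimes> t1) \<otimes> w'"
      using ore_common[of p2 "p2' \<otimes> t1"] assms c t by blast
    have w3: "p2 \<otimes> w = p2' \<otimes> (t1 \<otimes> w')" unfolding w(3) by (rule m_assoc[OF c(2) t(1) w(2)])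
    obtain v where v: "v \<in> carrier P" "p1 \<otimes> (w \<otimes> v) = p1' \<otimes> (t1 \<otimes> w' \<otimes> v)"
      using fr_refine[OF assms(1,2) c(1,2) w(1) m_closed[OF t(1) w(2)] f(1)] w3 by blast
    have "p2 \<otimes> (w \<otimes> v) = (p2' \<otimes> t1) \<otimes> (w' \<otimes> v)"
      by (rule mult_eq_ext[OF w(3) assms(2) w(1) m_closed[OF c(2) t(1)] w(2) v(1)])
    then have 2: "p2 \<otimes> (w \<otimes> v) = q1 \<otimes> (t2 \<otimes> w' \<otimes> v)"
      unfolding e using c t w(1,2) v(1) by (simp add: m_assoc)
    obtain v2 where v2: "v2 \<in> carrier P" "p3 \<otimes> (w \<otimes> v \<otimes> v2) = q2 \<otimes> (t2 \<otimes> w' \<otimes> v \<otimes> v2)"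
      using fr_refine[of p2 p3 q1 q2 "w \<otimes> v" "t2 \<otimes> w' \<otimes> v"] 2 assms c t w v f by auto
    have 1: "p1 \<otimes> (w \<otimes> v \<otimes> v2) = p1' \<otimes> (t1 \<otimes> w' \<otimes> v \<otimes> v2)"
      using mult_eq_ext[OF v(2), of v2] assms c t w v v2(1) by (simp add: m_assoc)
    have P: "w' \<otimes> v \<otimes> v2 \<in> carrier P" "w \<otimes> v \<otimes> v2 \<in> carrier P" using w v v2 by simp_all
    have "(p1' \<otimes> t1) \<otimes> (w' \<otimes> v \<otimes> v2) = p1 \<otimes> (w \<otimes> v \<otimes> v2)"
      unfolding 1 using c t w(1,2) v(1) v2(1) by (simp add: m_assoc)
    moreover have "(q2 \<otimes> t2) \<otimes> (w' \<otimes> v \<otimes> v2) = p3 \<otimes> (w \<otimes> v \<otimes> v2)"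
      unfolding v2(2) using c t w(1,2) v(1) v2(1) by (simp add: m_assoc)
    ultimately show ?thesis
      using assms c t P by (subst fr_eq_iff) (simp_all only: m_closed, blast)
  qed
  then have "?S \<subseteq> {fr p1 p3}"
    by (intro subsetI, elim CollectE exE conjE) (simp only: singleton_iff)
  moreover have "fr p1 p3 \<in> ?S"
    by (insert fr_self[OF assms(1,2)] fr_self[OF assms(2,3)] assms, rule CollectI, rule exI[of _ p1], rule exI[of _ p2], rule exI[of _ p2], rule exI[of _ p3],
        rule exI[of _ \<one>], rule exI[of _ \<one>], simp)
  ultimately have "?S = {fr p1 p3}" by (intro equalityI) (simp_all only: empty_subsetI insert_subset)
  then show ?thesis by (simp add: ore_group_def)
qed

text \<open>Two uses of (O1) turn the denominator of each fraction into the numerator of the next,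
  so that associativity becomes an instance of \<open>fr_mult\<close>.\<close>

lemma G_match3:
  assumes "g \<in> carrier G" "h \<in> carrier G" "k \<in> carrier G"
  obtains p1 p2 p3 p4 where "p1 \<in> carrier P" "p2 \<in> carrier P" "p3 \<in> carrier P" "p4 \<in> carrier P"
    "g = fr p1 p2" "h = fr p2 p3" "k = fr p3 p4"
proof -
  obtain a1 a2 b1 b2 c1 c2 where c: "a1 \<in> carrier P" "a2 \<in> carrier P" "b1 \<in> carrier P" "b2 \<in> carrier P"
    "c1 \<in> carrier P" "c2 \<in> carrier P" and g: "g = fr a1 a2" "h = fr b1 b2" "k = fr c1 c2"
    using assms by (auto simp: G_carrier)
  obtain t s where ts: "t \<in> carrier P" "s \<in> carrier P" "a2 \<otimes> t = b1 \<otimes> s" using ore_common[of a2 b1] c by blast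
  obtain u w where uw: "u \<in> carrier P" "w \<in> carrier P" "(b2 \<otimes> s) \<otimes> u = c1 \<otimes> w"
    using ore_common[of "b2 \<otimes> s" c1] c ts by blast
  show thesis
  proof (rule that[of "a1 \<otimes> (t \<otimes> u)" "a2 \<otimes> (t \<otimes> u)" "b2 \<otimes> s \<otimes> u" "c2 \<otimes> w"])
    show "h = fr (a2 \<otimes> (t \<otimes> u)) (b2 \<otimes> s \<otimes> u)"
      using mult_eq_ext[OF ts(3), of u] fr_shift[of b1 b2 "s \<otimes> u"] c ts uw g by (simp add: m_assoc)
    show "k = fr (b2 \<otimes> s \<otimes> u) (c2 \<otimes> w)"
      unfolding uw(3) using fr_shift[of c1 c2 w] c ts uw g by simp
  qed (use c ts uw g in \<open>simp_all add: fr_shift\<close>)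
qed

lemma G_mult_closed: "g \<in> carrier G \<Longrightarrow> h \<in> carrier G \<Longrightarrow> g \<otimes>\<^bsub>G\<^esub> h \<in> carrier G"
  by (erule G_match3[of g h h]) (auto simp: fr_mult fr_closed)

lemma G_mult_assoc:
  "g \<in> carrier G \<Longrightarrow> h \<in> carrier G \<Longrightarrow> k \<in> carrier G \<Longrightarrow> (g \<otimes>\<^bsub>G\<^esub> h) \<otimes>\<^bsub>G\<^esub> k = g \<otimes>\<^bsub>G\<^esub> (h \<otimes>\<^bsub>G\<^esub> k)"
  by (erule G_match3[of g h k]) (auto simp: fr_mult)

end

section \<open>Classes in the inductive limits, their sums and products\<close>

context proper_ore_diagram
begin

abbreviation "cl \<equiv> limit_class P F \<mu>"

definition el :: "('a \<Rightarrow> 'a) \<Rightarrow> 'p \<Rightarrow> 'p \<Rightarrow> bool" where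
  "el x p1 p2 \<longleftrightarrow> p1 \<in> carrier P \<and> p2 \<in> carrier P \<and> x \<in> H p1 p2"

text \<open>The entries t and s are arrows from the two objects to a common one. They are explicit
  arguments because later proofs prolong them and prescribe them.\<close>

definition agree :: "('a \<Rightarrow> 'a) \<Rightarrow> 'p \<Rightarrow> 'p \<Rightarrow> 'p \<Rightarrow> ('a \<Rightarrow> 'a) \<Rightarrow> 'p \<Rightarrow> 'p \<Rightarrow> 'p \<Rightarrow> bool" where
  "agree x p1 p2 t y q1 q2 s \<longleftrightarrow> p1 \<otimes> t = q1 \<otimes> s \<and> p2 \<otimes> t = q2 \<otimes> s \<and> sh p1 p2 t x = sh q1 q2 s y"

lemma elD: "el x p1 p2 \<Longrightarrow> p1 \<in> carrier P" "el x p1 p2 \<Longrightarrow> p2 \<in> carrier P" "el x p1 p2 \<Longrightarrow> x \<in> H p1 p2"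
  by (auto simp: el_def)

lemma el_shift: "el x p1 p2 \<Longrightarrow> t \<in> carrier P \<Longrightarrow> el (sh p1 p2 t x) (p1 \<otimes> t) (p2 \<otimes> t)"
  by (simp add: el_def H_shift)

lemma el_add: "el x p1 p2 \<Longrightarrow> el y p1 p2 \<Longrightarrow> el (x \<oplus>\<^bsub>Hb p1 p2\<^esub> y) p1 p2"
  using H_add by (simp add: el_def)

lemma el_compose: "el x p1 p2 \<Longrightarrow> el y p2 p3 \<Longrightarrow> el (compose (carrier (F p3)) x y) p1 p3"
  using H_compose[of p1 p2 p3 x y] by (simp add: el_def)

lemma el_zero: "p1 \<in> carrier P \<Longrightarrow> p2 \<in> carrier P \<Longrightarrow> el \<zero>\<^bsub>Hb p1 p2\<^esub> p1 p2"
  using H_zero by (simp add: el_def)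

lemma el_minus: "el x p1 p2 \<Longrightarrow> el (\<ominus>\<^bsub>Hb p1 p2\<^esub> x) p1 p2"
  using H_minus by (simp add: el_def)

lemma agree_ext:
  assumes "agree x p1 p2 t y q1 q2 s" "el x p1 p2" "el y q1 q2" "t \<in> carrier P" "s \<in> carrier P" "e \<in> carrier P"
  shows "agree x p1 p2 (t \<otimes> e) y q1 q2 (s \<otimes> e)"
proof -
  note a = assms(1)[unfolded agree_def]
  have "sh p1 p2 (t \<otimes> e) x = sh (p1 \<otimes> t) (p2 \<otimes> t) e (sh p1 p2 t x)"
    using assms by (simp add: shift_shift elD)
  also have "\<dots> = sh (q1 \<otimes> s) (q2 \<otimes> s) e (sh q1 q2 s y)" using a by simp
  also have "\<dots> = sh q1 q2 (s \<otimes> e) y"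
    using assms by (simp add: shift_shift elD)
  finally have "sh p1 p2 (t \<otimes> e) x = sh q1 q2 (s \<otimes> e) y" .
  moreover have "p1 \<otimes> (t \<otimes> e) = q1 \<otimes> (s \<otimes> e)" "p2 \<otimes> (t \<otimes> e) = q2 \<otimes> (s \<otimes> e)"
    using a assms(4-6) elD(1,2)[OF assms(2)] elD(1,2)[OF assms(3)] by (blast intro: mult_eq_ext)+
  ultimately show ?thesis by (simp only: agree_def)
qed

lemma agree_sym: "agree x p1 p2 t y q1 q2 s \<Longrightarrow> agree y q1 q2 s x p1 p2 t"
  by (simp add: agree_def)

lemma agree_trans: "agree x p1 p2 t y q1 q2 s \<Longrightarrow> agree y q1 q2 s z r1 r2 u \<Longrightarrow> agree x p1 p2 t z r1 r2 u"
  by (simp add: agree_def)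

lemma limit_rel_iff: "((x, p1, p2), (y, q1, q2)) \<in> limit_rel P F \<mu> \<longleftrightarrow>
    el x p1 p2 \<and> el y q1 q2 \<and> (\<exists>t\<in>carrier P. \<exists>s\<in>carrier P. agree x p1 p2 t y q1 q2 s)"
  by (auto simp: limit_rel_def el_def agree_def)

lemma equiv_limit_rel: "equiv {(x, p1, p2). el x p1 p2} (limit_rel P F \<mu>)"
proof (rule equivI)
  show "limit_rel P F \<mu> \<subseteq> {(x, p1, p2). el x p1 p2} \<times> {(x, p1, p2). el x p1 p2}"
    by (auto simp: limit_rel_iff)
  show "refl_on {(x, p1, p2). el x p1 p2} (limit_rel P F \<mu>)"
    by (auto simp: refl_on_def limit_rel_iff agree_def)
  show "sym (limit_rel P F \<mu>)"
    by (rule symI, clarify) (auto simp: limit_rel_iff intro: agree_sym)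
  show "trans (limit_rel P F \<mu>)"
  proof (rule transI, clarify)
    fix x p1 p2 y q1 q2 z r1 r2
    assume "((x, p1, p2), (y, q1, q2)) \<in> limit_rel P F \<mu>" "((y, q1, q2), (z, r1, r2)) \<in> limit_rel P F \<mu>"
    then obtain t1 t2 s1 s2 where c: "t1 \<in> carrier P" "t2 \<in> carrier P" "s1 \<in> carrier P" "s2 \<in> carrier P"
      and el: "el x p1 p2" "el y q1 q2" "el z r1 r2"
      and a: "agree x p1 p2 t1 y q1 q2 t2" "agree y q1 q2 s1 z r1 r2 s2"
      by (auto simp: limit_rel_iff)
    obtain u v where uv: "u \<in> carrier P" "v \<in> carrier P" "t2 \<otimes> u = s1 \<otimes> v"
      using ore_common[of t2 s1] c by blast
    have "agree x p1 p2 (t1 \<otimes> u) z r1 r2 (s2 \<otimes> v)"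
      using agree_trans[OF agree_ext[OF a(1) el(1,2) c(1,2) uv(1), unfolded uv(3)] agree_ext[OF a(2) el(2,3) c(3,4) uv(2)]] .
    then show "((x, p1, p2), (z, r1, r2)) \<in> limit_rel P F \<mu>"
      using el c uv by (auto simp: limit_rel_iff)
  qed
qed

lemma cl_eq_iff:
  assumes "el x p1 p2" "el y q1 q2"
  shows "cl x p1 p2 = cl y q1 q2 \<longleftrightarrow> (\<exists>t\<in>carrier P. \<exists>s\<in>carrier P. agree x p1 p2 t y q1 q2 s)"
  using eq_equiv_class_iff[OF equiv_limit_rel, of "(x, p1, p2)" "(y, q1, q2)"] assms
  by (simp add: limit_class_def limit_rel_iff)

lemma cl_eqI:
  assumes "el x p1 p2" "el y q1 q2" "t \<in> carrier P" "s \<in> carrier P" "agree x p1 p2 t y q1 q2 s"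
  shows "cl x p1 p2 = cl y q1 q2"
  using assms cl_eq_iff by blast

lemma cl_mem: "(y, q1, q2) \<in> cl x p1 p2 \<Longrightarrow> el y q1 q2 \<and> cl x p1 p2 = cl y q1 q2"
  using equiv_class_eq[OF equiv_limit_rel, of "(x, p1, p2)" "(y, q1, q2)"]
  by (auto simp: limit_class_def limit_rel_iff)

lemma cl_self: "el x p1 p2 \<Longrightarrow> (x, p1, p2) \<in> cl x p1 p2"
  using equiv_class_self[OF equiv_limit_rel, of "(x, p1, p2)"] by (simp add: limit_class_def)

lemma cl_shift:
  assumes "el x p1 p2" "t \<in> carrier P"
  shows "cl (sh p1 p2 t x) (p1 \<otimes> t) (p2 \<otimes> t) = cl x p1 p2"
  using elD[OF assms(1)] assms
  by (intro cl_eqI[OF el_shift[OF assms] assms(1) one_closed assms(2)]) (simp add: agree_def shift_one H_shift)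

text \<open>Equality of classes comes with arrows that cannot be chosen. By
  \<open>ore_common_refine\<close>, arrows u, u' that match one coordinate do as well after a
  further arrow v.\<close>

lemma cl_refine:
  assumes "el x p1 p2" "el y q1 q2" "cl x p1 p2 = cl y q1 q2" "u \<in> carrier P" "u' \<in> carrier P"
    and "p1 \<otimes> u = q1 \<otimes> u' \<or> p2 \<otimes> u = q2 \<otimes> u'"
  shows "\<exists>v\<in>carrier P. agree x p1 p2 (u \<otimes> v) y q1 q2 (u' \<otimes> v)"
proof -
  obtain t s where ts: "t \<in> carrier P" "s \<in> carrier P" "agree x p1 p2 t y q1 q2 s"
    using assms(3) unfolding cl_eq_iff[OF assms(1,2)] by blast
  obtain v b where vb: "v \<in> carrier P" "b \<in> carrier P" "u \<otimes> v = t \<otimes> b" "u' \<otimes> v = s \<otimes> b"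
    using assms(6) ts(3)[unfolded agree_def]
      ore_common_refine[OF elD(1)[OF assms(1)] elD(1)[OF assms(2)] ts(1,2) assms(4,5)]
      ore_common_refine[OF elD(2)[OF assms(1)] elD(2)[OF assms(2)] ts(1,2) assms(4,5)]
    by blast
  show ?thesis
    using agree_ext[OF ts(3) assms(1,2) ts(1,2) vb(2)] vb(1) unfolding vb(3,4)[symmetric] by blast
qed

text \<open>Two equalities of classes are realised by one refinement: the same T shifts x and y, and
  the same T' prolongs t1 and t2. The disjunction serves addition, where the first entries of x and
  y coincide, and multiplication, where the second entry of x is the first entry of y; d is the
  entry of x' that t1 and t2 match with q1'.\<close>

lemma cl_refine_pair:
  assumes x: "el x p1 p2" "el x' p1' p2'" "cl x p1 p2 = cl x' p1' p2'"
    and y: "el y q1 q2" "el y' q1' q2'" "cl y q1 q2 = cl y' q1' q2'"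
    and t: "t1 \<in> carrier P" "t2 \<in> carrier P"
    and d: "q1 = p1 \<and> d = p1' \<or> q1 = p2 \<and> d = p2'" "d \<otimes> t1 = q1' \<otimes> t2"
  obtains T T' where "T \<in> carrier P" "T' \<in> carrier P"
    "agree x p1 p2 T x' p1' p2' (t1 \<otimes> T')" "agree y q1 q2 T y' q1' q2' (t2 \<otimes> T')"
proof -
  note p = elD(1,2)[OF x(1)] elD(1,2)[OF x(2)] elD(1)[OF y(1)] elD(1)[OF y(2)]
  have dP: "d \<in> carrier P" using d(1) p by auto
  obtain w w' where w: "w \<in> carrier P" "w' \<in> carrier P" "q1 \<otimes> w = (d \<otimes> t1) \<otimes> w'"
    using ore_common[OF p(5) m_closed[OF dP t(1)]] by blast
  have "q1 \<otimes> w = d \<otimes> (t1 \<otimes> w')" unfolding w(3) by (rule m_assoc[OF dP t(1) w(2)])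
  then obtain v where v: "v \<in> carrier P" "agree x p1 p2 (w \<otimes> v) x' p1' p2' (t1 \<otimes> w' \<otimes> v)"
    using cl_refine[OF x w(1) m_closed[OF t(1) w(2)]] d(1) by blast
  have "q1 \<otimes> (w \<otimes> v) = (d \<otimes> t1) \<otimes> (w' \<otimes> v)"
    by (rule mult_eq_ext[OF w(3) p(5) w(1) m_closed[OF dP t(1)] w(2) v(1)])
  then have "q1 \<otimes> (w \<otimes> v) = q1' \<otimes> (t2 \<otimes> w' \<otimes> v)"
    unfolding d(2) using p(6) t w(1,2) v(1) by (simp add: m_assoc)
  then obtain u where u: "u \<in> carrier P" "agree y q1 q2 (w \<otimes> v \<otimes> u) y' q1' q2' (t2 \<otimes> w' \<otimes> v \<otimes> u)"
    using cl_refine[OF y, of "w \<otimes> v" "t2 \<otimes> w' \<otimes> v"] t w(1,2) v(1) by auto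
  have "agree x p1 p2 (w \<otimes> v \<otimes> u) x' p1' p2' (t1 \<otimes> w' \<otimes> v \<otimes> u)"
    using agree_ext[OF v(2) x(1,2) _ _ u(1)] t w(1,2) v(1) by simp
  then show thesis
    using u t w(1,2) v(1) by (intro that[of "w \<otimes> v \<otimes> u" "w' \<otimes> v \<otimes> u"]) (simp_all add: m_assoc)
qed

abbreviation "Oc \<equiv> O_component P F \<mu>"
abbreviation "bm \<equiv> O_component_mult P F \<mu>"

lemma Oc_carrier: "carrier (Oc g) = {cl x p1 p2 | x p1 p2. el x p1 p2 \<and> fr p1 p2 = g}"
  by (auto simp: O_component_def ore_reps_def el_def)

lemma cl_Oc: "el x p1 p2 \<Longrightarrow> cl x p1 p2 \<in> carrier (Oc (fr p1 p2))"
  by (auto simp: Oc_carrier)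

lemma OcE:
  assumes "X \<in> carrier (Oc g)"
  obtains x p1 p2 where "el x p1 p2" "g = fr p1 p2" "X = cl x p1 p2"
  using assms by (auto simp: Oc_carrier)

lemma Oc_zero:
  assumes "p1 \<in> carrier P" "p2 \<in> carrier P"
  shows "\<zero>\<^bsub>Oc (fr p1 p2)\<^esub> = cl \<zero>\<^bsub>Hb p1 p2\<^esub> p1 p2"
proof -
  have *: "cl \<zero>\<^bsub>Hb q1 q2\<^esub> q1 q2 = cl \<zero>\<^bsub>Hb p1 p2\<^esub> p1 p2"
    if q: "q1 \<in> carrier P" "q2 \<in> carrier P" and fq: "fr q1 q2 = fr p1 p2" for q1 q2
  proof -
    obtain t s where "t \<in> carrier P" "s \<in> carrier P" "q1 \<otimes> t = p1 \<otimes> s" "q2 \<otimes> t = p2 \<otimes> s"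
      using fq unfolding fr_eq_iff[OF q assms] by blast
    then show ?thesis
      using q assms by (intro cl_eqI[of _ _ _ _ _ _ t s] el_zero) (simp_all only: agree_def shift_zero)
  qed
  have "{cl (\<lambda>z\<in>carrier (F q2). \<zero>\<^bsub>F q1\<^esub>) q1 q2 | q1 q2. (q1, q2) \<in> ore_reps P (fr p1 p2)}
      = {cl \<zero>\<^bsub>Hb p1 p2\<^esub> p1 p2}"
  proof (intro equalityI subsetI)
    fix X assume "X \<in> {cl (\<lambda>z\<in>carrier (F q2). \<zero>\<^bsub>F q1\<^esub>) q1 q2 | q1 q2. (q1, q2) \<in> ore_reps P (fr p1 p2)}"
    then obtain q1 q2 where "q1 \<in> carrier P" "q2 \<in> carrier P" "fr q1 q2 = fr p1 p2" "X = cl \<zero>\<^bsub>Hb q1 q2\<^esub> q1 q2"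
      by (auto simp: ore_reps_def)
    then show "X \<in> {cl \<zero>\<^bsub>Hb p1 p2\<^esub> p1 p2}"
      using *
      by blast
  next
    fix X assume "X \<in> {cl \<zero>\<^bsub>Hb p1 p2\<^esub> p1 p2}"
    then show "X \<in> {cl (\<lambda>z\<in>carrier (F q2). \<zero>\<^bsub>F q1\<^esub>) q1 q2 | q1 q2. (q1, q2) \<in> ore_reps P (fr p1 p2)}"
      using assms by (auto simp: ore_reps_def)
  qed
  then show ?thesis by (simp add: O_component_def)
qed

text \<open>The addition is a \<open>the_elem\<close> over all representatives and arrows. Each
  choice, shifted by T', equals the shift by T of the sum x + y, so that all results are the class
  of x + y. The index g is arbitrary because the formula for the sum is the same in all
  components.\<close>

lemma Oc_add:
  assumes "el x p1 p2" "el y p1 p2"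
  shows "cl x p1 p2 \<oplus>\<^bsub>Oc g\<^esub> cl y p1 p2 = cl (x \<oplus>\<^bsub>Hb p1 p2\<^esub> y) p1 p2"
proof -
  let ?v = "\<lambda>x' p1' p2' y' q1 q2 t1 t2. cl (sh p1' p2' t1 x' \<oplus>\<^bsub>Hb (p1' \<otimes> t1) (p2' \<otimes> t1)\<^esub> sh q1 q2 t2 y') (p1' \<otimes> t1) (p2' \<otimes> t1)"
  let ?c = "\<lambda>x' p1' p2' y' q1 q2 t1 t2. (x', p1', p2') \<in> cl x p1 p2 \<and> (y', q1, q2) \<in> cl y p1 p2
    \<and> t1 \<in> carrier P \<and> t2 \<in> carrier P \<and> p1' \<otimes> t1 = q1 \<otimes> t2 \<and> p2' \<otimes> t1 = q2 \<otimes> t2"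
  have eq: "?v x' p1' p2' y' q1 q2 t1 t2 = cl (x \<oplus>\<^bsub>Hb p1 p2\<^esub> y) p1 p2"
    if c: "?c x' p1' p2' y' q1 q2 t1 t2" for x' p1' p2' y' q1 q2 t1 t2
  proof -
    have t: "t1 \<in> carrier P" "t2 \<in> carrier P" "p1' \<otimes> t1 = q1 \<otimes> t2" "p2' \<otimes> t1 = q2 \<otimes> t2" using c by auto
    have x': "el x' p1' p2'" "cl x p1 p2 = cl x' p1' p2'" and y': "el y' q1 q2" "cl y p1 p2 = cl y' q1 q2"
      using cl_mem c by blast+
    note p = elD[OF assms(1)] and y = elD[OF assms(2)] and x'd = elD[OF x'(1)] and y'd = elD[OF y'(1)]
    obtain T T' where TP: "T \<in> carrier P" "T' \<in> carrier P" and agx: "agree x p1 p2 T x' p1' p2' (t1 \<otimes> T')"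
      and agy: "agree y p1 p2 T y' q1 q2 (t2 \<otimes> T')"
      by (rule cl_refine_pair[OF assms(1) x' assms(2) y' t(1,2), of p1']) (simp_all add: t(3))
    have sx: "el (sh p1' p2' t1 x') (p1' \<otimes> t1) (p2' \<otimes> t1)" using el_shift[OF x'(1) t(1)] .
    have sy: "el (sh q1 q2 t2 y') (p1' \<otimes> t1) (p2' \<otimes> t1)" using el_shift[OF y'(1) t(2)] t by simp
    have c1: "p1' \<otimes> t1 \<in> carrier P" "p2' \<otimes> t1 \<in> carrier P" using x'd t(1) by simp_all
    have i1: "p1 \<otimes> T = p1' \<otimes> t1 \<otimes> T'" "p2 \<otimes> T = p2' \<otimes> t1 \<otimes> T'"
      using agx x'd(1,2) t(1) TP by (simp_all add: agree_def m_assoc)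
    have s1: "sh (p1' \<otimes> t1) (p2' \<otimes> t1) T' (sh p1' p2' t1 x') = sh p1 p2 T x"
      using agx x'd t(1) TP by (simp add: agree_def shift_shift)
    have s2: "sh (p1' \<otimes> t1) (p2' \<otimes> t1) T' (sh q1 q2 t2 y') = sh p1 p2 T y"
      using agy y'd t TP by (simp add: agree_def shift_shift)
    have "sh p1 p2 T (x \<oplus>\<^bsub>Hb p1 p2\<^esub> y) = sh p1 p2 T x \<oplus>\<^bsub>Hb (p1 \<otimes> T) (p2 \<otimes> T)\<^esub> sh p1 p2 T y"
      using p y TP by (intro shift_add)
    also have "\<dots> = sh (p1' \<otimes> t1) (p2' \<otimes> t1) T' (sh p1' p2' t1 x' \<oplus>\<^bsub>Hb (p1' \<otimes> t1) (p2' \<otimes> t1)\<^esub> sh q1 q2 t2 y')"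
      unfolding shift_add[OF c1 TP(2) c1 elD(3)[OF sx] c1 elD(3)[OF sy]] s1 s2 i1 by (rule refl)
    finally have "agree (sh p1' p2' t1 x' \<oplus>\<^bsub>Hb (p1' \<otimes> t1) (p2' \<otimes> t1)\<^esub> sh q1 q2 t2 y') (p1' \<otimes> t1) (p2' \<otimes> t1) T'
        (x \<oplus>\<^bsub>Hb p1 p2\<^esub> y) p1 p2 T"
      unfolding agree_def i1 by (intro conjI refl) (rule sym)
    then show ?thesis
      using TP by (intro cl_eqI[OF el_add[OF sx sy] el_add[OF assms]])
  qed
  have "{?v x' p1' p2' y' q1 q2 t1 t2 | x' p1' p2' y' q1 q2 t1 t2. ?c x' p1' p2' y' q1 q2 t1 t2}
      = {cl (x \<oplus>\<^bsub>Hb p1 p2\<^esub> y) p1 p2}"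
  proof (intro equalityI subsetI)
    fix X assume "X \<in> {?v x' p1' p2' y' q1 q2 t1 t2 | x' p1' p2' y' q1 q2 t1 t2. ?c x' p1' p2' y' q1 q2 t1 t2}"
    then show "X \<in> {cl (x \<oplus>\<^bsub>Hb p1 p2\<^esub> y) p1 p2}"
      by (elim CollectE exE) (use eq in \<open>simp only: singleton_iff\<close>)
  next
    fix X assume X: "X \<in> {cl (x \<oplus>\<^bsub>Hb p1 p2\<^esub> y) p1 p2}"
    \<comment> \<open>The choice t1 = t2 = 1 shows that the set of results is nonempty; its value
      follows from \<open>eq\<close> without computing shifts by 1.\<close>
    have c: "?c x p1 p2 y p1 p2 \<one> \<one>" using cl_self assms by simp
    from eq[OF c] X have XX: "X = ?v x p1 p2 y p1 p2 \<one> \<one>" by simp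
    show "X \<in> {?v x' p1' p2' y' q1 q2 t1 t2 | x' p1' p2' y' q1 q2 t1 t2. ?c x' p1' p2' y' q1 q2 t1 t2}"
      by (insert c XX, rule CollectI, rule exI[of _ x], rule exI[of _ p1], rule exI[of _ p2], rule exI[of _ y],
          rule exI[of _ p1], rule exI[of _ p2], rule exI[of _ \<one>], rule exI[of _ \<one>], rule conjI)
  qed
  then show ?thesis by (simp add: O_component_def del: hom_bimodule_simps)
qed

text \<open>At composable representatives no shift is left over. An arbitrary choice, shifted by T',
  becomes the composite of the shifts by T of x and y, which is the shift by T of their
  composite.\<close>

lemma bm_cl:
  assumes "el x p1 p2" "el y p2 p3"
  shows "bm (cl x p1 p2) (cl y p2 p3) = cl (compose (carrier (F p3)) x y) p1 p3"
proof -
  let ?v = "\<lambda>x' p1' p2' y' q1 q2 t1 t2.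
    cl (compose (carrier (F (q2 \<otimes> t2))) (sh p1' p2' t1 x') (sh q1 q2 t2 y')) (p1' \<otimes> t1) (q2 \<otimes> t2)"
  let ?c = "\<lambda>x' p1' p2' y' q1 q2 t1 t2. (x', p1', p2') \<in> cl x p1 p2 \<and> (y', q1, q2) \<in> cl y p2 p3
    \<and> t1 \<in> carrier P \<and> t2 \<in> carrier P \<and> p2' \<otimes> t1 = q1 \<otimes> t2"
  have eq: "?v x' p1' p2' y' q1 q2 t1 t2 = cl (compose (carrier (F p3)) x y) p1 p3"
    if c: "?c x' p1' p2' y' q1 q2 t1 t2" for x' p1' p2' y' q1 q2 t1 t2
  proof -
    have t: "t1 \<in> carrier P" "t2 \<in> carrier P" "p2' \<otimes> t1 = q1 \<otimes> t2" using c by auto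
    have x': "el x' p1' p2'" "cl x p1 p2 = cl x' p1' p2'" and y': "el y' q1 q2" "cl y p2 p3 = cl y' q1 q2"
      using cl_mem c by blast+
    note p = elD[OF assms(1)] and y = elD[OF assms(2)] and x'd = elD[OF x'(1)] and y'd = elD[OF y'(1)]
    obtain T T' where TP: "T \<in> carrier P" "T' \<in> carrier P" and agx: "agree x p1 p2 T x' p1' p2' (t1 \<otimes> T')"
      and agy: "agree y p2 p3 T y' q1 q2 (t2 \<otimes> T')"
      by (rule cl_refine_pair[OF assms(1) x' assms(2) y' t(1,2), of p2']) (simp_all add: t(3))
    have sx: "el (sh p1' p2' t1 x') (p1' \<otimes> t1) (q1 \<otimes> t2)" using el_shift[OF x'(1) t(1)] t by simp
    have sy: "el (sh q1 q2 t2 y') (q1 \<otimes> t2) (q2 \<otimes> t2)" using el_shift[OF y'(1) t(2)] .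
    have c1: "p1' \<otimes> t1 \<in> carrier P" "q1 \<otimes> t2 \<in> carrier P" "q2 \<otimes> t2 \<in> carrier P" using x'd y'd t(1,2) by simp_all
    have i1: "p1 \<otimes> T = p1' \<otimes> t1 \<otimes> T'" "p3 \<otimes> T = q2 \<otimes> t2 \<otimes> T'"
      using agx agy x'd(1,2) y'd(1,2) t(1,2) TP by (simp_all add: agree_def m_assoc)
    have s1: "sh (p1' \<otimes> t1) (q1 \<otimes> t2) T' (sh p1' p2' t1 x') = sh p1 p2 T x"
      using agx x'd t TP shift_shift[OF x'd(1,2) t(1) TP(2) x'd] by (simp add: agree_def)
    have s2: "sh (q1 \<otimes> t2) (q2 \<otimes> t2) T' (sh q1 q2 t2 y') = sh p2 p3 T y"
      using agy y'd t(2) TP by (simp add: agree_def shift_shift)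
    have "sh p1 p3 T (compose (carrier (F p3)) x y) = compose (carrier (F (p3 \<otimes> T))) (sh p1 p2 T x) (sh p2 p3 T y)"
      using p y TP by (intro shift_compose)
    also have "\<dots> = sh (p1' \<otimes> t1) (q2 \<otimes> t2) T'
        (compose (carrier (F (q2 \<otimes> t2))) (sh p1' p2' t1 x') (sh q1 q2 t2 y'))"
      unfolding shift_compose[OF c1 TP(2) c1(1,2) elD(3)[OF sx] c1(2,3) elD(3)[OF sy]] s1 s2 i1 by (rule refl)
    finally have "agree (compose (carrier (F (q2 \<otimes> t2))) (sh p1' p2' t1 x') (sh q1 q2 t2 y')) (p1' \<otimes> t1) (q2 \<otimes> t2) T'
        (compose (carrier (F p3)) x y) p1 p3 T"
      unfolding agree_def i1 by (intro conjI refl) (rule sym)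
    then show ?thesis
      using TP by (intro cl_eqI[OF el_compose[OF sx sy] el_compose[OF assms]])
  qed
  have "{?v x' p1' p2' y' q1 q2 t1 t2 | x' p1' p2' y' q1 q2 t1 t2. ?c x' p1' p2' y' q1 q2 t1 t2}
      = {cl (compose (carrier (F p3)) x y) p1 p3}"
  proof (intro equalityI subsetI)
    fix X assume "X \<in> {?v x' p1' p2' y' q1 q2 t1 t2 | x' p1' p2' y' q1 q2 t1 t2. ?c x' p1' p2' y' q1 q2 t1 t2}"
    then show "X \<in> {cl (compose (carrier (F p3)) x y) p1 p3}"
      by (elim CollectE exE) (use eq in \<open>simp only: singleton_iff\<close>)
  next
    fix X assume X: "X \<in> {cl (compose (carrier (F p3)) x y) p1 p3}"
    have c: "?c x p1 p2 y p2 p3 \<one> \<one>" using cl_self assms by simp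
    from eq[OF c] X have XX: "X = ?v x p1 p2 y p2 p3 \<one> \<one>" by simp
    show "X \<in> {?v x' p1' p2' y' q1 q2 t1 t2 | x' p1' p2' y' q1 q2 t1 t2. ?c x' p1' p2' y' q1 q2 t1 t2}"
      by (insert c XX, rule CollectI, rule exI[of _ x], rule exI[of _ p1], rule exI[of _ p2], rule exI[of _ y], rule exI[of _ p2], rule exI[of _ p3], rule exI[of _ \<one>], rule exI[of _ \<one>], rule conjI)
  qed
  then show ?thesis by (simp add: O_component_mult_def)
qed

section \<open>The homogeneous components\<close>

lemma cl_shiftE:
  assumes "el x p1 p2" "t \<in> carrier P"
  obtains x' where "el x' (p1 \<otimes> t) (p2 \<otimes> t)" "cl x p1 p2 = cl x' (p1 \<otimes> t) (p2 \<otimes> t)"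
  using el_shift[OF assms] cl_shift[OF assms, symmetric] by (rule that)

lemma Oc_match:
  assumes "X \<in> carrier (Oc g)" "Y \<in> carrier (Oc g)"
  obtains x y p1 p2 where "el x p1 p2" "el y p1 p2" "g = fr p1 p2" "X = cl x p1 p2" "Y = cl y p1 p2"
proof -
  obtain x p1 p2 where x: "el x p1 p2" "g = fr p1 p2" "X = cl x p1 p2" using assms(1) by (rule OcE)
  obtain y q1 q2 where y: "el y q1 q2" "g = fr q1 q2" "Y = cl y q1 q2" using assms(2) by (rule OcE)
  have "fr p1 p2 = fr q1 q2" using x(2) y(2) by simp
  then obtain t s where ts: "t \<in> carrier P" "s \<in> carrier P" "p1 \<otimes> t = q1 \<otimes> s" "p2 \<otimes> t = q2 \<otimes> s"
    unfolding fr_eq_iff[OF elD(1,2)[OF x(1)] elD(1,2)[OF y(1)]] by blast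
  obtain x' where x': "el x' (p1 \<otimes> t) (p2 \<otimes> t)" "cl x p1 p2 = cl x' (p1 \<otimes> t) (p2 \<otimes> t)"
    using x(1) ts(1) by (rule cl_shiftE)
  obtain y' where y': "el y' (q1 \<otimes> s) (q2 \<otimes> s)" "cl y q1 q2 = cl y' (q1 \<otimes> s) (q2 \<otimes> s)"
    using y(1) ts(2) by (rule cl_shiftE)
  show thesis
    using x' y' x y ts fr_shift[OF elD(1,2)[OF x(1)] ts(1)]
    by (intro that[of x' "p1 \<otimes> t" "p2 \<otimes> t" y']) simp_all
qed

lemma Oc_match3:
  assumes "X \<in> carrier (Oc g)" "Y \<in> carrier (Oc g)" "Z \<in> carrier (Oc g)"
  obtains x y z p1 p2 where "el x p1 p2" "el y p1 p2" "el z p1 p2" "g = fr p1 p2"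
    "X = cl x p1 p2" "Y = cl y p1 p2" "Z = cl z p1 p2"
proof -
  obtain x y p1 p2 where x: "el x p1 p2" "el y p1 p2" "g = fr p1 p2" "X = cl x p1 p2" "Y = cl y p1 p2"
    using assms(1,2) by (rule Oc_match)
  obtain z q1 q2 where z: "el z q1 q2" "g = fr q1 q2" "Z = cl z q1 q2" using assms(3) by (rule OcE)
  have "fr p1 p2 = fr q1 q2" using x(3) z(2) by simp
  then obtain t s where ts: "t \<in> carrier P" "s \<in> carrier P" "p1 \<otimes> t = q1 \<otimes> s" "p2 \<otimes> t = q2 \<otimes> s"
    unfolding fr_eq_iff[OF elD(1,2)[OF x(1)] elD(1,2)[OF z(1)]] by blast
  obtain x' where x': "el x' (p1 \<otimes> t) (p2 \<otimes> t)" "cl x p1 p2 = cl x' (p1 \<otimes> t) (p2 \<otimes> t)"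
    using x(1) ts(1) by (rule cl_shiftE)
  obtain y' where y': "el y' (p1 \<otimes> t) (p2 \<otimes> t)" "cl y p1 p2 = cl y' (p1 \<otimes> t) (p2 \<otimes> t)"
    using x(2) ts(1) by (rule cl_shiftE)
  obtain z' where z': "el z' (q1 \<otimes> s) (q2 \<otimes> s)" "cl z q1 q2 = cl z' (q1 \<otimes> s) (q2 \<otimes> s)"
    using z(1) ts(2) by (rule cl_shiftE)
  show thesis
    using x' y' z' x z ts fr_shift[OF elD(1,2)[OF x(1)] ts(1)]
    by (intro that[of x' "p1 \<otimes> t" "p2 \<otimes> t" y' z']) simp_all
qed

text \<open>Only Y receives a new representative. The shift of x by t is left to the caller, so that
  several maps at the same object can be moved by the same t, as additivity of the product
  requires.\<close>

lemma cl_matchE: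
  assumes "el x p1 p2" "Y \<in> carrier (Oc h)"
  obtains t y p3 where "t \<in> carrier P" "el y (p2 \<otimes> t) p3" "h = fr (p2 \<otimes> t) p3" "Y = cl y (p2 \<otimes> t) p3"
proof -
  obtain y q1 q2 where y: "el y q1 q2" "h = fr q1 q2" "Y = cl y q1 q2" using assms(2) by (rule OcE)
  obtain t s where ts: "t \<in> carrier P" "s \<in> carrier P" "p2 \<otimes> t = q1 \<otimes> s"
    using ore_common[OF elD(2)[OF assms(1)] elD(1)[OF y(1)]] by blast
  obtain y' where y': "el y' (q1 \<otimes> s) (q2 \<otimes> s)" "cl y q1 q2 = cl y' (q1 \<otimes> s) (q2 \<otimes> s)"
    using y(1) ts(2) by (rule cl_shiftE)
  show thesis
    using y y' ts fr_shift[OF elD(1,2)[OF y(1)] ts(2)] by (intro that[of t y' "q2 \<otimes> s"]) simp_all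
qed

lemma Oc_closed_add: "X \<in> carrier (Oc g) \<Longrightarrow> Y \<in> carrier (Oc g) \<Longrightarrow> X \<oplus>\<^bsub>Oc g\<^esub> Y \<in> carrier (Oc g)"
  by (erule (1) Oc_match) (simp add: Oc_add el_add cl_Oc del: hom_bimodule_simps)

text \<open>The axioms are verified at a common object, which exists because the index category is
  filtered; there they hold for maps.\<close>

lemma Oc_abelian:
  assumes "g \<in> carrier G"
  shows "abelian_group (Oc g)"
proof (rule abelian_groupI)
  fix X Y assume XY: "X \<in> carrier (Oc g)" "Y \<in> carrier (Oc g)"
  then show "X \<oplus>\<^bsub>Oc g\<^esub> Y \<in> carrier (Oc g)" by (rule Oc_closed_add)
  obtain x y p1 p2 where x: "el x p1 p2" "el y p1 p2" "g = fr p1 p2" "X = cl x p1 p2" "Y = cl y p1 p2"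
    using XY by (rule Oc_match)
  interpret B: abelian_group "Hb p1 p2" using elD[OF x(1)] by (intro abelian_Hb)
  have xy: "x \<in> carrier (Hb p1 p2)" "y \<in> carrier (Hb p1 p2)" using H_RH elD[OF x(1)] elD[OF x(2)] by simp_all
  show "X \<oplus>\<^bsub>Oc g\<^esub> Y = Y \<oplus>\<^bsub>Oc g\<^esub> X"
    unfolding x(4,5) Oc_add[OF x(1,2)] Oc_add[OF x(2,1)] B.a_comm[OF xy] by (rule refl)
next
  fix X Y Z assume XYZ: "X \<in> carrier (Oc g)" "Y \<in> carrier (Oc g)" "Z \<in> carrier (Oc g)"
  obtain x y z p1 p2 where x: "el x p1 p2" "el y p1 p2" "el z p1 p2" "g = fr p1 p2"
    "X = cl x p1 p2" "Y = cl y p1 p2" "Z = cl z p1 p2"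
    using XYZ by (rule Oc_match3)
  interpret B: abelian_group "Hb p1 p2" using elD[OF x(1)] by (intro abelian_Hb)
  have xyz: "x \<in> carrier (Hb p1 p2)" "y \<in> carrier (Hb p1 p2)" "z \<in> carrier (Hb p1 p2)"
    using H_RH elD[OF x(1)] elD[OF x(2)] elD[OF x(3)] by simp_all
  show "X \<oplus>\<^bsub>Oc g\<^esub> Y \<oplus>\<^bsub>Oc g\<^esub> Z = X \<oplus>\<^bsub>Oc g\<^esub> (Y \<oplus>\<^bsub>Oc g\<^esub> Z)"
    unfolding x(5,6,7) Oc_add[OF x(1,2)] Oc_add[OF x(2,3)] Oc_add[OF el_add[OF x(1,2)] x(3)]
      Oc_add[OF x(1) el_add[OF x(2,3)]] B.a_assoc[OF xyz] by (rule refl)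
next
  obtain p1 p2 where p: "p1 \<in> carrier P" "p2 \<in> carrier P" "g = fr p1 p2" using assms by (auto simp: G_carrier)
  show "\<zero>\<^bsub>Oc g\<^esub> \<in> carrier (Oc g)"
    unfolding p(3) Oc_zero[OF p(1,2)] by (rule cl_Oc[OF el_zero[OF p(1,2)]])
next
  fix X assume "X \<in> carrier (Oc g)"
  then obtain x p1 p2 where x: "el x p1 p2" "g = fr p1 p2" "X = cl x p1 p2" by (rule OcE)
  note p = elD[OF x(1)]
  interpret B: abelian_group "Hb p1 p2" using p by (intro abelian_Hb)
  have xc: "x \<in> carrier (Hb p1 p2)" using H_RH p by simp
  have z: "\<zero>\<^bsub>Oc g\<^esub> = cl \<zero>\<^bsub>Hb p1 p2\<^esub> p1 p2" unfolding x(2) by (rule Oc_zero[OF p(1,2)])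
  show "\<zero>\<^bsub>Oc g\<^esub> \<oplus>\<^bsub>Oc g\<^esub> X = X"
    unfolding z x(3) Oc_add[OF el_zero[OF p(1,2)] x(1)] B.l_zero[OF xc] by (rule refl)
  have "cl (\<ominus>\<^bsub>Hb p1 p2\<^esub> x) p1 p2 \<oplus>\<^bsub>Oc g\<^esub> X = \<zero>\<^bsub>Oc g\<^esub>"
    unfolding z x(3) Oc_add[OF el_minus[OF x(1)] x(1)] B.l_neg[OF xc] by (rule refl)
  moreover have "cl (\<ominus>\<^bsub>Hb p1 p2\<^esub> x) p1 p2 \<in> carrier (Oc g)"
    unfolding x(2) by (rule cl_Oc[OF el_minus[OF x(1)]])
  ultimately show "\<exists>Y\<in>carrier (Oc g). Y \<oplus>\<^bsub>Oc g\<^esub> X = \<zero>\<^bsub>Oc g\<^esub>" by (rule rev_bexI[rotated])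
qed

lemma bm_closed:
  assumes "X \<in> carrier (Oc g)" "Y \<in> carrier (Oc h)"
  shows "bm X Y \<in> carrier (Oc (g \<otimes>\<^bsub>G\<^esub> h))"
proof -
  obtain x p1 p2 where x: "el x p1 p2" "g = fr p1 p2" "X = cl x p1 p2" using assms(1) by (rule OcE)
  obtain t y p3 where y: "t \<in> carrier P" "el y (p2 \<otimes> t) p3" "h = fr (p2 \<otimes> t) p3" "Y = cl y (p2 \<otimes> t) p3"
    using x(1) assms(2) by (rule cl_matchE)
  obtain x' where x': "el x' (p1 \<otimes> t) (p2 \<otimes> t)" "cl x p1 p2 = cl x' (p1 \<otimes> t) (p2 \<otimes> t)"
    using x(1) y(1) by (rule cl_shiftE)
  have g: "g = fr (p1 \<otimes> t) (p2 \<otimes> t)" unfolding x(2) by (rule fr_shift[OF elD(1,2)[OF x(1)] y(1), symmetric])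
  show ?thesis
    unfolding x(3) x'(2) y(4) bm_cl[OF x'(1) y(2)] g y(3) fr_mult[OF elD(1,2)[OF x'(1)] elD(2)[OF y(2)]]
    by (rule cl_Oc[OF el_compose[OF x'(1) y(2)]])
qed

lemma bm_add_left:
  assumes "X \<in> carrier (Oc g)" "X' \<in> carrier (Oc g)" "Y \<in> carrier (Oc h)"
  shows "bm (X \<oplus>\<^bsub>Oc g\<^esub> X') Y = bm X Y \<oplus>\<^bsub>Oc (g \<otimes>\<^bsub>G\<^esub> h)\<^esub> bm X' Y"
proof -
  obtain x1 x1' p1 p2 where x: "el x1 p1 p2" "el x1' p1 p2" "g = fr p1 p2" "X = cl x1 p1 p2" "X' = cl x1' p1 p2"
    using assms(1,2) by (rule Oc_match)
  obtain t y p3 where y: "t \<in> carrier P" "el y (p2 \<otimes> t) p3" "h = fr (p2 \<otimes> t) p3" "Y = cl y (p2 \<otimes> t) p3"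
    using x(1) assms(3) by (rule cl_matchE)
  obtain x where a: "el x (p1 \<otimes> t) (p2 \<otimes> t)" "cl x1 p1 p2 = cl x (p1 \<otimes> t) (p2 \<otimes> t)"
    using x(1) y(1) by (rule cl_shiftE)
  obtain x' where b: "el x' (p1 \<otimes> t) (p2 \<otimes> t)" "cl x1' p1 p2 = cl x' (p1 \<otimes> t) (p2 \<otimes> t)"
    using x(2) y(1) by (rule cl_shiftE)
  show ?thesis
    unfolding x(4,5) a(2) b(2) y(4) Oc_add[OF a(1) b(1)] bm_cl[OF a(1) y(2)] bm_cl[OF b(1) y(2)]
      bm_cl[OF el_add[OF a(1) b(1)] y(2)] Oc_add[OF el_compose[OF a(1) y(2)] el_compose[OF b(1) y(2)]]
      compose_add_left[OF elD(1,2)[OF a(1)] elD(2)[OF y(2)] elD(3)[OF a(1)] elD(3)[OF b(1)] elD(3)[OF y(2)]]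
    by (rule refl)
qed

lemma bm_add_right:
  assumes "X \<in> carrier (Oc g)" "Y \<in> carrier (Oc h)" "Y' \<in> carrier (Oc h)"
  shows "bm X (Y \<oplus>\<^bsub>Oc h\<^esub> Y') = bm X Y \<oplus>\<^bsub>Oc (g \<otimes>\<^bsub>G\<^esub> h)\<^esub> bm X Y'"
proof -
  obtain x1 p1 p2 where x: "el x1 p1 p2" "g = fr p1 p2" "X = cl x1 p1 p2" using assms(1) by (rule OcE)
  obtain y1 y1' q1 q2 where y: "el y1 q1 q2" "el y1' q1 q2" "h = fr q1 q2" "Y = cl y1 q1 q2" "Y' = cl y1' q1 q2"
    using assms(2,3) by (rule Oc_match)
  obtain t s where ts: "t \<in> carrier P" "s \<in> carrier P" "p2 \<otimes> t = q1 \<otimes> s"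
    using ore_common[OF elD(2)[OF x(1)] elD(1)[OF y(1)]] by blast
  obtain x where x': "el x (p1 \<otimes> t) (p2 \<otimes> t)" "cl x1 p1 p2 = cl x (p1 \<otimes> t) (p2 \<otimes> t)"
    using x(1) ts(1) by (rule cl_shiftE)
  note x'' = x'[unfolded ts(3)]
  obtain y where a: "el y (q1 \<otimes> s) (q2 \<otimes> s)" "cl y1 q1 q2 = cl y (q1 \<otimes> s) (q2 \<otimes> s)"
    using y(1) ts(2) by (rule cl_shiftE)
  obtain y' where b: "el y' (q1 \<otimes> s) (q2 \<otimes> s)" "cl y1' q1 q2 = cl y' (q1 \<otimes> s) (q2 \<otimes> s)"
    using y(2) ts(2) by (rule cl_shiftE)
  show ?thesis
    unfolding x(3) x''(2) y(4,5) a(2) b(2) Oc_add[OF a(1) b(1)] bm_cl[OF x''(1) a(1)] bm_cl[OF x''(1) b(1)]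
      bm_cl[OF x''(1) el_add[OF a(1) b(1)]] Oc_add[OF el_compose[OF x''(1) a(1)] el_compose[OF x''(1) b(1)]]
      compose_add_right[OF elD(1,2)[OF x''(1)] elD(2)[OF a(1)] elD(3)[OF x''(1)] elD(3)[OF a(1)] elD(3)[OF b(1)]]
    by (rule refl)
qed

lemma bm_assoc:
  assumes "X \<in> carrier (Oc g)" "Y \<in> carrier (Oc h)" "Z \<in> carrier (Oc k)"
  shows "bm (bm X Y) Z = bm X (bm Y Z)"
proof -
  obtain x p1 p2 where x: "el x p1 p2" "g = fr p1 p2" "X = cl x p1 p2" using assms(1) by (rule OcE)
  obtain t y p3 where y: "t \<in> carrier P" "el y (p2 \<otimes> t) p3" "h = fr (p2 \<otimes> t) p3" "Y = cl y (p2 \<otimes> t) p3"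
    using x(1) assms(2) by (rule cl_matchE)
  obtain s z p4 where z: "s \<in> carrier P" "el z (p3 \<otimes> s) p4" "k = fr (p3 \<otimes> s) p4" "Z = cl z (p3 \<otimes> s) p4"
    using y(2) assms(3) by (rule cl_matchE)
  obtain x1 where x1: "el x1 (p1 \<otimes> t) (p2 \<otimes> t)" "cl x p1 p2 = cl x1 (p1 \<otimes> t) (p2 \<otimes> t)"
    using x(1) y(1) by (rule cl_shiftE)
  obtain x2 where x2: "el x2 (p1 \<otimes> t \<otimes> s) (p2 \<otimes> t \<otimes> s)" "cl x1 (p1 \<otimes> t) (p2 \<otimes> t) = cl x2 (p1 \<otimes> t \<otimes> s) (p2 \<otimes> t \<otimes> s)"
    using x1(1) z(1) by (rule cl_shiftE)
  obtain y2 where y2: "el y2 (p2 \<otimes> t \<otimes> s) (p3 \<otimes> s)" "cl y (p2 \<otimes> t) p3 = cl y2 (p2 \<otimes> t \<otimes> s) (p3 \<otimes> s)"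
    using y(2) z(1) by (rule cl_shiftE)
  show ?thesis
    unfolding x(3) x1(2) x2(2) y(4) y2(2) z(4) bm_cl[OF x2(1) y2(1)] bm_cl[OF y2(1) z(2)]
      bm_cl[OF el_compose[OF x2(1) y2(1)] z(2)] bm_cl[OF x2(1) el_compose[OF y2(1) z(2)]]
      compose_assoc_H[OF elD(1,2,3)[OF z(2)]]
    by (rule refl)
qed

lemma bm_hom_left:
  assumes "Y \<in> carrier (Oc h)"
  shows "(\<lambda>X. bm X Y) \<in> add_hom (Oc g) (Oc (g \<otimes>\<^bsub>G\<^esub> h))"
  using assms by (intro add_homI bm_closed bm_add_left)

lemma bm_hom_right:
  assumes "X \<in> carrier (Oc g)"
  shows "bm X \<in> add_hom (Oc h) (Oc (g \<otimes>\<^bsub>G\<^esub> h))"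
  using assms by (intro add_homI bm_closed bm_add_right)

lemma bm_zero_left:
  assumes "g \<in> carrier G" "h \<in> carrier G" "Y \<in> carrier (Oc h)"
  shows "bm \<zero>\<^bsub>Oc g\<^esub> Y = \<zero>\<^bsub>Oc (g \<otimes>\<^bsub>G\<^esub> h)\<^esub>"
  using add_hom_zero[OF Oc_abelian Oc_abelian bm_hom_left] assms G_mult_closed by blast

lemma bm_zero_right:
  assumes "g \<in> carrier G" "h \<in> carrier G" "X \<in> carrier (Oc g)"
  shows "bm X \<zero>\<^bsub>Oc h\<^esub> = \<zero>\<^bsub>Oc (g \<otimes>\<^bsub>G\<^esub> h)\<^esub>"
  using add_hom_zero[OF Oc_abelian Oc_abelian bm_hom_right] assms G_mult_closed by blast

section \<open>The graded ring\<close>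

abbreviation "Orng \<equiv> O_ring P F \<mu>"

lemma Oc_group: "g \<in> carrier G \<Longrightarrow> group (add_monoid (Oc g))"
  by (rule abelian_group.a_group[OF Oc_abelian])

lemma Oc_zero_closed: "g \<in> carrier G \<Longrightarrow> \<zero>\<^bsub>Oc g\<^esub> \<in> carrier (Oc g)"
  by (rule abelian_groupE(2)[OF Oc_abelian])

definition supp :: "(('p \<times> 'p) set \<Rightarrow> (('a \<Rightarrow> 'a) \<times> 'p \<times> 'p) set) \<Rightarrow> ('p \<times> 'p) set set" where
  "supp \<xi> = {g \<in> carrier G. \<xi> g \<noteq> \<zero>\<^bsub>Oc g\<^esub>}"

lemma O_carrier: "carrier Orng = {\<xi> \<in> \<Pi>\<^sub>E g\<in>carrier G. carrier (Oc g). finite (supp \<xi>)}"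
  using carrier_sum_group[of "carrier G" "\<lambda>g. add_monoid (Oc g)"] Oc_group
  by (simp add: O_ring_def Let_def supp_def)

lemma O_add: "\<xi> \<oplus>\<^bsub>Orng\<^esub> \<eta> = (\<lambda>g\<in>carrier G. \<xi> g \<oplus>\<^bsub>Oc g\<^esub> \<eta> g)"
  by (simp add: O_ring_def Let_def)

lemma O_mult: "\<xi> \<otimes>\<^bsub>Orng\<^esub> \<eta> = (\<lambda>g\<in>carrier G. finsum (Oc g) (\<lambda>(h, k). bm (\<xi> h) (\<eta> k))
    {(h, k). h \<in> carrier G \<and> k \<in> carrier G \<and> h \<otimes>\<^bsub>G\<^esub> k = g \<and> \<xi> h \<noteq> \<zero>\<^bsub>Oc h\<^esub> \<and> \<eta> k \<noteq> \<zero>\<^bsub>Oc k\<^esub>})"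
  by (simp add: O_ring_def Let_def)

lemma O_mem: "\<xi> \<in> carrier Orng \<Longrightarrow> g \<in> carrier G \<Longrightarrow> \<xi> g \<in> carrier (Oc g)"
  by (auto simp: O_carrier)

lemma O_finite: "\<xi> \<in> carrier Orng \<Longrightarrow> finite (supp \<xi>)"
  by (simp add: O_carrier)

lemma supp_subset: "supp \<xi> \<subseteq> carrier G"
  by (auto simp: supp_def)

lemma O_eqI:
  assumes "\<xi> \<in> extensional (carrier G)" "\<eta> \<in> extensional (carrier G)" "\<And>g. g \<in> carrier G \<Longrightarrow> \<xi> g = \<eta> g"
  shows "\<xi> = \<eta>"
  using assms by (rule extensionalityI)

lemma O_ext: "\<xi> \<in> carrier Orng \<Longrightarrow> \<xi> \<in> extensional (carrier G)"
  by (auto simp: O_carrier PiE_def)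

lemma O_abelian: "abelian_group Orng"
proof (rule abelian_groupI)
  let ?S = "sum_group (carrier G) (\<lambda>g. add_monoid (Oc g))"
  have gS: "group ?S" by (rule sum_group) (rule Oc_group)
  interpret S: group ?S by (rule gS)
  have c: "carrier ?S = carrier Orng" by (simp add: O_ring_def Let_def)
  have m: "mult ?S = add Orng" by (simp add: O_ring_def Let_def)
  have o: "one ?S = zero Orng" by (simp add: O_ring_def Let_def)
  show "\<xi> \<oplus>\<^bsub>Orng\<^esub> \<eta> \<in> carrier Orng" if "\<xi> \<in> carrier Orng" "\<eta> \<in> carrier Orng" for \<xi> \<eta>
    using S.m_closed[of \<xi> \<eta>] that unfolding c m by blast
  show "\<zero>\<^bsub>Orng\<^esub> \<in> carrier Orng" using S.one_closed unfolding c o .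
  show "\<xi> \<oplus>\<^bsub>Orng\<^esub> \<eta> \<oplus>\<^bsub>Orng\<^esub> \<zeta> = \<xi> \<oplus>\<^bsub>Orng\<^esub> (\<eta> \<oplus>\<^bsub>Orng\<^esub> \<zeta>)"
    if "\<xi> \<in> carrier Orng" "\<eta> \<in> carrier Orng" "\<zeta> \<in> carrier Orng" for \<xi> \<eta> \<zeta>
    using S.m_assoc[of \<xi> \<eta> \<zeta>] that unfolding c m by blast
  show "\<xi> \<oplus>\<^bsub>Orng\<^esub> \<eta> = \<eta> \<oplus>\<^bsub>Orng\<^esub> \<xi>" if "\<xi> \<in> carrier Orng" "\<eta> \<in> carrier Orng" for \<xi> \<eta>
    unfolding O_add using that O_mem abelian_groupE(4)[OF Oc_abelian] by (intro restrict_ext) blast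
  show "\<zero>\<^bsub>Orng\<^esub> \<oplus>\<^bsub>Orng\<^esub> \<xi> = \<xi>" if "\<xi> \<in> carrier Orng" for \<xi>
    using S.l_one[of \<xi>] that unfolding c m o by blast
  show "\<exists>\<eta>\<in>carrier Orng. \<eta> \<oplus>\<^bsub>Orng\<^esub> \<xi> = \<zero>\<^bsub>Orng\<^esub>" if "\<xi> \<in> carrier Orng" for \<xi>
    using S.l_inv_ex[of \<xi>] that unfolding c m o by blast
qed

text \<open>The index set in the definition of the product depends on where the factors vanish.
  Enlarging it to a finite box only adds zero terms, so that several products can be written as sums
  over the same set.\<close>

lemma O_mult_eq:
  assumes "\<xi> \<in> carrier Orng" "\<eta> \<in> carrier Orng" "finite B" "finite C" "supp \<xi> \<subseteq> B" "supp \<eta> \<subseteq> C"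
    "B \<subseteq> carrier G" "C \<subseteq> carrier G" "g \<in> carrier G"
  shows "(\<xi> \<otimes>\<^bsub>Orng\<^esub> \<eta>) g = finsum (Oc g) (\<lambda>(h, k). bm (\<xi> h) (\<eta> k)) {(h, k) \<in> B \<times> C. h \<otimes>\<^bsub>G\<^esub> k = g}"
proof -
  interpret Og: abelian_group "Oc g" by (rule Oc_abelian) fact
  let ?S = "{(h, k). h \<in> carrier G \<and> k \<in> carrier G \<and> h \<otimes>\<^bsub>G\<^esub> k = g \<and> \<xi> h \<noteq> \<zero>\<^bsub>Oc h\<^esub> \<and> \<eta> k \<noteq> \<zero>\<^bsub>Oc k\<^esub>}"
  let ?T = "{(h, k) \<in> B \<times> C. h \<otimes>\<^bsub>G\<^esub> k = g}"
  have "finsum (Oc g) (\<lambda>(h, k). bm (\<xi> h) (\<eta> k)) ?S = finsum (Oc g) (\<lambda>(h, k). bm (\<xi> h) (\<eta> k)) ?T"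
  proof (rule Og.add.finprod_mono_neutral_cong_left)
    show "finite ?T" using assms(3,4) by (rule_tac finite_subset[of _ "B \<times> C"]) auto
    show "?S \<subseteq> ?T" using assms(5,6) by (auto simp: supp_def)
    show "(\<lambda>(h, k). bm (\<xi> h) (\<eta> k)) \<in> ?T \<rightarrow> carrier (Oc g)"
      using assms(7,8) bm_closed[OF O_mem[OF assms(1)] O_mem[OF assms(2)]] by auto
    fix p assume "p \<in> ?T - ?S"
    then obtain h k where p: "p = (h, k)" "h \<in> carrier G" "k \<in> carrier G" "h \<otimes>\<^bsub>G\<^esub> k = g"
      "\<xi> h = \<zero>\<^bsub>Oc h\<^esub> \<or> \<eta> k = \<zero>\<^bsub>Oc k\<^esub>"
      using assms(7,8) by auto
    then show "(case p of (h, k) \<Rightarrow> bm (\<xi> h) (\<eta> k)) = \<zero>\<^bsub>Oc g\<^esub>"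
      using bm_zero_left[OF p(2,3) O_mem[OF assms(2) p(3)]] bm_zero_right[OF p(2,3) O_mem[OF assms(1) p(2)]] by auto
  qed simp
  then show ?thesis using assms(9) by (simp add: O_mult)
qed

lemma O_mult_closed:
  assumes "\<xi> \<in> carrier Orng" "\<eta> \<in> carrier Orng"
  shows "\<xi> \<otimes>\<^bsub>Orng\<^esub> \<eta> \<in> carrier Orng"
proof -
  note eq = O_mult_eq[OF assms O_finite[OF assms(1)] O_finite[OF assms(2)] order_refl order_refl supp_subset supp_subset]
  have "(\<xi> \<otimes>\<^bsub>Orng\<^esub> \<eta>) g \<in> carrier (Oc g)" if "g \<in> carrier G" for g
    unfolding eq[OF that]
    using bm_closed[OF O_mem[OF assms(1)] O_mem[OF assms(2)]] subsetD[OF supp_subset]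
    by (intro abelian_monoid.finsum_closed[OF abelian_group.axioms(1)[OF Oc_abelian[OF that]]]) auto
  moreover have "supp (\<xi> \<otimes>\<^bsub>Orng\<^esub> \<eta>) \<subseteq> (\<lambda>(h, k). h \<otimes>\<^bsub>G\<^esub> k) ` (supp \<xi> \<times> supp \<eta>)"
  proof
    fix g assume g: "g \<in> supp (\<xi> \<otimes>\<^bsub>Orng\<^esub> \<eta>)"
    then have gG: "g \<in> carrier G" and nz: "(\<xi> \<otimes>\<^bsub>Orng\<^esub> \<eta>) g \<noteq> \<zero>\<^bsub>Oc g\<^esub>" by (auto simp: supp_def)
    interpret Og: abelian_group "Oc g" by (rule Oc_abelian) fact
    have "{(h, k) \<in> supp \<xi> \<times> supp \<eta>. h \<otimes>\<^bsub>G\<^esub> k = g} \<noteq> {}"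
    proof
      assume "{(h, k) \<in> supp \<xi> \<times> supp \<eta>. h \<otimes>\<^bsub>G\<^esub> k = g} = {}"
      then have "(\<xi> \<otimes>\<^bsub>Orng\<^esub> \<eta>) g = \<zero>\<^bsub>Oc g\<^esub>" unfolding eq[OF gG] by (simp only: Og.finsum_empty)
      then show False using nz by contradiction
    qed
    then show "g \<in> (\<lambda>(h, k). h \<otimes>\<^bsub>G\<^esub> k) ` (supp \<xi> \<times> supp \<eta>)" by auto
  qed
  then have "finite (supp (\<xi> \<otimes>\<^bsub>Orng\<^esub> \<eta>))"
    by (rule finite_subset) (simp add: O_finite assms)
  moreover have "\<xi> \<otimes>\<^bsub>Orng\<^esub> \<eta> \<in> extensional (carrier G)" by (simp add: O_mult)
  ultimately show ?thesis by (auto simp: O_carrier PiE_iff)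
qed

lemma supp_add: "\<xi> \<in> carrier Orng \<Longrightarrow> \<eta> \<in> carrier Orng \<Longrightarrow> supp (\<xi> \<oplus>\<^bsub>Orng\<^esub> \<eta>) \<subseteq> supp \<xi> \<union> supp \<eta>"
  using abelian_groupE(5)[OF Oc_abelian] Oc_zero_closed by (auto simp: supp_def O_add)

text \<open>A common form of both distributive laws: in each of them one factor stays constant and
  the other is a sum. All supports are merged into one index set so that the sums can be added term
  by term.\<close>

lemma O_mult_add:
  assumes "\<xi> \<in> carrier Orng" "\<xi>' \<in> carrier Orng" "\<xi>'' \<in> carrier Orng"
    and "\<eta> \<in> carrier Orng" "\<eta>' \<in> carrier Orng" "\<eta>'' \<in> carrier Orng"
    and bm_add: "\<And>h k. h \<in> carrier G \<Longrightarrow> k \<in> carrier G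
      \<Longrightarrow> bm (\<xi>'' h) (\<eta>'' k) = bm (\<xi> h) (\<eta> k) \<oplus>\<^bsub>Oc (h \<otimes>\<^bsub>G\<^esub> k)\<^esub> bm (\<xi>' h) (\<eta>' k)"
  shows "\<xi>'' \<otimes>\<^bsub>Orng\<^esub> \<eta>'' = \<xi> \<otimes>\<^bsub>Orng\<^esub> \<eta> \<oplus>\<^bsub>Orng\<^esub> \<xi>' \<otimes>\<^bsub>Orng\<^esub> \<eta>'"
proof (rule O_eqI)
  show "\<xi>'' \<otimes>\<^bsub>Orng\<^esub> \<eta>'' \<in> extensional (carrier G)" by (simp add: O_mult)
  show "\<xi> \<otimes>\<^bsub>Orng\<^esub> \<eta> \<oplus>\<^bsub>Orng\<^esub> \<xi>' \<otimes>\<^bsub>Orng\<^esub> \<eta>' \<in> extensional (carrier G)" by (simp add: O_add)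
  fix g assume g: "g \<in> carrier G"
  interpret Og: abelian_group "Oc g" by (rule Oc_abelian) fact
  let ?B = "supp \<xi> \<union> supp \<xi>' \<union> supp \<xi>''" and ?C = "supp \<eta> \<union> supp \<eta>' \<union> supp \<eta>''"
  let ?T = "{(h, k) \<in> ?B \<times> ?C. h \<otimes>\<^bsub>G\<^esub> k = g}"
  have B: "finite ?B" "finite ?C" "?B \<subseteq> carrier G" "?C \<subseteq> carrier G"
    using assms(1-6)[THEN O_finite] by (simp_all add: supp_subset)
  have mem: "h \<in> carrier G" "k \<in> carrier G" "h \<otimes>\<^bsub>G\<^esub> k = g" if "(h, k) \<in> ?T" for h k
    using that subsetD[OF B(3), of h] subsetD[OF B(4), of k] by simp_all
  have c: "(\<lambda>(h, k). bm (\<sigma> h) (\<tau> k)) \<in> ?T \<rightarrow> carrier (Oc g)"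
    if z: "\<sigma> \<in> carrier Orng" "\<tau> \<in> carrier Orng" for \<sigma> \<tau>
  proof (rule Pi_I)
    fix p assume "p \<in> ?T"
    then obtain h k where p: "p = (h, k)" "(h, k) \<in> ?T" by (cases p) simp
    show "(case p of (h, k) \<Rightarrow> bm (\<sigma> h) (\<tau> k)) \<in> carrier (Oc g)"
      using bm_closed[OF O_mem[OF z(1) mem(1)[OF p(2)]] O_mem[OF z(2) mem(2)[OF p(2)]]] mem(3)[OF p(2)]
      by (simp add: p(1))
  qed
  have eq: "(\<sigma> \<otimes>\<^bsub>Orng\<^esub> \<tau>) g = finsum (Oc g) (\<lambda>(h, k). bm (\<sigma> h) (\<tau> k)) ?T"
    if "\<sigma> \<in> carrier Orng" "\<tau> \<in> carrier Orng" "supp \<sigma> \<subseteq> ?B" "supp \<tau> \<subseteq> ?C" for \<sigma> \<tau>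
    using that(1,2) B(1,2) that(3,4) B(3,4) g by (rule O_mult_eq)
  have "(\<xi>'' \<otimes>\<^bsub>Orng\<^esub> \<eta>'') g = finsum (Oc g) (\<lambda>(h, k). bm (\<xi>'' h) (\<eta>'' k)) ?T"
    by (rule eq[OF assms(3,6)]) auto
  also have "\<dots> = finsum (Oc g) (\<lambda>p. (\<lambda>(h, k). bm (\<xi> h) (\<eta> k)) p \<oplus>\<^bsub>Oc g\<^esub> (\<lambda>(h, k). bm (\<xi>' h) (\<eta>' k)) p) ?T"
  proof (rule Og.finsum_cong'[OF refl])
    show "(\<lambda>p. (\<lambda>(h, k). bm (\<xi> h) (\<eta> k)) p \<oplus>\<^bsub>Oc g\<^esub> (\<lambda>(h, k). bm (\<xi>' h) (\<eta>' k)) p) \<in> ?T \<rightarrow> carrier (Oc g)"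
      using c[OF assms(1,4)] c[OF assms(2,5)] by (intro Pi_I Og.a_closed) (simp_all only: Pi_iff)
    fix p assume "p \<in> ?T"
    then obtain h k where p: "p = (h, k)" "(h, k) \<in> ?T" by (cases p) simp
    show "(\<lambda>(h, k). bm (\<xi>'' h) (\<eta>'' k)) p
        = (\<lambda>(h, k). bm (\<xi> h) (\<eta> k)) p \<oplus>\<^bsub>Oc g\<^esub> (\<lambda>(h, k). bm (\<xi>' h) (\<eta>' k)) p"
      using bm_add[OF mem(1,2)[OF p(2)]] mem(3)[OF p(2)] by (simp add: p(1))
  qed
  also have "\<dots> = finsum (Oc g) (\<lambda>(h, k). bm (\<xi> h) (\<eta> k)) ?T \<oplus>\<^bsub>Oc g\<^esub> finsum (Oc g) (\<lambda>(h, k). bm (\<xi>' h) (\<eta>' k)) ?T"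
    using c[OF assms(1,4)] c[OF assms(2,5)] by (rule Og.finsum_addf)
  also have "finsum (Oc g) (\<lambda>(h, k). bm (\<xi> h) (\<eta> k)) ?T = (\<xi> \<otimes>\<^bsub>Orng\<^esub> \<eta>) g"
    by (rule eq[OF assms(1,4), symmetric]) auto
  also have "finsum (Oc g) (\<lambda>(h, k). bm (\<xi>' h) (\<eta>' k)) ?T = (\<xi>' \<otimes>\<^bsub>Orng\<^esub> \<eta>') g"
    by (rule eq[OF assms(2,5), symmetric]) auto
  finally show "(\<xi>'' \<otimes>\<^bsub>Orng\<^esub> \<eta>'') g = (\<xi> \<otimes>\<^bsub>Orng\<^esub> \<eta> \<oplus>\<^bsub>Orng\<^esub> \<xi>' \<otimes>\<^bsub>Orng\<^esub> \<eta>') g"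
    unfolding O_add[of "\<xi> \<otimes>\<^bsub>Orng\<^esub> \<eta>"] using g by (simp only: restrict_apply')
qed

lemma O_distr_left:
  assumes "\<xi> \<in> carrier Orng" "\<xi>' \<in> carrier Orng" "\<eta> \<in> carrier Orng"
  shows "(\<xi> \<oplus>\<^bsub>Orng\<^esub> \<xi>') \<otimes>\<^bsub>Orng\<^esub> \<eta> = \<xi> \<otimes>\<^bsub>Orng\<^esub> \<eta> \<oplus>\<^bsub>Orng\<^esub> \<xi>' \<otimes>\<^bsub>Orng\<^esub> \<eta>"
  using assms(1,2) abelian_groupE(1)[OF O_abelian assms(1,2)] assms(3,3,3)
proof (rule O_mult_add)
  fix h k assume "h \<in> carrier G" "k \<in> carrier G"
  then show "bm ((\<xi> \<oplus>\<^bsub>Orng\<^esub> \<xi>') h) (\<eta> k) = bm (\<xi> h) (\<eta> k) \<oplus>\<^bsub>Oc (h \<otimes>\<^bsub>G\<^esub> k)\<^esub> bm (\<xi>' h) (\<eta> k)"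
    using bm_add_left[OF assms[THEN O_mem]] by (simp add: O_add)
qed

lemma O_distr_right:
  assumes "\<eta> \<in> carrier Orng" "\<eta>' \<in> carrier Orng" "\<xi> \<in> carrier Orng"
  shows "\<xi> \<otimes>\<^bsub>Orng\<^esub> (\<eta> \<oplus>\<^bsub>Orng\<^esub> \<eta>') = \<xi> \<otimes>\<^bsub>Orng\<^esub> \<eta> \<oplus>\<^bsub>Orng\<^esub> \<xi> \<otimes>\<^bsub>Orng\<^esub> \<eta>'"
  using assms(3,3,3,1,2) abelian_groupE(1)[OF O_abelian assms(1,2)]
proof (rule O_mult_add)
  fix h k assume "h \<in> carrier G" "k \<in> carrier G"
  then show "bm (\<xi> h) ((\<eta> \<oplus>\<^bsub>Orng\<^esub> \<eta>') k) = bm (\<xi> h) (\<eta> k) \<oplus>\<^bsub>Oc (h \<otimes>\<^bsub>G\<^esub> k)\<^esub> bm (\<xi> h) (\<eta>' k)"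
    using bm_add_right[OF assms(3,1,2)[THEN O_mem]] by (simp add: O_add)
qed

section \<open>Homogeneous elements, associativity and local units\<close>

definition single :: "('p \<times> 'p) set \<Rightarrow> (('a \<Rightarrow> 'a) \<times> 'p \<times> 'p) set
    \<Rightarrow> ('p \<times> 'p) set \<Rightarrow> (('a \<Rightarrow> 'a) \<times> 'p \<times> 'p) set" where
  "single g X = (\<lambda>h\<in>carrier G. if h = g then X else \<zero>\<^bsub>Oc h\<^esub>)"

lemma single_supp: "supp (single g X) \<subseteq> {g}"
  by (auto simp: supp_def single_def)

lemma single_closed:
  assumes "g \<in> carrier G" "X \<in> carrier (Oc g)"
  shows "single g X \<in> carrier Orng"
  unfolding O_carrier
proof (rule CollectI, rule conjI)
  show "single g X \<in> (\<Pi>\<^sub>E g\<in>carrier G. carrier (Oc g))"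
    using assms by (auto simp: single_def Oc_zero_closed)
  show "finite (supp (single g X))" by (rule finite_subset[OF single_supp]) simp
qed

lemma single_add:
  assumes "g \<in> carrier G" "X \<in> carrier (Oc g)" "Y \<in> carrier (Oc g)"
  shows "single g (X \<oplus>\<^bsub>Oc g\<^esub> Y) = single g X \<oplus>\<^bsub>Orng\<^esub> single g Y"
proof (rule O_eqI)
  fix h assume h: "h \<in> carrier G"
  show "single g (X \<oplus>\<^bsub>Oc g\<^esub> Y) h = (single g X \<oplus>\<^bsub>Orng\<^esub> single g Y) h"
    using h abelian_groupE(5)[OF Oc_abelian[OF h] Oc_zero_closed[OF h]]
    by (cases "h = g") (simp_all add: single_def O_add)
qed (simp_all add: single_def O_add)

lemma single_mult:
  assumes "g \<in> carrier G" "X \<in> carrier (Oc g)" "h \<in> carrier G" "Y \<in> carrier (Oc h)"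
  shows "single g X \<otimes>\<^bsub>Orng\<^esub> single h Y = single (g \<otimes>\<^bsub>G\<^esub> h) (bm X Y)"
proof (rule O_eqI)
  show "single g X \<otimes>\<^bsub>Orng\<^esub> single h Y \<in> extensional (carrier G)" by (simp add: O_mult)
  show "single (g \<otimes>\<^bsub>G\<^esub> h) (bm X Y) \<in> extensional (carrier G)" by (simp add: single_def)
  fix k assume k: "k \<in> carrier G"
  interpret Ok: abelian_group "Oc k" by (rule Oc_abelian) fact
  have eq: "(single g X \<otimes>\<^bsub>Orng\<^esub> single h Y) k
      = finsum (Oc k) (\<lambda>(a, b). bm (single g X a) (single h Y b)) {(a, b) \<in> {g} \<times> {h}. a \<otimes>\<^bsub>G\<^esub> b = k}"
    using assms k single_supp by (intro O_mult_eq single_closed) auto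
  show "(single g X \<otimes>\<^bsub>Orng\<^esub> single h Y) k = single (g \<otimes>\<^bsub>G\<^esub> h) (bm X Y) k"
  proof (cases "g \<otimes>\<^bsub>G\<^esub> h = k")
    case True
    then have "{(a, b) \<in> {g} \<times> {h}. a \<otimes>\<^bsub>G\<^esub> b = k} = {(g, h)}" by auto
    then show ?thesis
      unfolding eq using True bm_closed[OF assms(2,4)] assms k by (simp add: single_def Ok.finsum_insert)
  next
    case False
    then have E: "{(a, b) \<in> {g} \<times> {h}. a \<otimes>\<^bsub>G\<^esub> b = k} = {}" by auto
    show ?thesis
      unfolding eq E Ok.finsum_empty using False[symmetric] k by (simp add: single_def)
  qed
qed

text \<open>Induction on a finite set containing the support: splitting off the component at g
  leaves an element supported in the rest.\<close>

lemma O_induct [consumes 1, case_names single add]: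
  assumes "\<xi> \<in> carrier Orng"
    and single: "\<And>g X. g \<in> carrier G \<Longrightarrow> X \<in> carrier (Oc g) \<Longrightarrow> Q (single g X)"
    and add: "\<And>\<xi> \<eta>. \<xi> \<in> carrier Orng \<Longrightarrow> \<eta> \<in> carrier Orng \<Longrightarrow> Q \<xi> \<Longrightarrow> Q \<eta> \<Longrightarrow> Q (\<xi> \<oplus>\<^bsub>Orng\<^esub> \<eta>)"
  shows "Q \<xi>"
proof -
  have "finite B \<Longrightarrow> \<xi> \<in> carrier Orng \<Longrightarrow> supp \<xi> \<subseteq> B \<Longrightarrow> Q \<xi>" for B \<xi>
  proof (induction B arbitrary: \<xi> rule: finite_induct)
    case empty
    have g: "fr \<one> \<one> \<in> carrier G" by (simp add: fr_closed)
    \<comment> \<open>The principle has no case for zero, so zero is presented as a homogeneous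
      element of the identity degree.\<close>
    have "\<xi> = single (fr \<one> \<one>) \<zero>\<^bsub>Oc (fr \<one> \<one>)\<^esub>"
      using empty O_ext by (intro O_eqI) (auto simp: single_def supp_def)
    then show ?case using single[OF g Oc_zero_closed[OF g]] by simp
  next
    case (insert g B)
    show ?case
    proof (cases "g \<in> carrier G")
      case False
      then have "supp \<xi> \<subseteq> B" using insert.prems supp_subset by blast
      then show ?thesis using insert by blast
    next
      case True
      define \<eta> where "\<eta> = (\<lambda>h\<in>carrier G. if h = g then \<zero>\<^bsub>Oc g\<^esub> else \<xi> h)"
      have supp: "supp \<eta> \<subseteq> B" using insert.prems by (auto simp: supp_def \<eta>_def)
      then have \<eta>: "\<eta> \<in> carrier Orng"
        using finite_subset[OF supp insert.hyps(1)] O_mem[OF insert.prems(1)] Oc_zero_closed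
        by (auto simp: O_carrier \<eta>_def PiE_iff)
      have "\<xi> = \<eta> \<oplus>\<^bsub>Orng\<^esub> single g (\<xi> g)"
      proof (rule O_eqI[OF O_ext[OF insert.prems(1)]])
        fix h assume h: "h \<in> carrier G"
        show "\<xi> h = (\<eta> \<oplus>\<^bsub>Orng\<^esub> single g (\<xi> g)) h"
          using h abelian_groupE(5)[OF Oc_abelian[OF h] O_mem[OF insert.prems(1) h]]
            abelian_monoid.r_zero[OF abelian_group.axioms(1)[OF Oc_abelian[OF h]] O_mem[OF insert.prems(1) h]]
          by (cases "h = g") (simp_all add: O_add \<eta>_def single_def)
      qed (simp add: O_add)
      then show ?thesis
        using add[OF \<eta> single_closed[OF True O_mem[OF insert.prems(1) True]] insert.IH[OF \<eta> supp]
            single[OF True O_mem[OF insert.prems(1) True]]] by simp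
    qed
  qed
  then show ?thesis using assms(1) O_finite by blast
qed

text \<open>Additivity in each factor reduces the claim to homogeneous elements, which avoids
  rearranging iterated sums over pairs in the group.\<close>

lemma O_mult_assoc:
  assumes "\<xi> \<in> carrier Orng" "\<eta> \<in> carrier Orng" "\<zeta> \<in> carrier Orng"
  shows "\<xi> \<otimes>\<^bsub>Orng\<^esub> \<eta> \<otimes>\<^bsub>Orng\<^esub> \<zeta> = \<xi> \<otimes>\<^bsub>Orng\<^esub> (\<eta> \<otimes>\<^bsub>Orng\<^esub> \<zeta>)"
  using assms(1)
proof (induction rule: O_induct)
  case (single g X)
  note gX = single
  show ?case using assms(2)
  proof (induction rule: O_induct)
    case (single h Y)
    note hY = single
    show ?case using assms(3)
    proof (induction rule: O_induct)
      case (single k Z)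
      show ?case
        using gX hY single bm_closed
        by (simp add: single_mult G_mult_closed G_mult_assoc bm_assoc)
    next
      case (add \<xi> \<eta>)
      then show ?case
        using single_closed[OF gX] single_closed[OF hY] by (simp add: O_distr_right O_mult_closed)
    qed
  next
    case (add \<xi> \<eta>)
    then show ?case
      using single_closed[OF gX] assms(3) by (simp add: O_distr_right O_distr_left O_mult_closed)
  qed
next
  case (add \<xi> \<eta>)
  then show ?case
    using assms(2,3) by (simp add: O_distr_left O_mult_closed)
qed

lemma O_nonunital_ring: "nonunital_ring Orng"
  by (intro nonunital_ring.intro nonunital_ring_axioms.intro O_abelian O_mult_closed O_mult_assoc
      O_distr_left O_distr_right)

text \<open>This is \<kappa>_1(e), compare \<open>canonical_eq\<close>. These elements, for
  idempotents e of F_1, will be the local units of the ring.\<close>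

definition unit_at :: "'a \<Rightarrow> ('p \<times> 'p) set \<Rightarrow> (('a \<Rightarrow> 'a) \<times> 'p \<times> 'p) set" where
  "unit_at e = single (fr \<one> \<one>) (cl (lm \<one> e) \<one> \<one>)"

lemma lm_el: "p \<in> carrier P \<Longrightarrow> x \<in> carrier (F p) \<Longrightarrow> el (lm p x) p \<one>"
  by (simp add: el_def lm_H)

text \<open>The shift along p of multiplication by e on F_1 is multiplication by e on F_p. So
  \<kappa>_1(e) has a representative at every (p, p), which composes with maps from or into
  F_p.\<close>

lemma unit_cl:
  assumes "p \<in> carrier P" "e \<in> carrier A"
  shows "el (\<lambda>y\<in>carrier (F p). e \<odot>\<^bsub>F p\<^esub> y) p p"
    "cl (lm \<one> e) \<one> \<one> = cl (\<lambda>y\<in>carrier (F p). e \<odot>\<^bsub>F p\<^esub> y) p p"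
proof -
  have "sh \<one> \<one> p (lm \<one> e) = (\<lambda>y\<in>carrier (F p). dmul \<one> p e y)"
    using shift_lm[OF one_closed assms] .
  also have "\<dots> = (\<lambda>y\<in>carrier (F p). e \<odot>\<^bsub>F p\<^esub> y)"
    using assms by (intro restrict_ext) (simp add: dmul_one_left)
  finally have *: "sh \<one> \<one> p (lm \<one> e) = (\<lambda>y\<in>carrier (F p). e \<odot>\<^bsub>F p\<^esub> y)" .
  note L = lm_el[OF one_closed assms(2)]
  show "el (\<lambda>y\<in>carrier (F p). e \<odot>\<^bsub>F p\<^esub> y) p p"
    using el_shift[OF L assms(1)] assms(1) unfolding * by simp
  show "cl (lm \<one> e) \<one> \<one> = cl (\<lambda>y\<in>carrier (F p). e \<odot>\<^bsub>F p\<^esub> y) p p"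
    using cl_shift[OF L assms(1)] assms(1) unfolding * by simp
qed

lemma fr_diag: "p \<in> carrier P \<Longrightarrow> fr p p = fr \<one> \<one>"
  using fr_shift[of \<one> \<one> p] by simp

lemma unit_at_closed: "e \<in> carrier A \<Longrightarrow> unit_at e \<in> carrier Orng"
  unfolding unit_at_def by (intro single_closed fr_closed cl_Oc lm_el one_closed)

text \<open>Multiplication from the left uses the representative of \<kappa>_1(e) at (p1, p1), from
  the right the one at (p2, p2).\<close>

lemma unit_at_single:
  assumes "el x p1 p2" "e \<in> carrier A"
  shows "(\<And>z. z \<in> carrier (F p2) \<Longrightarrow> e \<odot>\<^bsub>F p1\<^esub> x z = x z)
      \<Longrightarrow> unit_at e \<otimes>\<^bsub>Orng\<^esub> single (fr p1 p2) (cl x p1 p2) = single (fr p1 p2) (cl x p1 p2)"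
    and "(\<And>z. z \<in> carrier (F p2) \<Longrightarrow> x (e \<odot>\<^bsub>F p2\<^esub> z) = x z)
      \<Longrightarrow> single (fr p1 p2) (cl x p1 p2) \<otimes>\<^bsub>Orng\<^esub> unit_at e = single (fr p1 p2) (cl x p1 p2)"
proof -
  note p = elD[OF assms(1)]
  have c: "fr \<one> \<one> \<in> carrier G" "fr p1 p2 \<in> carrier G" using p fr_closed by simp_all
  note m = single_mult[OF c(1) cl_Oc[OF lm_el[OF one_closed assms(2)]] c(2) cl_Oc[OF assms(1)]]
    single_mult[OF c(2) cl_Oc[OF assms(1)] c(1) cl_Oc[OF lm_el[OF one_closed assms(2)]]]
  have f: "fr \<one> \<one> \<otimes>\<^bsub>G\<^esub> fr p1 p2 = fr p1 p2" "fr p1 p2 \<otimes>\<^bsub>G\<^esub> fr \<one> \<one> = fr p1 p2"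
    using fr_mult[OF p(1,1,2)] fr_mult[OF p(1,2,2)] unfolding fr_diag[OF p(1)] fr_diag[OF p(2)] .
  note u1 = unit_cl[OF p(1) assms(2)] and u2 = unit_cl[OF p(2) assms(2)]
  show "unit_at e \<otimes>\<^bsub>Orng\<^esub> single (fr p1 p2) (cl x p1 p2) = single (fr p1 p2) (cl x p1 p2)"
    if h: "\<And>z. z \<in> carrier (F p2) \<Longrightarrow> e \<odot>\<^bsub>F p1\<^esub> x z = x z"
  proof -
    have "compose (carrier (F p2)) (\<lambda>y\<in>carrier (F p1). e \<odot>\<^bsub>F p1\<^esub> y) x = x"
    proof (rule H_eqI[OF p(1,2) elD(3)[OF el_compose[OF u1(1) assms(1)]] p(3)])
      fix z assume z: "z \<in> carrier (F p2)"
      show "compose (carrier (F p2)) (\<lambda>y\<in>carrier (F p1). e \<odot>\<^bsub>F p1\<^esub> y) x z = x z"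
        using h[OF z] H_closed[OF p z] z by (simp add: compose_eq)
    qed
    then show ?thesis
      unfolding unit_at_def m f unfolding u1(2) bm_cl[OF u1(1) assms(1)] by simp
  qed
  show "single (fr p1 p2) (cl x p1 p2) \<otimes>\<^bsub>Orng\<^esub> unit_at e = single (fr p1 p2) (cl x p1 p2)"
    if h: "\<And>z. z \<in> carrier (F p2) \<Longrightarrow> x (e \<odot>\<^bsub>F p2\<^esub> z) = x z"
  proof -
    have "compose (carrier (F p2)) x (\<lambda>y\<in>carrier (F p2). e \<odot>\<^bsub>F p2\<^esub> y) = x"
    proof (rule H_eqI[OF p(1,2) elD(3)[OF el_compose[OF assms(1) u2(1)]] p(3)])
      fix z assume z: "z \<in> carrier (F p2)"
      show "compose (carrier (F p2)) x (\<lambda>y\<in>carrier (F p2). e \<odot>\<^bsub>F p2\<^esub> y) z = x z"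
        using h[OF z] z by (simp add: compose_eq)
    qed
    then show ?thesis
      unfolding unit_at_def m f unfolding u2(2) bm_cl[OF assms(1) u2(1)] by simp
  qed
qed

text \<open>For homogeneous elements, right units come from the unit condition \<open>H_unit\<close>
  and left units from finite generation through \<open>H_left_unit\<close>. Since both hold for all
  large e, they pass to sums.\<close>

lemma O_unit:
  assumes "\<xi> \<in> carrier Orng"
  shows "for_large A (\<lambda>e. unit_at e \<otimes>\<^bsub>Orng\<^esub> \<xi> = \<xi> \<and> \<xi> \<otimes>\<^bsub>Orng\<^esub> unit_at e = \<xi>)"
  using assms
proof (induction rule: O_induct)
  case (single g X)
  obtain x p1 p2 where x: "el x p1 p2" "g = fr p1 p2" "X = cl x p1 p2" using single(2) by (rule OcE)
  show ?case
    using A.for_large_conj[OF H_left_unit[OF elD[OF x(1)]] H_unit[OF elD[OF x(1)]]]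
    by (rule A.for_large_mono) (simp add: x(2,3) unit_at_single[OF x(1)])
next
  case (add \<xi> \<eta>)
  show ?case
    using A.for_large_conj[OF add(3,4)]
    by (rule A.for_large_mono) (simp add: O_distr_left O_distr_right unit_at_closed add(1,2))
qed

lemma unit_at_idem:
  assumes "e \<in> idempotents A"
  shows "unit_at e \<in> idempotents Orng"
proof -
  have e: "e \<in> carrier A" "e \<otimes>\<^bsub>A\<^esub> e = e" using assms by (auto simp: idempotents_def)
  have "e \<odot>\<^bsub>A\<^esub> lm \<one> e z = lm \<one> e z" if "z \<in> carrier A" for z
    using that e A.m_assoc[OF e(1,1) that] by (simp add: lm_def base_ract base_lact A.m_closed)
  then have "unit_at e \<otimes>\<^bsub>Orng\<^esub> unit_at e = unit_at e"
    using unit_at_single(1)[OF lm_el[OF one_closed e(1)] e(1)] by (simp add: unit_at_def)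
  then show ?thesis using unit_at_closed[OF e(1)] by (simp add: idempotents_def)
qed

lemma O_local_units: "ring_with_local_units Orng"
proof (intro ring_with_local_units.intro O_nonunital_ring ring_with_local_units_axioms.intro)
  fix X assume X: "finite X" "X \<subseteq> carrier Orng"
  have "for_large A (\<lambda>e. \<forall>\<xi>\<in>X. unit_at e \<otimes>\<^bsub>Orng\<^esub> \<xi> = \<xi> \<and> \<xi> \<otimes>\<^bsub>Orng\<^esub> unit_at e = \<xi>)"
    using X(1) O_unit[OF subsetD[OF X(2)]] by (rule A.for_large_finite)
  then obtain e where "e \<in> idempotents A" "\<forall>\<xi>\<in>X. unit_at e \<otimes>\<^bsub>Orng\<^esub> \<xi> = \<xi> \<and> \<xi> \<otimes>\<^bsub>Orng\<^esub> unit_at e = \<xi>"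
    by (rule A.for_largeE)
  then show "\<exists>e\<in>idempotents Orng. \<forall>\<xi>\<in>X. e \<otimes>\<^bsub>Orng\<^esub> \<xi> = \<xi> \<and> \<xi> \<otimes>\<^bsub>Orng\<^esub> e = \<xi>"
    using unit_at_idem by blast
qed

section \<open>The canonical covariant representation\<close>

abbreviation "\<kappa> \<equiv> O_canonical P F \<mu>"

lemma canonical_eq:
  "p \<in> carrier P \<Longrightarrow> x \<in> carrier (F p) \<Longrightarrow> \<kappa> p x = single (fr p \<one>) (cl (lm p x) p \<one>)"
  by (simp add: O_canonical_def single_def lm_def)

lemma lm_Oc: "p \<in> carrier P \<Longrightarrow> x \<in> carrier (F p) \<Longrightarrow> cl (lm p x) p \<one> \<in> carrier (Oc (fr p \<one>))"
  by (rule cl_Oc[OF lm_el])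

lemma canonical_closed: "p \<in> carrier P \<Longrightarrow> x \<in> carrier (F p) \<Longrightarrow> \<kappa> p x \<in> carrier Orng"
  by (simp add: canonical_eq single_closed fr_closed lm_Oc)

lemma canonical_add_hom:
  assumes p: "p \<in> carrier P"
  shows "\<kappa> p \<in> add_hom (F p) Orng"
proof (rule add_homI)
  fix x y assume xy: "x \<in> carrier (F p)" "y \<in> carrier (F p)"
  have "x \<oplus>\<^bsub>F p\<^esub> y \<in> carrier (F p)" using abelian_groupE(1)[OF abelian_F[OF p]] xy .
  then show "\<kappa> p (x \<oplus>\<^bsub>F p\<^esub> y) = \<kappa> p x \<oplus>\<^bsub>Orng\<^esub> \<kappa> p y"
    using xy p single_add[OF fr_closed[OF p one_closed] lm_Oc[OF p xy(1)] lm_Oc[OF p xy(2)]]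
    by (simp add: canonical_eq lm_add Oc_add[OF lm_el lm_el] del: hom_bimodule_simps)
qed (use p canonical_closed in blast)

lemma single_cl_closed: "el T p1 p2 \<Longrightarrow> single (fr p1 p2) (cl T p1 p2) \<in> carrier Orng"
  by (rule single_closed[OF fr_closed[OF elD(1,2)] cl_Oc])

lemma single_cl_mult:
  assumes "el S p1 p2" "el T p2 p3"
  shows "single (fr p1 p2) (cl S p1 p2) \<otimes>\<^bsub>Orng\<^esub> single (fr p2 p3) (cl T p2 p3)
    = single (fr p1 p3) (cl (compose (carrier (F p3)) S T) p1 p3)"
  using single_mult[OF fr_closed[OF elD(1,2)[OF assms(1)]] cl_Oc[OF assms(1)] fr_closed[OF elD(1,2)[OF assms(2)]] cl_Oc[OF assms(2)]]
  unfolding bm_cl[OF assms] fr_mult[OF elD(1,2)[OF assms(1)] elD(2)[OF assms(2)]] .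

lemma single_canonical:
  assumes "el T p1 p2" "x \<in> carrier (F p2)"
  shows "single (fr p1 p2) (cl T p1 p2) \<otimes>\<^bsub>Orng\<^esub> \<kappa> p2 x = \<kappa> p1 (T x)"
proof -
  note p = elD[OF assms(1)]
  show ?thesis
    unfolding canonical_eq[OF p(2) assms(2)] canonical_eq[OF p(1) H_closed[OF p assms(2)]]
      single_cl_mult[OF assms(1) lm_el[OF p(2) assms(2)]] compose_lm[OF p assms(2)] by (rule refl)
qed

text \<open>Represent \<kappa>_p(x) at (pq, q) instead of (p, 1). There it is the map y \<mapsto> x
  y from F_q to F_pq, and \<open>single_canonical\<close> applies.\<close>

lemma canonical_mult:
  assumes "p \<in> carrier P" "q \<in> carrier P" "x \<in> carrier (F p)" "y \<in> carrier (F q)"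
  shows "\<kappa> p x \<otimes>\<^bsub>Orng\<^esub> \<kappa> q y = \<kappa> (p \<otimes> q) (dmul p q x y)"
proof -
  have L: "el (lm p x) p \<one>" using assms by (intro lm_el)
  have S: "el (sh p \<one> q (lm p x)) (p \<otimes> q) q" using el_shift[OF L assms(2)] assms by simp
  have "\<kappa> p x = single (fr (p \<otimes> q) q) (cl (sh p \<one> q (lm p x)) (p \<otimes> q) q)"
    using fr_shift[OF assms(1) one_closed assms(2)] cl_shift[OF L assms(2)] assms
    by (simp add: canonical_eq)
  then have "\<kappa> p x \<otimes>\<^bsub>Orng\<^esub> \<kappa> q y = \<kappa> (p \<otimes> q) (sh p \<one> q (lm p x) y)"
    using single_canonical[OF S assms(4)] by (simp only:)
  then show ?thesis
    using assms by (simp add: shift_lm)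
qed

text \<open>A group record for H p1 p2, so that finite sums of maps can be formed and moved, by
  \<open>add_hom_finsum\<close>, through evaluation at a point and through the passage to classes in
  the ring.\<close>

definition HG :: "'p \<Rightarrow> 'p \<Rightarrow> ('a, 'a \<Rightarrow> 'a, 'a) bimodule" where
  "HG p1 p2 = (Hb p1 p2)\<lparr>carrier := H p1 p2\<rparr>"

lemma HG_simps: "carrier (HG p1 p2) = H p1 p2" "add (HG p1 p2) = add (Hb p1 p2)" "zero (HG p1 p2) = zero (Hb p1 p2)"
  by (simp_all add: HG_def)

lemma HG_abelian:
  assumes "p1 \<in> carrier P" "p2 \<in> carrier P"
  shows "abelian_group (HG p1 p2)"
proof (rule abelian_groupI, unfold HG_simps)
  interpret B: abelian_group "Hb p1 p2" using assms by (rule abelian_Hb)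
  have c: "x \<in> carrier (Hb p1 p2)" if "x \<in> H p1 p2" for x using H_RH[OF assms that] by simp
  show "\<zero>\<^bsub>Hb p1 p2\<^esub> \<in> H p1 p2" by (rule H_zero[OF assms])
  fix x assume x: "x \<in> H p1 p2"
  show "\<zero>\<^bsub>Hb p1 p2\<^esub> \<oplus>\<^bsub>Hb p1 p2\<^esub> x = x" by (rule B.l_zero[OF c[OF x]])
  show "\<exists>y\<in>H p1 p2. y \<oplus>\<^bsub>Hb p1 p2\<^esub> x = \<zero>\<^bsub>Hb p1 p2\<^esub>"
    using B.l_neg[OF c[OF x]] H_minus[OF assms x] by (rule bexI)
  fix y assume y: "y \<in> H p1 p2"
  show "x \<oplus>\<^bsub>Hb p1 p2\<^esub> y \<in> H p1 p2" by (rule H_add[OF assms x y])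
  show "x \<oplus>\<^bsub>Hb p1 p2\<^esub> y = y \<oplus>\<^bsub>Hb p1 p2\<^esub> x" by (rule B.a_comm[OF c[OF x] c[OF y]])
  fix z assume z: "z \<in> H p1 p2"
  show "x \<oplus>\<^bsub>Hb p1 p2\<^esub> y \<oplus>\<^bsub>Hb p1 p2\<^esub> z = x \<oplus>\<^bsub>Hb p1 p2\<^esub> (y \<oplus>\<^bsub>Hb p1 p2\<^esub> z)"
    by (rule B.a_assoc[OF c[OF x] c[OF y] c[OF z]])
qed

lemma HG_single_hom:
  assumes "p1 \<in> carrier P" "p2 \<in> carrier P"
  shows "(\<lambda>T. single (fr p1 p2) (cl T p1 p2)) \<in> add_hom (HG p1 p2) Orng"
proof (rule add_homI, unfold HG_simps)
  have el: "el T p1 p2" if "T \<in> H p1 p2" for T using that assms by (simp add: el_def)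
  show "single (fr p1 p2) (cl T p1 p2) \<in> carrier Orng" if "T \<in> H p1 p2" for T
    by (rule single_cl_closed[OF el[OF that]])
  show "single (fr p1 p2) (cl (S \<oplus>\<^bsub>Hb p1 p2\<^esub> T) p1 p2)
      = single (fr p1 p2) (cl S p1 p2) \<oplus>\<^bsub>Orng\<^esub> single (fr p1 p2) (cl T p1 p2)"
    if "S \<in> H p1 p2" "T \<in> H p1 p2" for S T
    unfolding single_add[OF fr_closed[OF assms] cl_Oc[OF el[OF that(1)]] cl_Oc[OF el[OF that(2)]], symmetric]
      Oc_add[OF el[OF that(1)] el[OF that(2)]] by (rule refl)
qed

lemma HG_eval_hom:
  assumes "p1 \<in> carrier P" "p2 \<in> carrier P" "y \<in> carrier (F p2)"
  shows "(\<lambda>T. T y) \<in> add_hom (HG p1 p2) (F p1)"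
  using assms H_closed[OF assms(1,2) _ assms(3)] by (intro add_homI) (simp_all add: HG_simps)

text \<open>The summand at x is the class at (p, p) of y \<mapsto> x \<phi> x(y). By hypothesis
  these maps add up to multiplication by e on F_p, which represents \<kappa>_1(e) by
  \<open>unit_cl\<close>.\<close>

lemma canonical_decomposition:
  assumes p: "p \<in> carrier P" and e: "e \<in> idempotents A"
    and X: "X \<subseteq> carrier (F p)" "\<And>x. x \<in> X \<Longrightarrow> \<phi> x \<in> H \<one> p"
    and sum: "\<And>y. y \<in> carrier (F p) \<Longrightarrow> finsum (F p) (\<lambda>x. x \<triangleleft>\<^bsub>F p\<^esub> \<phi> x y) X = e \<odot>\<^bsub>F p\<^esub> y"
  shows "finsum Orng (\<lambda>x. \<kappa> p x \<otimes>\<^bsub>Orng\<^esub> single (fr \<one> p) (cl (\<phi> x) \<one> p)) X = unit_at e"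
proof -
  have ec: "e \<in> carrier A" using e by (rule idempotentsD(1))
  interpret Or: abelian_group Orng by (rule O_abelian)
  define \<psi> where "\<psi> x = compose (carrier (F p)) (lm p x) (\<phi> x)" for x
  have el\<phi>: "el (\<phi> x) \<one> p" if "x \<in> X" for x using X(2)[OF that] p by (simp add: el_def)
  have ll: "el (lm p x) p \<one>" if "x \<in> X" for x using X(1) that p by (intro lm_el) auto
  have el\<psi>: "el (\<psi> x) p p" if "x \<in> X" for x unfolding \<psi>_def by (rule el_compose[OF ll[OF that] el\<phi>[OF that]])
  have \<psi>H: "\<psi> \<in> X \<rightarrow> carrier (HG p p)" using elD(3)[OF el\<psi>] by (auto simp: HG_simps)
  have prod: "\<kappa> p x \<otimes>\<^bsub>Orng\<^esub> single (fr \<one> p) (cl (\<phi> x) \<one> p) = single (fr p p) (cl (\<psi> x) p p)" if "x \<in> X" for x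
    unfolding canonical_eq[OF p subsetD[OF X(1) that]] \<psi>_def by (rule single_cl_mult[OF ll[OF that] el\<phi>[OF that]])
  note u = unit_cl[OF p ec]
  \<comment> \<open>The sum is formed among maps before passing to classes, because maps can be
    compared pointwise.\<close>
  have total: "finsum (HG p p) \<psi> X = (\<lambda>y\<in>carrier (F p). e \<odot>\<^bsub>F p\<^esub> y)"
  proof (rule H_eqI[OF p p _ elD(3)[OF u(1)]])
    show "finsum (HG p p) \<psi> X \<in> H p p"
      using abelian_monoid.finsum_closed[OF abelian_group.axioms(1)[OF HG_abelian[OF p p]] \<psi>H] by (simp add: HG_simps)
    fix y assume y: "y \<in> carrier (F p)"
    have "finsum (HG p p) \<psi> X y = finsum (F p) (\<lambda>x. \<psi> x y) X"
      by (rule add_hom_finsum[OF HG_abelian[OF p p] abelian_F[OF p] HG_eval_hom[OF p p y] \<psi>H])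
    also have "\<dots> = finsum (F p) (\<lambda>x. x \<triangleleft>\<^bsub>F p\<^esub> \<phi> x y) X"
    proof (rule abelian_monoid.finsum_cong'[OF abelian_group.axioms(1)[OF abelian_F[OF p]] refl])
      have c: "\<phi> x y \<in> carrier A" if "x \<in> X" for x using H_closed[OF one_closed p X(2)[OF that] y] .
      then show "(\<lambda>x. x \<triangleleft>\<^bsub>F p\<^esub> \<phi> x y) \<in> X \<rightarrow> carrier (F p)" using X(1) p by (auto intro!: ract_F)
      show "\<psi> x y = x \<triangleleft>\<^bsub>F p\<^esub> \<phi> x y" if "x \<in> X" for x
        using c[OF that] y by (simp add: \<psi>_def compose_eq lm_def)
    qed
    also have "\<dots> = (\<lambda>y\<in>carrier (F p). e \<odot>\<^bsub>F p\<^esub> y) y" using sum[OF y] y by simp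
    finally show "finsum (HG p p) \<psi> X y = (\<lambda>y\<in>carrier (F p). e \<odot>\<^bsub>F p\<^esub> y) y" .
  qed
  have "finsum Orng (\<lambda>x. \<kappa> p x \<otimes>\<^bsub>Orng\<^esub> single (fr \<one> p) (cl (\<phi> x) \<one> p)) X
      = finsum Orng (\<lambda>x. single (fr p p) (cl (\<psi> x) p p)) X"
    using single_cl_closed[OF el\<psi>] prod by (intro Or.finsum_cong') auto
  also have "\<dots> = single (fr p p) (cl (finsum (HG p p) \<psi> X) p p)"
    by (rule add_hom_finsum[OF HG_abelian[OF p p] O_abelian HG_single_hom[OF p p] \<psi>H, symmetric])
  also have "\<dots> = unit_at e"
    unfolding total u(2)[symmetric] fr_diag[OF p] unit_at_def by (rule refl)
  finally show ?thesis .
qed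

end

lemma pullback_simps [simp]:
  "carrier (pullback_bimodule f D) = carrier D" "add (pullback_bimodule f D) = add D"
  "zero (pullback_bimodule f D) = zero D" "smult (pullback_bimodule f D) = (\<lambda>a d. f a \<otimes>\<^bsub>D\<^esub> d)"
  by (simp_all add: pullback_bimodule_def)

section \<open>From nondegenerate homomorphisms to covariant representations\<close>

context proper_ore_diagram
begin

lemma pair_pullback:
  assumes "ring_with_local_units D" "p \<in> carrier P" "\<And>a. a \<in> carrier A \<Longrightarrow> n a \<in> carrier D"
  shows "tensor_pair A (F p) (pullback_bimodule n D)"
proof -
  interpret D: ring_with_local_units D by fact
  have "abelian_group (pullback_bimodule n D)" by (rule abelian_group_cong[OF D.abel]) auto
  then show ?thesis
    using assms by (auto simp: tensor_pair_def tensor_pair_axioms_def abelian_F ract_F D.m_closed)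
qed

text \<open>Nondegeneracy makes D the span of the products f(a) b, and \<kappa>_1(e) is a left unit
  of a for large e. So idempotents of F_1 provide left local units for D, which links D to the
  corners e F_p.\<close>

lemma nondegenerate_unit:
  assumes D: "ring_with_local_units D" and f: "f \<in> nondegenerate_ring_homs Orng D" and d: "d \<in> carrier D"
  shows "for_large A (\<lambda>e. f (unit_at e) \<otimes>\<^bsub>D\<^esub> d = d)"
proof -
  interpret D: ring_with_local_units D by fact
  have fh: "f \<in> add_hom Orng D" and fm: "\<And>\<xi> \<eta>. \<xi> \<in> carrier Orng \<Longrightarrow> \<eta> \<in> carrier Orng \<Longrightarrow> f (\<xi> \<otimes>\<^bsub>Orng\<^esub> \<eta>) = f \<xi> \<otimes>\<^bsub>D\<^esub> f \<eta>"
    and nd: "generate (add_monoid D) {f a \<otimes>\<^bsub>D\<^esub> b | a b. a \<in> carrier Orng \<and> b \<in> carrier D} = carrier D"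
    using f unfolding nondegenerate_ring_homs_def nondegenerate_hom_def by blast+
  note fc = add_hom_closed[OF fh]
  have uc: "f (unit_at e) \<in> carrier D" if "e \<in> carrier A" for e
    by (rule fc[OF unit_at_closed[OF that]])
  have gen: "for_large A (\<lambda>e. f (unit_at e) \<otimes>\<^bsub>D\<^esub> (f a \<otimes>\<^bsub>D\<^esub> b) = f a \<otimes>\<^bsub>D\<^esub> b)"
    if a: "a \<in> carrier Orng" and b: "b \<in> carrier D" for a b
    using O_unit[OF a]
  proof (rule A.for_large_mono)
    fix e assume e: "e \<in> carrier A" "unit_at e \<otimes>\<^bsub>Orng\<^esub> a = a \<and> a \<otimes>\<^bsub>Orng\<^esub> unit_at e = a"
    then show "f (unit_at e) \<otimes>\<^bsub>D\<^esub> (f a \<otimes>\<^bsub>D\<^esub> b) = f a \<otimes>\<^bsub>D\<^esub> b"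
      using D.m_assoc[OF uc[OF e(1)] fc[OF a] b] fm[OF unit_at_closed[OF e(1)] a] by simp
  qed
  have "for_large A (\<lambda>e. f (unit_at e) \<otimes>\<^bsub>D\<^esub> d = d)"
    if "d \<in> generate (add_monoid D) {f a \<otimes>\<^bsub>D\<^esub> b | a b. a \<in> carrier Orng \<and> b \<in> carrier D}" for d
    using that
  proof (induction rule: generate.induct)
    case one
    show ?case using A.for_large_True by (rule A.for_large_mono) (simp add: D.m_zero_right uc)
  next
    case (incl h)
    then show ?case using gen by blast
  next
    case (inv h)
    then obtain a b where ab: "a \<in> carrier Orng" "b \<in> carrier D" "h = f a \<otimes>\<^bsub>D\<^esub> b" by blast
    have h: "h \<in> carrier D" unfolding ab(3) by (rule D.m_closed[OF fc[OF ab(1)] ab(2)])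
    show ?case
      using gen[OF ab(1,2)] unfolding a_inv_def[symmetric] ab(3)[symmetric]
      by (rule A.for_large_mono) (simp add: add_hom_minus[OF D.abel D.abel D.lmult_add_hom[OF uc] h])
  next
    case (eng h k)
    have "h \<in> carrier D" "k \<in> carrier D" using eng.hyps unfolding nd by simp_all
    then show ?case
      using A.for_large_conj[OF eng.IH] by (elim A.for_large_mono) (simp add: D.r_distr uc)
  qed
  then show ?thesis using d unfolding nd by blast
qed

text \<open>Write v_x for the class of \<phi> x at (1, p). If f(\<kappa>_1(e)) k = k, then k is the
  sum of the elements \<nu>_p(x) (f(v_x) k), which gives surjectivity. For injectivity e has to fix
  the first entries of the given tensors; as it depends on them, only partial inverses arise, and
  \<open>tensor_iso_byI\<close> is made for these.\<close>

lemma composite_covariant: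
  assumes D: "ring_with_local_units D" and f: "f \<in> nondegenerate_ring_homs Orng D"
  shows "(\<lambda>p\<in>carrier P. compose (carrier (F p)) f (\<kappa> p)) \<in> covariant_representations P F \<mu> D"
proof -
  interpret D: ring_with_local_units D by fact
  have fh: "f \<in> add_hom Orng D" and fm: "\<And>\<xi> \<eta>. \<xi> \<in> carrier Orng \<Longrightarrow> \<eta> \<in> carrier Orng \<Longrightarrow> f (\<xi> \<otimes>\<^bsub>Orng\<^esub> \<eta>) = f \<xi> \<otimes>\<^bsub>D\<^esub> f \<eta>"
    using f unfolding nondegenerate_ring_homs_def by blast+
  note fc = add_hom_closed[OF fh]
  define \<nu> where "\<nu> = (\<lambda>p\<in>carrier P. compose (carrier (F p)) f (\<kappa> p))"
  have \<nu>: "\<nu> p x = f (\<kappa> p x)" if "p \<in> carrier P" "x \<in> carrier (F p)" for p x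
    using that by (simp add: \<nu>_def compose_eq)
  have \<nu>c: "\<nu> p x \<in> carrier D" if "p \<in> carrier P" "x \<in> carrier (F p)" for p x
    using that canonical_closed fc by (simp add: \<nu>)
  have \<nu>h: "\<nu> p \<in> add_hom (F p) D" if p: "p \<in> carrier P" for p
    using add_hom_compose[OF canonical_add_hom[OF p] fh] abelian_groupE(1)[OF abelian_F[OF p]] p
    by (simp add: hom_def \<nu> Pi_iff)
  have \<nu>m: "\<nu> p x \<otimes>\<^bsub>D\<^esub> \<nu> q y = \<nu> (p \<otimes> q) (dmul p q x y)"
    if "p \<in> carrier P" "q \<in> carrier P" "x \<in> carrier (F p)" "y \<in> carrier (F q)" for p q x y
    using that by (simp add: \<nu> dmul_closed fm[symmetric] canonical_closed canonical_mult)
  have "tensor_iso_by A (F p) (pullback_bimodule (\<nu> \<one>) D) D (\<lambda>x d. \<nu> p x \<otimes>\<^bsub>D\<^esub> d)" if p: "p \<in> carrier P" for p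
  proof -
    let ?D = "pullback_bimodule (\<nu> \<one>) D"
    interpret T: tensor_pair A "F p" ?D by (rule pair_pullback[OF D p \<nu>c[OF one_closed]])
    interpret TA: abelian_group "tensor A (F p) ?D" by (rule T.tensor_abelian)
    \<comment> \<open>Additive maps see only the carrier and the addition, so that maps on D count
      as maps on its pullback.\<close>
    have Dh: "add_hom D K = add_hom ?D K" for K :: "('x, 'y) ring_scheme" by (simp add: hom_def)
    show ?thesis
    proof (rule T.tensor_iso_byI[OF D.abel])
      show "balanced A (F p) ?D D (\<lambda>x d. \<nu> p x \<otimes>\<^bsub>D\<^esub> d)"
        unfolding balanced_def
      proof (intro conjI ballI)
        fix x assume "x \<in> carrier (F p)"
        then show "(\<lambda>d. \<nu> p x \<otimes>\<^bsub>D\<^esub> d) \<in> add_hom ?D D"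
          unfolding Dh[symmetric] by (intro D.lmult_add_hom \<nu>c p)
      next
        fix d assume "d \<in> carrier ?D"
        then show "(\<lambda>x. \<nu> p x \<otimes>\<^bsub>D\<^esub> d) \<in> add_hom (F p) D"
          using add_hom_compose[OF \<nu>h[OF p] D.rmult_add_hom] by simp
      next
        fix x a d assume x: "x \<in> carrier (F p)" and a: "a \<in> carrier A" and d: "d \<in> carrier ?D"
        have "\<nu> p (x \<triangleleft>\<^bsub>F p\<^esub> a) = \<nu> p x \<otimes>\<^bsub>D\<^esub> \<nu> \<one> a"
          using \<nu>m[OF p one_closed x a] p x a by (simp add: dmul_one_right)
        then show "\<nu> p (x \<triangleleft>\<^bsub>F p\<^esub> a) \<otimes>\<^bsub>D\<^esub> d = \<nu> p x \<otimes>\<^bsub>D\<^esub> (a \<odot>\<^bsub>?D\<^esub> d)"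
          using D.m_assoc[OF \<nu>c[OF p x] \<nu>c[OF one_closed a]] d by simp
      qed
    next
      fix k assume k: "k \<in> carrier D"
      obtain e where e: "e \<in> idempotents A" "f (unit_at e) \<otimes>\<^bsub>D\<^esub> k = k"
        using nondegenerate_unit[OF D f k] by (rule A.for_largeE)
      obtain X \<phi> where X: "finite X" "X \<subseteq> carrier (F p)" "\<forall>x\<in>X. \<phi> x \<in> H \<one> p"
        "\<forall>y\<in>carrier (F p). finsum (F p) (\<lambda>x. x \<triangleleft>\<^bsub>F p\<^esub> \<phi> x y) X = e \<odot>\<^bsub>F p\<^esub> y"
        using corner_dual_basis[OF p e(1)] by (elim exE conjE)
      define v where "v x = single (fr \<one> p) (cl (\<phi> x) \<one> p)" for x
      have vc: "v x \<in> carrier Orng" if "x \<in> X" for x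
        using X(3) that p unfolding v_def by (intro single_cl_closed) (simp add: el_def)
      have Kc: "\<kappa> p x \<in> carrier Orng" if "x \<in> X" for x using X(2) that p canonical_closed by blast
      have unit: "finsum Orng (\<lambda>x. \<kappa> p x \<otimes>\<^bsub>Orng\<^esub> v x) X = unit_at e"
        unfolding v_def using X by (intro canonical_decomposition[OF p e(1)]) simp_all
      have "k = f (finsum Orng (\<lambda>x. \<kappa> p x \<otimes>\<^bsub>Orng\<^esub> v x) X) \<otimes>\<^bsub>D\<^esub> k" unfolding unit using e(2) by (rule sym)
      also have "\<dots> = finsum D (\<lambda>x. f (\<kappa> p x \<otimes>\<^bsub>Orng\<^esub> v x) \<otimes>\<^bsub>D\<^esub> k) X"
        using vc Kc O_mult_closed
        by (intro add_hom_finsum[OF O_abelian D.abel add_hom_compose[OF fh D.rmult_add_hom[OF k]]]) auto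
      also have "\<dots> = finsum D (\<lambda>x. \<nu> p x \<otimes>\<^bsub>D\<^esub> (f (v x) \<otimes>\<^bsub>D\<^esub> k)) X"
      proof (rule D.finsum_cong'[OF refl])
        show "(\<lambda>x. \<nu> p x \<otimes>\<^bsub>D\<^esub> (f (v x) \<otimes>\<^bsub>D\<^esub> k)) \<in> X \<rightarrow> carrier D"
          using X(2) p \<nu>c fc[OF vc] k by (auto intro!: D.m_closed)
        show "f (\<kappa> p x \<otimes>\<^bsub>Orng\<^esub> v x) \<otimes>\<^bsub>D\<^esub> k = \<nu> p x \<otimes>\<^bsub>D\<^esub> (f (v x) \<otimes>\<^bsub>D\<^esub> k)" if "x \<in> X" for x
          using fm[OF Kc[OF that] vc[OF that]] D.m_assoc[OF fc[OF Kc[OF that]] fc[OF vc[OF that]] k] \<nu>[OF p] X(2) that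
          by auto
      qed
      finally have "k = finsum D (\<lambda>x. \<nu> p x \<otimes>\<^bsub>D\<^esub> (f (v x) \<otimes>\<^bsub>D\<^esub> k)) X" .
      moreover have "(\<lambda>x. f (v x) \<otimes>\<^bsub>D\<^esub> k) \<in> X \<rightarrow> carrier ?D"
        using fc[OF vc] k by (auto intro!: D.m_closed)
      ultimately show "\<exists>X\<subseteq>carrier (F p). \<exists>y\<in>X \<rightarrow> carrier ?D. k = finsum D (\<lambda>x. \<nu> p x \<otimes>\<^bsub>D\<^esub> y x) X"
        using X(2) by (intro exI[of _ X] conjI bexI[of _ "\<lambda>x. f (v x) \<otimes>\<^bsub>D\<^esub> k"])
    next
      fix U assume U: "finite U" "U \<subseteq> carrier (F p) \<times> carrier ?D"
      have U': "fst ` U \<subseteq> carrier (F p)" using U by auto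
      have "for_large A (\<lambda>e. \<forall>x\<in>fst ` U. e \<odot>\<^bsub>F p\<^esub> x = x)"
        using finite_imageI[OF U(1)] smooth_left_unit[OF base_ring left_F[OF p] smooth_F(1)[OF p] subsetD[OF U']]
        by (rule A.for_large_finite)
      then obtain e where e: "e \<in> idempotents A" "\<forall>x\<in>fst ` U. e \<odot>\<^bsub>F p\<^esub> x = x" by (rule A.for_largeE)
      obtain X \<phi> where X: "finite X" "X \<subseteq> carrier (F p)" "\<forall>x\<in>X. \<phi> x \<in> H \<one> p"
        "\<forall>y\<in>carrier (F p). finsum (F p) (\<lambda>x. x \<triangleleft>\<^bsub>F p\<^esub> \<phi> x y) X = e \<odot>\<^bsub>F p\<^esub> y"
        using corner_dual_basis[OF p e(1)] by (elim exE conjE)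
      define v where "v x = single (fr \<one> p) (cl (\<phi> x) \<one> p)" for x
      have el: "el (\<phi> x) \<one> p" if "x \<in> X" for x using X(3) that p by (simp add: el_def)
      have vc: "v x \<in> carrier Orng" if "x \<in> X" for x
        unfolding v_def by (rule single_cl_closed[OF el[OF that]])
      let ?t = "tensor_elem A (F p) ?D"
      \<comment> \<open>By \<open>f (v x) \<nu>\<^sub>p(y) = \<nu>\<^sub>1(\<phi> x y)\<close> and \<open>\<Sum> x \<cdot> \<phi> x y = e y\<close>, this inverts \<open>y \<otimes> d \<mapsto> \<nu>\<^sub>p(y) d\<close> on \<open>U\<close>.\<close>
      define s where "s d = finsum (tensor A (F p) ?D) (\<lambda>x. ?t x (f (v x) \<otimes>\<^bsub>D\<^esub> d)) X" for d
      have s_hom: "s \<in> add_hom D (tensor A (F p) ?D)"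
        unfolding s_def
      proof (rule add_hom_of_finsum[OF T.tensor_abelian])
        fix x assume x: "x \<in> X"
        have "?t x \<in> add_hom D (tensor A (F p) ?D)" unfolding Dh using T.tensor_elem_hom(1) x X(2) by blast
        then show "(\<lambda>d. ?t x (f (v x) \<otimes>\<^bsub>D\<^esub> d)) \<in> add_hom D (tensor A (F p) ?D)"
          by (rule add_hom_compose[OF D.lmult_add_hom[OF fc[OF vc[OF x]]]])
      qed
      have "s (\<nu> p y \<otimes>\<^bsub>D\<^esub> d) = ?t y d" if yd: "(y, d) \<in> U" for y d
      proof -
        have y: "y \<in> carrier (F p)" and d: "d \<in> carrier D" and ey: "e \<odot>\<^bsub>F p\<^esub> y = y"
          using yd U(2) e(2) by force+
        have pc: "\<phi> x y \<in> carrier A" if "x \<in> X" for x using H_closed[OF elD[OF el[OF that]] y] .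
        have tc: "?t (x \<triangleleft>\<^bsub>F p\<^esub> \<phi> x y) d \<in> carrier (tensor A (F p) ?D)" if "x \<in> X" for x
          using pc[OF that] X(2) that p d by (intro T.tensor_elem_closed ract_F) auto
        have step: "?t x (f (v x) \<otimes>\<^bsub>D\<^esub> (\<nu> p y \<otimes>\<^bsub>D\<^esub> d)) = ?t (x \<triangleleft>\<^bsub>F p\<^esub> \<phi> x y) d" if x: "x \<in> X" for x
        proof -
          have xF: "x \<in> carrier (F p)" using x X(2) by blast
          have "f (v x) \<otimes>\<^bsub>D\<^esub> \<nu> p y = \<nu> \<one> (\<phi> x y)"
            using fm[OF vc[OF x] canonical_closed[OF p y]] single_canonical[OF el[OF x] y] \<nu>[OF p y] \<nu>[OF one_closed pc[OF x]]
            by (simp add: v_def)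
          then have "f (v x) \<otimes>\<^bsub>D\<^esub> (\<nu> p y \<otimes>\<^bsub>D\<^esub> d) = \<phi> x y \<odot>\<^bsub>?D\<^esub> d"
            using D.m_assoc[OF fc[OF vc[OF x]] \<nu>c[OF p y] d] by simp
          then show ?thesis
            using balancedD(3)[OF T.tensor_elem_balanced xF pc[OF x], of d] d by simp
        qed
        have "s (\<nu> p y \<otimes>\<^bsub>D\<^esub> d) = finsum (tensor A (F p) ?D) (\<lambda>x. ?t (x \<triangleleft>\<^bsub>F p\<^esub> \<phi> x y) d) X"
          unfolding s_def using tc by (intro TA.finsum_cong' refl step) auto
        \<comment> \<open>The scalars \<phi> x(y) now stand in the first entry, so that the sum can
          be collected there and evaluated by the dual basis to e y = y.\<close>
        also have "\<dots> = ?t (finsum (F p) (\<lambda>x. x \<triangleleft>\<^bsub>F p\<^esub> \<phi> x y) X) d"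
          using X(2) pc p d
          by (intro add_hom_finsum[OF abelian_F[OF p] T.tensor_abelian T.tensor_elem_hom(2), symmetric])
            (auto intro!: ract_F)
        also have "\<dots> = ?t y d" using X(4) y ey by simp
        finally show ?thesis .
      qed
      then show "\<exists>s\<in>add_hom D (tensor A (F p) ?D). \<forall>(x, y)\<in>U. s (\<nu> p x \<otimes>\<^bsub>D\<^esub> y) = ?t x y"
        using s_hom by (intro bexI[of _ s]) auto
    qed
  qed
  then show ?thesis
    unfolding \<nu>_def[symmetric] covariant_representations_def
    using \<nu>h \<nu>m by (simp add: dmul_def) (simp add: \<nu>_def compose_def)
qed

end

section \<open>The universal property\<close>

locale covariant_representation = proper_ore_diagram P F \<mu> + D: ring_with_local_units D
  for P :: "'p monoid" (structure) and F :: "'p \<Rightarrow> ('a, 'a, 'a) bimodule"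
    and \<mu> :: "'p \<Rightarrow> 'p \<Rightarrow> (('a \<times> 'a) \<Rightarrow>\<^sub>0 int) set \<Rightarrow> 'a"
    and D :: "('d, 'm) ring_scheme" +
  fixes \<nu> :: "'p \<Rightarrow> 'a \<Rightarrow> 'd"
  assumes covariant: "\<nu> \<in> covariant_representations P F \<mu> D"
begin

lemma nu_hom: "p \<in> carrier P \<Longrightarrow> \<nu> p \<in> add_hom (F p) D"
  using covariant by (simp add: covariant_representations_def)

lemmas nu_closed = add_hom_closed[OF nu_hom]

lemma nu_mult:
  assumes "p \<in> carrier P" "q \<in> carrier P" "x \<in> carrier (F p)" "y \<in> carrier (F q)"
  shows "\<nu> p x \<otimes>\<^bsub>D\<^esub> \<nu> q y = \<nu> (p \<otimes> q) (dmul p q x y)"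
  using covariant assms by (simp add: covariant_representations_def dmul_def)

lemma nu_iso:
  "p \<in> carrier P \<Longrightarrow> tensor_iso_by A (F p) (pullback_bimodule (\<nu> \<one>) D) D (\<lambda>x d. \<nu> p x \<otimes>\<^bsub>D\<^esub> d)"
  using covariant by (simp add: covariant_representations_def)

lemma nu_pair: "p \<in> carrier P \<Longrightarrow> tensor_pair A (F p) (pullback_bimodule (\<nu> \<one>) D)"
  by (rule pair_pullback[OF D.ring_with_local_units_axioms _ nu_closed[OF one_closed]])

text \<open>For each single p the isomorphism is onto, so that products with first factor in the
  image of \<nu>_p already span D.\<close>

lemma nu_induct [consumes 2, case_names mult add]:
  assumes "p \<in> carrier P" "k \<in> carrier D"
    and "\<And>x d. x \<in> carrier (F p) \<Longrightarrow> d \<in> carrier D \<Longrightarrow> Q (\<nu> p x \<otimes>\<^bsub>D\<^esub> d)"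
    and "\<And>k l. k \<in> carrier D \<Longrightarrow> l \<in> carrier D \<Longrightarrow> Q k \<Longrightarrow> Q l \<Longrightarrow> Q (k \<oplus>\<^bsub>D\<^esub> l)"
  shows "Q k"
  using tensor_pair.tensor_iso_by_induct[OF nu_pair[OF assms(1)] nu_iso[OF assms(1)] assms(2), of Q] assms(3,4)
  by simp

lemma nu_ract: "p \<in> carrier P \<Longrightarrow> x \<in> carrier (F p) \<Longrightarrow> a \<in> carrier A \<Longrightarrow> \<nu> p (x \<triangleleft>\<^bsub>F p\<^esub> a) = \<nu> p x \<otimes>\<^bsub>D\<^esub> \<nu> \<one> a"
  using nu_mult[of p \<one> x a] by (simp add: dmul_one_right)

lemma nu_lact: "p \<in> carrier P \<Longrightarrow> x \<in> carrier (F p) \<Longrightarrow> a \<in> carrier A \<Longrightarrow> \<nu> p (a \<odot>\<^bsub>F p\<^esub> x) = \<nu> \<one> a \<otimes>\<^bsub>D\<^esub> \<nu> p x"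
  using nu_mult[of \<one> p a x] by (simp add: dmul_one_left)

text \<open>The products \<nu>_p(x) k span D, so that d and d' have equal products with all of D; a
  common right local unit of d and d' then gives d = d'.\<close>

lemma nu_right_cancel:
  assumes p: "p \<in> carrier P" and d: "d \<in> carrier D" "d' \<in> carrier D"
    and eq: "\<And>x. x \<in> carrier (F p) \<Longrightarrow> d \<otimes>\<^bsub>D\<^esub> \<nu> p x = d' \<otimes>\<^bsub>D\<^esub> \<nu> p x"
  shows "d = d'"
proof -
  have "finite {d, d'}" "{d, d'} \<subseteq> carrier D" using d by auto
  from D.local_units[OF this] obtain c where c: "c \<in> idempotents D"
    "\<forall>x\<in>{d, d'}. c \<otimes>\<^bsub>D\<^esub> x = x \<and> x \<otimes>\<^bsub>D\<^esub> c = x" by (rule bexE)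
  have "d \<otimes>\<^bsub>D\<^esub> k = d' \<otimes>\<^bsub>D\<^esub> k" if k: "k \<in> carrier D" for k
    using p k
  proof (induction rule: nu_induct)
    case (mult x k)
    then show ?case
      using D.m_assoc[OF d(1) nu_closed[OF p mult(1)] mult(2)] D.m_assoc[OF d(2) nu_closed[OF p mult(1)] mult(2)]
        eq[OF mult(1)] by simp
  next
    case (add k l)
    then show ?case using D.r_distr[OF add(1,2) d(1)] D.r_distr[OF add(1,2) d(2)] by simp
  qed
  from this[OF idempotentsD(1)[OF c(1)]] show ?thesis using c(2) by simp
qed

definition implements :: "'d \<Rightarrow> ('a \<Rightarrow> 'a) \<Rightarrow> 'p \<Rightarrow> 'p \<Rightarrow> bool" where
  "implements d T p1 p2 \<longleftrightarrow> d \<in> carrier D \<and> (\<forall>x\<in>carrier (F p2). d \<otimes>\<^bsub>D\<^esub> \<nu> p2 x = \<nu> p1 (T x))"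

lemma implements_unique:
  "p2 \<in> carrier P \<Longrightarrow> implements d T p1 p2 \<Longrightarrow> implements d' T p1 p2 \<Longrightarrow> d = d'"
  by (rule nu_right_cancel) (auto simp: implements_def)

text \<open>
  The operator \<open>T \<otimes> id\<close> on \<open>F\<^bsub>p2\<^esub> \<otimes> D \<cong> D\<close> maps \<open>d\<close> to \<open>h d\<close>.  Since \<open>T = T \<cdot> e\<close> for an idempotent \<open>e\<close>, it
  is left multiplication by \<open>h (\<nu> \<one> e)\<close>.
\<close>

lemma implements_ex:
  assumes el: "el T p1 p2"
  shows "\<exists>d. implements d T p1 p2"
proof -
  note p = elD[OF el]
  let ?D = "pullback_bimodule (\<nu> \<one>) D"
  interpret T: tensor_pair A "F p2" ?D by (rule nu_pair[OF p(2)])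
  note Tc = H_closed[OF p]
  have "balanced A (F p2) ?D D (\<lambda>x d. \<nu> p1 (T x) \<otimes>\<^bsub>D\<^esub> d)"
    unfolding balanced_def
  proof (intro conjI ballI)
    fix x assume "x \<in> carrier (F p2)"
    then show "(\<lambda>d. \<nu> p1 (T x) \<otimes>\<^bsub>D\<^esub> d) \<in> add_hom ?D D"
      using D.lmult_add_hom[OF nu_closed[OF p(1) Tc]] by (simp add: hom_def)
  next
    fix d assume "d \<in> carrier ?D"
    then show "(\<lambda>x. \<nu> p1 (T x) \<otimes>\<^bsub>D\<^esub> d) \<in> add_hom (F p2) D"
      using add_hom_compose[OF add_hom_compose[OF right_homD(1)[OF H_RH[OF p]] nu_hom[OF p(1)]] D.rmult_add_hom] by simp
  next
    fix x a d assume x: "x \<in> carrier (F p2)" and a: "a \<in> carrier A" and d: "d \<in> carrier ?D"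
    show "\<nu> p1 (T (x \<triangleleft>\<^bsub>F p2\<^esub> a)) \<otimes>\<^bsub>D\<^esub> d = \<nu> p1 (T x) \<otimes>\<^bsub>D\<^esub> (a \<odot>\<^bsub>?D\<^esub> d)"
      using D.m_assoc[OF nu_closed[OF p(1) Tc[OF x]] nu_closed[OF one_closed a]] d
      by (simp add: H_ract[OF p x a] nu_ract[OF p(1) Tc[OF x] a])
  qed
  from T.tensor_iso_by_universal[OF nu_iso[OF p(2)] D.abel this D.abel]
  obtain h where h: "h \<in> add_hom D D"
    "\<And>x d. x \<in> carrier (F p2) \<Longrightarrow> d \<in> carrier D \<Longrightarrow> h (\<nu> p2 x \<otimes>\<^bsub>D\<^esub> d) = \<nu> p1 (T x) \<otimes>\<^bsub>D\<^esub> d" by auto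
  \<comment> \<open>h is right D-linear: this holds on the products \<nu>_p2(x) k, which span D. It
    is what allows h(\<nu>_1(e)) to act as a left factor.\<close>
  have lin: "h k \<otimes>\<^bsub>D\<^esub> d = h (k \<otimes>\<^bsub>D\<^esub> d)" if k: "k \<in> carrier D" and d: "d \<in> carrier D" for k d
    using p(2) k
  proof (induction rule: nu_induct)
    case (mult x k)
    then show ?case
      using D.m_assoc[OF nu_closed[OF p(2) mult(1)] mult(2) d]
        D.m_assoc[OF nu_closed[OF p(1) Tc[OF mult(1)]] mult(2) d] d
      by (simp add: h(2) D.m_closed)
  next
    case (add k l)
    then show ?case
      using d add_hom_closed[OF h(1)] by (simp add: D.l_distr add_hom_add[OF h(1)] D.m_closed)
  qed
  obtain e where e: "e \<in> carrier A" "\<forall>x\<in>carrier (F p2). T (e \<odot>\<^bsub>F p2\<^esub> x) = T x"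
    using H_unit[OF p] by (rule A.for_largeE)
  have "h (\<nu> \<one> e) \<otimes>\<^bsub>D\<^esub> \<nu> p2 x = \<nu> p1 (T x)" if x: "x \<in> carrier (F p2)" for x
  proof -
    have ex: "e \<odot>\<^bsub>F p2\<^esub> x \<in> carrier (F p2)" by (rule lact_F[OF p(2) e(1) x])
    \<comment> \<open>The formula for h concerns products \<nu>_p2(x) d only. The local unit c makes
      \<nu>_p2(e x) such a product and disappears again after \<nu>_p1(T x).\<close>
    have "finite {\<nu> p2 (e \<odot>\<^bsub>F p2\<^esub> x), \<nu> p1 (T x)}" "{\<nu> p2 (e \<odot>\<^bsub>F p2\<^esub> x), \<nu> p1 (T x)} \<subseteq> carrier D"
      using nu_closed[OF p(2) ex] nu_closed[OF p(1) Tc[OF x]] by auto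
    from D.local_units[OF this] obtain c where c: "c \<in> idempotents D"
      "\<forall>k\<in>{\<nu> p2 (e \<odot>\<^bsub>F p2\<^esub> x), \<nu> p1 (T x)}. c \<otimes>\<^bsub>D\<^esub> k = k \<and> k \<otimes>\<^bsub>D\<^esub> c = k" by (rule bexE)
    have "h (\<nu> \<one> e) \<otimes>\<^bsub>D\<^esub> \<nu> p2 x = h (\<nu> p2 (e \<odot>\<^bsub>F p2\<^esub> x))"
      using lin[OF nu_closed[OF one_closed e(1)] nu_closed[OF p(2) x]] by (simp add: nu_lact[OF p(2) x e(1)])
    also have "\<dots> = h (\<nu> p2 (e \<odot>\<^bsub>F p2\<^esub> x) \<otimes>\<^bsub>D\<^esub> c)" using c(2) by simp
    also have "\<dots> = \<nu> p1 (T x) \<otimes>\<^bsub>D\<^esub> c"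
      unfolding h(2)[OF ex idempotentsD(1)[OF c(1)]] bspec[OF e(2) x] by (rule refl)
    also have "\<dots> = \<nu> p1 (T x)" using c(2) by simp
    finally show ?thesis .
  qed
  then have "implements (h (\<nu> \<one> e)) T p1 p2"
    using add_hom_closed[OF h(1) nu_closed[OF one_closed e(1)]] by (simp add: implements_def)
  then show ?thesis by (rule exI)
qed

text \<open>By multiplicativity of \<nu>, d \<nu>_p2(x) \<nu>_t(y) = \<nu>_p1(T x) \<nu>_t(y), and
  the right side is the value of \<nu> at T(x) y, the image of x y under the shift.\<close>

lemma implements_shift:
  assumes el: "el T p1 p2" and t: "t \<in> carrier P" and d: "implements d T p1 p2"
  shows "implements d (sh p1 p2 t T) (p1 \<otimes> t) (p2 \<otimes> t)"
proof -
  note p = elD[OF el] and S = elD[OF el_shift[OF el t]]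
  have dc: "d \<in> carrier D" using d by (simp add: implements_def)
  have "d \<otimes>\<^bsub>D\<^esub> \<nu> (p2 \<otimes> t) z = \<nu> (p1 \<otimes> t) (sh p1 p2 t T z)" if z: "z \<in> carrier (F (p2 \<otimes> t))" for z
    using p(2) t z
  proof (induction rule: F_induct)
    case (dmul x y)
    have "d \<otimes>\<^bsub>D\<^esub> (\<nu> p2 x \<otimes>\<^bsub>D\<^esub> \<nu> t y) = \<nu> p1 (T x) \<otimes>\<^bsub>D\<^esub> \<nu> t y"
      using D.m_assoc[OF dc nu_closed[OF p(2) dmul(1)] nu_closed[OF t dmul(2)]] d dmul(1) by (simp add: implements_def)
    then show ?case
      by (simp add: nu_mult[OF p(2) t dmul] nu_mult[OF p(1) t H_closed[OF p dmul(1)] dmul(2)]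
          H_shift_dmul[OF p(1,2) t p dmul])
  next
    case (add k l)
    then show ?case
      using D.r_distr[OF nu_closed[OF S(2) add(1)] nu_closed[OF S(2) add(2)] dc] H_closed[OF S]
      by (simp add: add_hom_add[OF nu_hom[OF S(2)]] add_hom_add[OF nu_hom[OF S(1)]] right_homD(5)[OF H_RH[OF S]])
  qed
  then show ?thesis using dc by (simp add: implements_def)
qed

text \<open>\<open>implements_shift\<close> only passes along arrows, whereas S has to be reached
  against one. So S is given its own element c, which exists by \<open>implements_ex\<close>; both c
  and d implement the common shift, and uniqueness there yields c = d.\<close>

lemma implements_cl:
  assumes el: "el T p1 p2" "el S q1 q2" and eq: "cl T p1 p2 = cl S q1 q2" and d: "implements d T p1 p2"
  shows "implements d S q1 q2"
proof -
  obtain t s where ts: "t \<in> carrier P" "s \<in> carrier P" "agree T p1 p2 t S q1 q2 s"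
    using eq unfolding cl_eq_iff[OF el] by blast
  obtain c where c: "implements c S q1 q2" using implements_ex[OF el(2)] by (rule exE)
  have "implements d (sh q1 q2 s S) (q1 \<otimes> s) (q2 \<otimes> s)"
    using implements_shift[OF el(1) ts(1) d] ts(3) by (simp add: agree_def)
  then have "d = c"
    using implements_shift[OF el(2) ts(2) c] elD(2)[OF el_shift[OF el(2) ts(2)]] by (intro implements_unique)
  then show ?thesis using c by simp
qed

text \<open>The value has to serve all representatives at once, so that it depends only on the
  class; by \<open>implements_cl\<close>, serving one of them suffices.\<close>

definition \<theta> :: "(('a \<Rightarrow> 'a) \<times> 'p \<times> 'p) set \<Rightarrow> 'd" where
  "\<theta> X = (THE d. \<forall>(T, p1, p2)\<in>X. implements d T p1 p2)"

lemma theta_eqI: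
  assumes el: "el T p1 p2" and d: "implements d T p1 p2"
  shows "\<theta> (cl T p1 p2) = d"
  unfolding \<theta>_def
proof (rule the_equality)
  show "\<forall>(S, q1, q2)\<in>cl T p1 p2. implements d S q1 q2"
  proof (rule ballI, clarify)
    fix S q1 q2 assume "(S, q1, q2) \<in> cl T p1 p2"
    from cl_mem[OF this] show "implements d S q1 q2" using implements_cl[OF el _ _ d] by simp
  qed
  show "c = d" if "\<forall>(S, q1, q2)\<in>cl T p1 p2. implements c S q1 q2" for c
  proof (rule implements_unique[OF elD(2)[OF el] _ d])
    show "implements c T p1 p2" using bspec[OF that cl_self[OF el]] by simp
  qed
qed

lemma theta_implements:
  assumes el: "el T p1 p2"
  shows "implements (\<theta> (cl T p1 p2)) T p1 p2"
proof -
  obtain d where d: "implements d T p1 p2" using implements_ex[OF el] by (rule exE)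
  show ?thesis unfolding theta_eqI[OF el d] by (rule d)
qed

lemma theta_closed: "X \<in> carrier (Oc g) \<Longrightarrow> \<theta> X \<in> carrier D"
  by (erule OcE) (use theta_implements in \<open>auto simp: implements_def\<close>)

lemma theta_hom: "\<theta> \<in> add_hom (Oc g) D"
proof (rule add_homI)
  fix X Y assume XY: "X \<in> carrier (Oc g)" "Y \<in> carrier (Oc g)"
  obtain S T p1 p2 where el: "el S p1 p2" "el T p1 p2" and X: "X = cl S p1 p2" "Y = cl T p1 p2"
    using XY by (rule Oc_match)
  note p = elD(1,2)[OF el(1)] and i = theta_implements[OF el(1)] theta_implements[OF el(2)]
  have "implements (\<theta> X \<oplus>\<^bsub>D\<^esub> \<theta> Y) (S \<oplus>\<^bsub>Hb p1 p2\<^esub> T) p1 p2"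
    using i H_closed[OF elD[OF el(1)]] H_closed[OF elD[OF el(2)]] nu_closed[OF p(2)]
    by (simp add: implements_def X D.l_distr add_hom_add[OF nu_hom[OF p(1)]])
  then show "\<theta> (X \<oplus>\<^bsub>Oc g\<^esub> Y) = \<theta> X \<oplus>\<^bsub>D\<^esub> \<theta> Y"
    unfolding X Oc_add[OF el] by (rule theta_eqI[OF el_add[OF el]])
qed (rule theta_closed)

text \<open>At composable representatives the two defining relations can be chained: the product of
  the implementing elements moves \<nu>(z) first to \<nu>(y z), then to \<nu>(x' (y z)).\<close>

lemma theta_mult:
  assumes "X \<in> carrier (Oc g)" "Y \<in> carrier (Oc h)"
  shows "\<theta> (bm X Y) = \<theta> X \<otimes>\<^bsub>D\<^esub> \<theta> Y"
proof -
  obtain x p1 p2 where x: "el x p1 p2" "g = fr p1 p2" "X = cl x p1 p2" using assms(1) by (rule OcE)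
  obtain t y p3 where y: "t \<in> carrier P" "el y (p2 \<otimes> t) p3" "h = fr (p2 \<otimes> t) p3" "Y = cl y (p2 \<otimes> t) p3"
    using x(1) assms(2) by (rule cl_matchE)
  obtain x' where x': "el x' (p1 \<otimes> t) (p2 \<otimes> t)" "cl x p1 p2 = cl x' (p1 \<otimes> t) (p2 \<otimes> t)"
    using x(1) y(1) by (rule cl_shiftE)
  have X: "X = cl x' (p1 \<otimes> t) (p2 \<otimes> t)" using x(3) x'(2) by simp
  note i = theta_implements[OF x'(1)] theta_implements[OF y(2)]
  have c: "\<theta> X \<in> carrier D" "\<theta> Y \<in> carrier D" using assms theta_closed by blast+
  have "implements (\<theta> X \<otimes>\<^bsub>D\<^esub> \<theta> Y) (compose (carrier (F p3)) x' y) (p1 \<otimes> t) p3"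
    unfolding implements_def
  proof (intro conjI ballI)
    show "\<theta> X \<otimes>\<^bsub>D\<^esub> \<theta> Y \<in> carrier D" using c by (rule D.m_closed)
    fix z assume z: "z \<in> carrier (F p3)"
    have "\<theta> X \<otimes>\<^bsub>D\<^esub> \<theta> Y \<otimes>\<^bsub>D\<^esub> \<nu> p3 z = \<theta> X \<otimes>\<^bsub>D\<^esub> \<nu> (p2 \<otimes> t) (y z)"
      using D.m_assoc[OF c nu_closed[OF elD(2)[OF y(2)] z]] i(2) z by (simp add: implements_def y(4))
    also have "\<dots> = \<nu> (p1 \<otimes> t) (x' (y z))"
      using i(1) H_closed[OF elD[OF y(2)] z] by (simp add: implements_def X)
    finally show "\<theta> X \<otimes>\<^bsub>D\<^esub> \<theta> Y \<otimes>\<^bsub>D\<^esub> \<nu> p3 z = \<nu> (p1 \<otimes> t) (compose (carrier (F p3)) x' y z)"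
      using z by (simp add: compose_eq)
  qed
  from theta_eqI[OF el_compose[OF x'(1) y(2)] this] show ?thesis
    unfolding X y(4) bm_cl[OF x'(1) y(2)] .
qed

lemma theta_zero: "g \<in> carrier G \<Longrightarrow> \<theta> \<zero>\<^bsub>Oc g\<^esub> = \<zero>\<^bsub>D\<^esub>"
  by (rule add_hom_zero[OF Oc_abelian D.abel theta_hom])

definition induced :: "(('p \<times> 'p) set \<Rightarrow> (('a \<Rightarrow> 'a) \<times> 'p \<times> 'p) set) \<Rightarrow> 'd" where
  "induced = (\<lambda>\<xi>\<in>carrier Orng. finsum D (\<lambda>g. \<theta> (\<xi> g)) (supp \<xi>))"

text \<open>The extra terms vanish, so that the images of two elements and of their sum can be
  written over one index set.\<close>

lemma induced_eq:
  assumes "\<xi> \<in> carrier Orng" "finite B" "supp \<xi> \<subseteq> B" "B \<subseteq> carrier G"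
  shows "induced \<xi> = finsum D (\<lambda>g. \<theta> (\<xi> g)) B"
proof -
  have "finsum D (\<lambda>g. \<theta> (\<xi> g)) (supp \<xi>) = finsum D (\<lambda>g. \<theta> (\<xi> g)) B"
  proof (rule D.add.finprod_mono_neutral_cong_left[OF assms(2,3)])
    show "(\<lambda>g. \<theta> (\<xi> g)) \<in> B \<rightarrow> carrier D"
      using theta_closed[OF O_mem[OF assms(1)]] assms(4) by auto
    show "\<theta> (\<xi> g) = \<zero>\<^bsub>D\<^esub>" if "g \<in> B - supp \<xi>" for g
      using that assms(4) theta_zero[of g] by (auto simp: supp_def)
  qed (rule refl)
  then show ?thesis using assms(1) by (simp add: induced_def)
qed

lemma induced_hom: "induced \<in> add_hom Orng D"
proof (rule add_homI)
  fix \<xi> assume x: "\<xi> \<in> carrier Orng"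
  show "induced \<xi> \<in> carrier D"
    unfolding induced_eq[OF x O_finite[OF x] order_refl supp_subset]
    using theta_closed[OF O_mem[OF x subsetD[OF supp_subset]]] by (intro D.finsum_closed) auto
next
  fix \<xi> \<eta> assume x: "\<xi> \<in> carrier Orng" and y: "\<eta> \<in> carrier Orng"
  let ?B = "supp \<xi> \<union> supp \<eta>"
  have B: "finite ?B" "?B \<subseteq> carrier G" using O_finite[OF x] O_finite[OF y] by (simp_all add: supp_subset)
  note m = O_mem[OF x subsetD[OF B(2)]] O_mem[OF y subsetD[OF B(2)]]
  have "induced (\<xi> \<oplus>\<^bsub>Orng\<^esub> \<eta>) = finsum D (\<lambda>g. \<theta> ((\<xi> \<oplus>\<^bsub>Orng\<^esub> \<eta>) g)) ?B"
    by (rule induced_eq[OF abelian_groupE(1)[OF O_abelian x y] B(1) supp_add[OF x y] B(2)])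
  also have "\<dots> = finsum D (\<lambda>g. \<theta> (\<xi> g) \<oplus>\<^bsub>D\<^esub> \<theta> (\<eta> g)) ?B"
  proof (rule D.finsum_cong'[OF refl])
    show "(\<lambda>g. \<theta> (\<xi> g) \<oplus>\<^bsub>D\<^esub> \<theta> (\<eta> g)) \<in> ?B \<rightarrow> carrier D"
      using theta_closed[OF m(1)] theta_closed[OF m(2)] by (intro Pi_I D.a_closed)
    show "\<theta> ((\<xi> \<oplus>\<^bsub>Orng\<^esub> \<eta>) g) = \<theta> (\<xi> g) \<oplus>\<^bsub>D\<^esub> \<theta> (\<eta> g)" if "g \<in> ?B" for g
      using add_hom_add[OF theta_hom m(1)[OF that] m(2)[OF that]] subsetD[OF B(2) that] by (simp add: O_add)
  qed
  also have "\<dots> = finsum D (\<lambda>g. \<theta> (\<xi> g)) ?B \<oplus>\<^bsub>D\<^esub> finsum D (\<lambda>g. \<theta> (\<eta> g)) ?B"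
    using theta_closed[OF m(1)] theta_closed[OF m(2)] by (intro D.finsum_addf Pi_I)
  also have "\<dots> = induced \<xi> \<oplus>\<^bsub>D\<^esub> induced \<eta>"
    using induced_eq[OF x B(1) _ B(2)] induced_eq[OF y B(1) _ B(2)] by simp
  finally show "induced (\<xi> \<oplus>\<^bsub>Orng\<^esub> \<eta>) = induced \<xi> \<oplus>\<^bsub>D\<^esub> induced \<eta>" .
qed

lemma induced_single:
  assumes "g \<in> carrier G" "X \<in> carrier (Oc g)"
  shows "induced (single g X) = \<theta> X"
  using induced_eq[OF single_closed[OF assms] _ single_supp] assms theta_closed[OF assms(2)]
  by (simp add: single_def)

text \<open>Both sides are additive in each variable, and for homogeneous elements the claim is
  \<open>theta_mult\<close>.\<close>

lemma induced_mult:
  assumes "\<xi> \<in> carrier Orng" "\<eta> \<in> carrier Orng"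
  shows "induced (\<xi> \<otimes>\<^bsub>Orng\<^esub> \<eta>) = induced \<xi> \<otimes>\<^bsub>D\<^esub> induced \<eta>"
  using assms(1)
proof (induction rule: O_induct)
  case (single g X)
  note gX = single
  show ?case using assms(2)
  proof (induction rule: O_induct)
    case (single h Y)
    show ?case
      unfolding single_mult[OF gX single] induced_single[OF gX] induced_single[OF single]
        induced_single[OF G_mult_closed[OF gX(1) single(1)] bm_closed[OF gX(2) single(2)]]
      by (rule theta_mult[OF gX(2) single(2)])
  next
    case (add \<xi> \<eta>)
    then show ?case
      using single_closed[OF gX] add_hom_closed[OF induced_hom]
      by (simp add: O_distr_right add_hom_add[OF induced_hom] O_mult_closed D.r_distr)
  qed
next
  case (add \<xi> \<xi>')
  then show ?case
    using assms(2) add_hom_closed[OF induced_hom]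
    by (simp add: O_distr_left add_hom_add[OF induced_hom] O_mult_closed D.l_distr)
qed

text \<open>The rule \<nu>_p(x z) = \<nu>_p(x) \<nu>_1(z) says that \<nu>_p(x) implements left
  multiplication by x.\<close>

lemma induced_canonical:
  assumes p: "p \<in> carrier P" and x: "x \<in> carrier (F p)"
  shows "induced (\<kappa> p x) = \<nu> p x"
proof -
  have "implements (\<nu> p x) (lm p x) p \<one>"
    using nu_closed[OF p x] nu_ract[OF p x] by (simp add: implements_def lm_def)
  then show ?thesis
    unfolding canonical_eq[OF p x] induced_single[OF fr_closed[OF p one_closed] lm_Oc[OF p x]]
    by (rule theta_eqI[OF lm_el[OF p x]])
qed

text \<open>Covariance at p = 1 makes D the span of products with first factor in \<nu>_1(F_1), and
  \<nu>_1 takes its values in the image of the induced map.\<close>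

lemma induced_nondegenerate: "induced \<in> nondegenerate_ring_homs Orng D"
proof -
  let ?S = "{induced a \<otimes>\<^bsub>D\<^esub> b | a b. a \<in> carrier Orng \<and> b \<in> carrier D}"
  have "?S \<subseteq> carrier D" using add_hom_closed[OF induced_hom] D.m_closed by blast
  then have "generate (add_monoid D) ?S \<subseteq> carrier D"
    using group.generate_incl[OF D.a_group, of ?S] by (simp only: partial_object.select_convs)
  moreover have "k \<in> generate (add_monoid D) ?S" if k: "k \<in> carrier D" for k
    using one_closed k
  proof (induction rule: nu_induct)
    case (mult x d)
    have "\<nu> \<one> x \<otimes>\<^bsub>D\<^esub> d = induced (\<kappa> \<one> x) \<otimes>\<^bsub>D\<^esub> d" by (simp only: induced_canonical[OF one_closed mult(1)])
    then show ?case using canonical_closed[OF one_closed mult(1)] mult(2) by (intro generate.incl) blast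
  next
    case (add k l)
    then show ?case using generate.eng[of k "add_monoid D" ?S l] by (simp only: monoid.simps)
  qed
  ultimately have "nondegenerate_hom Orng D induced" unfolding nondegenerate_hom_def by blast
  moreover have "induced \<in> carrier Orng \<rightarrow>\<^sub>E carrier D"
    using add_hom_closed[OF induced_hom] by (auto simp: induced_def)
  ultimately show ?thesis
    using induced_hom induced_mult by (simp add: nondegenerate_ring_homs_def)
qed

lemma induced_composite: "(\<lambda>p\<in>carrier P. compose (carrier (F p)) induced (\<kappa> p)) = \<nu>"
proof (rule extensionalityI)
  show "\<nu> \<in> extensional (carrier P)" using covariant by (simp add: covariant_representations_def)
  fix p assume p: "p \<in> carrier P"
  have "compose (carrier (F p)) induced (\<kappa> p) = \<nu> p"
  proof (rule extensionalityI[OF compose_extensional])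
    show "\<nu> p \<in> extensional (carrier (F p))" using covariant p by (simp add: covariant_representations_def)
  qed (simp add: compose_eq induced_canonical[OF p])
  then show "(\<lambda>p\<in>carrier P. compose (carrier (F p)) induced (\<kappa> p)) p = \<nu> p" using p by simp
qed simp

text \<open>Applying f to \<open>single_canonical\<close> shows that the image of the class of T
  implements T, and implementing elements are unique. Homogeneous elements generate the ring
  additively.\<close>

lemma ring_hom_determined:
  assumes f: "f \<in> nondegenerate_ring_homs Orng D"
    and eq: "\<And>p x. p \<in> carrier P \<Longrightarrow> x \<in> carrier (F p) \<Longrightarrow> f (\<kappa> p x) = \<nu> p x"
  shows "f = induced"
proof (rule extensionalityI)
  have fh: "f \<in> add_hom Orng D" and fm: "\<And>\<xi> \<eta>. \<xi> \<in> carrier Orng \<Longrightarrow> \<eta> \<in> carrier Orng \<Longrightarrow> f (\<xi> \<otimes>\<^bsub>Orng\<^esub> \<eta>) = f \<xi> \<otimes>\<^bsub>D\<^esub> f \<eta>"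
    using f unfolding nondegenerate_ring_homs_def by blast+
  show "f \<in> extensional (carrier Orng)" using f by (auto simp: nondegenerate_ring_homs_def PiE_def)
  show "induced \<in> extensional (carrier Orng)" by (simp add: induced_def)
  fix \<xi> assume "\<xi> \<in> carrier Orng"
  then show "f \<xi> = induced \<xi>"
  proof (induction rule: O_induct)
    case (single g X)
    obtain T p1 p2 where T: "el T p1 p2" "g = fr p1 p2" "X = cl T p1 p2" using single(2) by (rule OcE)
    note p = elD[OF T(1)] and sc = single_closed[OF single]
    have "implements (f (single g X)) T p1 p2"
      unfolding implements_def
    proof (intro conjI ballI)
      show "f (single g X) \<in> carrier D" by (rule add_hom_closed[OF fh sc])
      fix x assume x: "x \<in> carrier (F p2)"
      have "f (single g X) \<otimes>\<^bsub>D\<^esub> \<nu> p2 x = f (single g X \<otimes>\<^bsub>Orng\<^esub> \<kappa> p2 x)"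
        by (simp only: fm[OF sc canonical_closed[OF p(2) x]] eq[OF p(2) x])
      also have "\<dots> = \<nu> p1 (T x)"
        unfolding T(2,3) single_canonical[OF T(1) x] by (rule eq[OF p(1) H_closed[OF p x]])
      finally show "f (single g X) \<otimes>\<^bsub>D\<^esub> \<nu> p2 x = \<nu> p1 (T x)" .
    qed
    then have "\<theta> X = f (single g X)" using theta_eqI[OF T(1)] by (simp only: T(3))
    then show ?case using induced_single[OF single] by (simp only:)
  next
    case (add \<xi> \<eta>)
    then show ?case by (simp add: add_hom_add[OF fh] add_hom_add[OF induced_hom])
  qed
qed

end

section \<open>The bijection between homomorphisms and covariant representations\<close>

context proper_ore_diagram
begin

text \<open>A local unit e of \<xi> writes \<xi> as the product e \<xi>.\<close>

lemma identity_nondegenerate: "(\<lambda>\<xi>\<in>carrier Orng. \<xi>) \<in> nondegenerate_ring_homs Orng Orng"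
proof -
  interpret Or: ring_with_local_units Orng by (rule O_local_units)
  let ?S = "{(\<lambda>\<xi>\<in>carrier Orng. \<xi>) a \<otimes>\<^bsub>Orng\<^esub> b | a b. a \<in> carrier Orng \<and> b \<in> carrier Orng}"
  have "?S \<subseteq> carrier Orng"
    by (intro subsetI, elim CollectE exE conjE) (simp only: restrict_apply' O_mult_closed)
  then have "generate (add_monoid Orng) ?S \<subseteq> carrier Orng"
    using group.generate_incl[OF Or.a_group, of ?S] by (simp only: partial_object.select_convs)
  moreover have "\<xi> \<in> generate (add_monoid Orng) ?S" if x: "\<xi> \<in> carrier Orng" for \<xi>
  proof (rule generate.incl)
    have "finite {\<xi>}" "{\<xi>} \<subseteq> carrier Orng" using x by auto
    from Or.local_units[OF this] obtain e where e: "e \<in> idempotents Orng" "e \<otimes>\<^bsub>Orng\<^esub> \<xi> = \<xi>" by blast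
    have ec: "e \<in> carrier Orng" by (rule idempotentsD(1)[OF e(1)])
    have "\<xi> = (\<lambda>\<xi>\<in>carrier Orng. \<xi>) e \<otimes>\<^bsub>Orng\<^esub> \<xi>" unfolding restrict_apply'[OF ec] e(2) by (rule refl)
    from this ec x show "\<xi> \<in> ?S" by (intro CollectI) blast
  qed
  ultimately have "nondegenerate_hom Orng Orng (\<lambda>\<xi>\<in>carrier Orng. \<xi>)" unfolding nondegenerate_hom_def by blast
  then show ?thesis
    using O_mult_closed Or.a_closed by (simp add: nondegenerate_ring_homs_def hom_def)
qed

lemma canonical_covariant: "\<kappa> \<in> covariant_representations P F \<mu> Orng"
proof -
  have "(\<lambda>p\<in>carrier P. compose (carrier (F p)) (\<lambda>\<xi>\<in>carrier Orng. \<xi>) (\<kappa> p)) = \<kappa>"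
  proof (rule extensionalityI)
    show "\<kappa> \<in> extensional (carrier P)" by (simp add: O_canonical_def)
    fix p assume p: "p \<in> carrier P"
    have "compose (carrier (F p)) (\<lambda>\<xi>\<in>carrier Orng. \<xi>) (\<kappa> p) = \<kappa> p"
    proof (rule extensionalityI[OF compose_extensional])
      show "\<kappa> p \<in> extensional (carrier (F p))" using p by (simp add: O_canonical_def)
    qed (simp add: compose_eq canonical_closed[OF p])
    then show "(\<lambda>p\<in>carrier P. compose (carrier (F p)) (\<lambda>\<xi>\<in>carrier Orng. \<xi>) (\<kappa> p)) p = \<kappa> p" using p by simp
  qed simp
  then show ?thesis using composite_covariant[OF O_local_units identity_nondegenerate] by simp
qed

lemma composite_bij:
  assumes D: "ring_with_local_units D"
  shows "bij_betw (\<lambda>f. \<lambda>p\<in>carrier P. compose (carrier (F p)) f (\<kappa> p))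
    (nondegenerate_ring_homs Orng D) (covariant_representations P F \<mu> D)"
  unfolding bij_betw_def
proof (intro conjI inj_onI equalityI subsetI)
  let ?c = "\<lambda>f. \<lambda>p\<in>carrier P. compose (carrier (F p)) f (\<kappa> p)"
  have rep: "covariant_representation P F \<mu> D \<nu>" if "\<nu> \<in> covariant_representations P F \<mu> D" for \<nu>
    using that D proper_ore_diagram_axioms
    by (simp add: covariant_representation_def covariant_representation_axioms_def)
  {
    fix f f' assume f: "f \<in> nondegenerate_ring_homs Orng D" and f': "f' \<in> nondegenerate_ring_homs Orng D"
      and eq: "?c f = ?c f'"
    \<comment> \<open>The representation obtained from f is by \<open>eq\<close> also the one
      obtained from f', so that both homomorphisms coincide with the one that it induces.\<close>
    interpret covariant_representation P F \<mu> D "?c f" by (rule rep[OF composite_covariant[OF D f]])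
    have "f = induced" by (rule ring_hom_determined[OF f]) (simp add: compose_eq)
    moreover have "f' = induced"
      by (rule ring_hom_determined[OF f']) (simp only: eq, simp add: compose_eq)
    ultimately show "f = f'" by simp
  }
  show "\<nu> \<in> covariant_representations P F \<mu> D" if "\<nu> \<in> ?c ` nondegenerate_ring_homs Orng D" for \<nu>
    using that by (elim imageE) (simp only: composite_covariant[OF D])
  show "\<nu> \<in> ?c ` nondegenerate_ring_homs Orng D" if "\<nu> \<in> covariant_representations P F \<mu> D" for \<nu>
  proof -
    interpret covariant_representation P F \<mu> D \<nu> by (rule rep[OF that])
    show ?thesis using induced_composite[symmetric] induced_nondegenerate by (rule image_eqI)
  qed
qed

end

theorem theorem5p19:
  fixes P :: "'p monoid"
    and F :: "'p \<Rightarrow> ('a, 'a, 'a) bimodule"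
    and \<mu> :: "'p \<Rightarrow> 'p \<Rightarrow> (('a \<times> 'a) \<Rightarrow>\<^sub>0 int) set \<Rightarrow> 'a"
  assumes "proper_ore_diagram P F \<mu>"
  shows "ring_with_local_units (O_ring P F \<mu>) \<and>
    O_canonical P F \<mu> \<in> covariant_representations P F \<mu> (O_ring P F \<mu>) \<and>
    (\<forall>D :: 'd ring. ring_with_local_units D \<longrightarrow>
      bij_betw
        (\<lambda>f. \<lambda>p\<in>carrier P. compose (carrier (F p)) f (O_canonical P F \<mu> p))
        (nondegenerate_ring_homs (O_ring P F \<mu>) D)
        (covariant_representations P F \<mu> D))"
proof -
  interpret proper_ore_diagram P F \<mu> by fact
  show ?thesis using O_local_units canonical_covariant composite_bij by blast
qed

end
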